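(* Each of the three families $\{p_I\}$ (power sum functions), $\{e_I\}$ (elementary functions) and $\{h_I\}$ (complete homogeneous functions), where $I$ runs over all set superpartitions (of all bidegrees), is a basis of the $\mathbb Q$-algebra $\mathbf{sNCSym}$ (as a vector space).
   Context: Combinatorial objects. $[n]=\{1,\dots,n\}$, $[n]_0=[n]\cup\{0\}$, and $A^+=A\setminus\{0\}$. For $0\le m\le n+1$, a partial set supercomposition of bidegree $(n,m)$ (degree $n$, fermionic degree $m$) is a tuple $K=(K_1,\dots,K_q)$ of nonempty subsets of $[n]_0$ (blocks) such that $K_1^+\cup\dots\cup K_q^+=[n]$, $K_i\cap K_j\subseteq\{0\}$ for $i\ne j$, $0\in K_i$ exactly for $i\le m$ (these are the fermionic blocks), and the nonfermionic blocks $K_{m+1},\dots,K_q$ are ordered by increasing minimum. $s\mathcal C_{n,m}$ is the set of these. A set superpartition is a partial set supercomposition $I=(I_1,\dots,I_k)$ with $I_i\ne I_j$ and $\min(I_i\setminus I_j)<\min(I_j\setminus I_i)$ for all $i<j$, where $\min(\emptyset):=0$. For $K,L\in s\mathcal C_{n,m}$ write $K\sqsubseteq L$ if, for every $i\in[m]$, the $i$th fermionic block of $L$ is the union of the $i$th fermionic block of $K$ with some (possibly no) nonfermionic blocks of $K$, and each nonfermionic block of $L$ is a union of nonfermionic blocks of $K$. This is a partial order making $s\mathcal C_{n,m}$ a meet-semilattice, with meet denoted $\sqcap$. For a tuple of sets $N=(N_1,\dots,N_r)$, $N!=|N_1|!\cdots|N_r|!$ (the element $0$ is counted in the cardinalities).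 Functions. Let $\mathcal A$ be the $\mathbb Q$-algebra of formal power series of bounded degree in variables $x_1,x_2,\dots$ and $\theta_1,\theta_2,\dots$ subject only to $x_i\theta_j=\theta_jx_i$ and $\theta_i\theta_j=-\theta_j\theta_i$ for all $i,j$ (so $\theta_i^2=0$ and the $x_i$ do not commute with each other). $\mathbf{sNCSym}\subset\mathcal A$ is the subalgebra of elements invariant under all finite permutations acting simultaneously on indices of $x$ and $\theta$. For $K\in s\mathcal C_{n,m}$, each function below is a sum over words $\theta_{a_1}\cdots\theta_{a_m}x_{b_1}\cdots x_{b_n}$ with positive integer indices: - $M(K)$ is the set of words with, for $i\in[m]$, $a_i=b_j$ iff $j\in K_i^+$, and, for $i,j\in[n]$, $b_i=b_j$ iff $i,j$ lie in the same block of $K$. - $p_K$ is the sum of all words such that $a_i=b_j$ whenever $i\in[m]$, $j\in K_i^+$, and $b_i=b_j$ whenever $i,j\in[n]$ lie in the same block of $K$. - $e_K$ is the sum of all words such that $a_i\ne b_j$ whenever $i\in[m]$, $j\in K_i^+$, and $b_i\neq b_j$ whenever $i\ne j$ in $[n]$ lie in the same block of $K$. - $h_K=\sum_u c_u\,u$, over all words $u$ with $a_1,\dots,a_m$ pairwise distinct and such that $\{a_1,\dots,a_m\}\setminus\{b_1,\dots,b_n\}$ has at most one element, where $c_u=(K\sqcap L)!$ and $L$ is the unique element of $s\mathcal C_{n,m}$ with $u\in M(L)$. *)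

theory Defs
  imports Complex_Main "HOL-Combinatorics.Permutations"
begin

section \<open>Set supercompositions and set superpartitions\<close>

text \<open>
  Tuples of blocks are lists of sets of natural numbers; lists are indexed from 0, so the
  $i$-th block is \<open>K ! (i - 1)\<close>, and the fermionic blocks are the \<open>K ! i\<close> with \<open>i < m\<close>.
  The elements of the blocks themselves are numbered as usual: they lie in \<open>{0..n}\<close>.
\<close>

definition pos :: "nat set \<Rightarrow> nat set" where
  "pos A = A - {0}"

definition sC :: "nat \<Rightarrow> nat \<Rightarrow> nat set list set" where
  "sC n m = {K. m \<le> n + 1 \<and> m \<le> length K \<and>
     (\<forall>B\<in>set K. B \<noteq> {} \<and> B \<subseteq> {0..n}) \<and>
     (\<Union>B\<in>set K. pos B) = {1..n} \<and>
     (\<forall>i<length K. \<forall>j<length K. i \<noteq> j \<longrightarrow> K ! i \<inter> K ! j \<subseteq> {0}) \<and>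
     (\<forall>i<length K. 0 \<in> K ! i \<longleftrightarrow> i < m) \<and>
     (\<forall>i j. m \<le> i \<and> i < j \<and> j < length K \<longrightarrow> Min (K ! i) < Min (K ! j))}"

text \<open>The bidegree can be read off from the tuple, see \<open>sC_bidegree\<close> below.\<close>

definition deg :: "nat set list \<Rightarrow> nat" where
  "deg K = card (\<Union>B\<in>set K. pos B)"

definition fdeg :: "nat set list \<Rightarrow> nat" where
  "fdeg K = length (filter (\<lambda>B. 0 \<in> B) K)"

lemma sC_bidegree:
  assumes "K \<in> sC n m"
  shows "deg K = n" "fdeg K = m"
proof -
  show "deg K = n" using assms by (simp add: deg_def sC_def)
  have "{i. i < length K \<and> 0 \<in> K ! i} = {..<m}"
    using assms by (auto simp: sC_def)
  then show "fdeg K = m" by (simp add: fdeg_def length_filter_conv_card)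
qed

definition min0 :: "nat set \<Rightarrow> nat" where
  "min0 A = (if A = {} then 0 else Min A)"

definition superpartitions :: "nat set list set" where
  "superpartitions = {I. (\<exists>n m. I \<in> sC n m) \<and>
     (\<forall>i j. i < j \<and> j < length I \<longrightarrow>
        I ! i \<noteq> I ! j \<and> min0 (I ! i - I ! j) < min0 (I ! j - I ! i))}"

definition refines :: "nat \<Rightarrow> nat set list \<Rightarrow> nat set list \<Rightarrow> bool" where
  "refines m K L \<longleftrightarrow>
     (\<forall>i<m. \<exists>S \<subseteq> set (drop m K). L ! i = K ! i \<union> \<Union>S) \<and>
     (\<forall>B\<in>set (drop m L). \<exists>S \<subseteq> set (drop m K). B = \<Union>S)"

definition is_meet :: "nat \<Rightarrow> nat \<Rightarrow> nat set list \<Rightarrow> nat set list \<Rightarrow> nat set list \<Rightarrow> bool" where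
  "is_meet n m K L J \<longleftrightarrow> J \<in> sC n m \<and> refines m J K \<and> refines m J L \<and>
     (\<forall>J'\<in>sC n m. refines m J' K \<and> refines m J' L \<longrightarrow> refines m J' J)"

definition meet :: "nat \<Rightarrow> nat \<Rightarrow> nat set list \<Rightarrow> nat set list \<Rightarrow> nat set list" where
  "meet n m K L = (THE J. is_meet n m K L J)"

definition tuple_fact :: "nat set list \<Rightarrow> nat" where
  "tuple_fact N = (\<Prod>B\<leftarrow>N. fact (card B))"


section \<open>The algebra of power series in non-commuting and anticommuting variables\<close>

text \<open>
  Using the defining relations, every monomial in the variables is zero or, up to sign,
  equal to exactly one of the form $\theta_{s_1}\cdots\theta_{s_k}x_{w_1}\cdots x_{w_l}$ with
  $s_1<\dots<s_k$. Such a monomial is encoded by the finite set \<open>S = {s\<^sub>1,\<dots>,s\<^sub>k}\<close> and the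
  list \<open>w\<close>, and a series by its coefficients. The index set is all of type \<open>nat\<close>: the
  number \<open>i\<close> stands for the index $i+1$.
\<close>

definition bounded_degree :: "(nat set \<Rightarrow> nat list \<Rightarrow> rat) \<Rightarrow> bool" where
  "bounded_degree f \<longleftrightarrow>
     (\<exists>d. \<forall>S w. f S w \<noteq> 0 \<longrightarrow> finite S \<and> card S + length w \<le> d)"

typedef superseries = "{f. bounded_degree f}"
  morphisms coeff Abs_superseries
  by (rule exI[of _ "\<lambda>_ _. 0"]) (simp add: bounded_degree_def)

lemma bounded_coeff [simp]: "bounded_degree (coeff f)"
  using coeff by blast

lemma coeff_Abs: "bounded_degree f \<Longrightarrow> coeff (Abs_superseries f) = f"
  by (simp add: Abs_superseries_inverse)

lemma coeff_infinite: "infinite S \<Longrightarrow> coeff f S w = 0"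
  using bounded_coeff[of f] unfolding bounded_degree_def by blast

lemma superseries_eqI: "(\<And>S w. finite S \<Longrightarrow> coeff f S w = coeff g S w) \<Longrightarrow> f = g"
  by (metis coeff_infinite coeff_inject ext)

text \<open>Sign of the permutation sorting the elements of \<open>S\<close> followed by those of \<open>T\<close>.\<close>

definition shuffle_sign :: "nat set \<Rightarrow> nat set \<Rightarrow> rat" where
  "shuffle_sign S T = (-1) ^ card {(i, j). i \<in> S \<and> j \<in> T \<and> j < i}"

definition mult_coeff ::
  "(nat set \<Rightarrow> nat list \<Rightarrow> rat) \<Rightarrow> (nat set \<Rightarrow> nat list \<Rightarrow> rat) \<Rightarrow> nat set \<Rightarrow> nat list \<Rightarrow> rat" where
  "mult_coeff f g S w =
     (\<Sum>T\<in>Pow S. \<Sum>k\<le>length w.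
        shuffle_sign T (S - T) * f T (take k w) * g (S - T) (drop k w))"

lemma bounded_degree_add:
  assumes "bounded_degree f" "bounded_degree g"
  shows "bounded_degree (\<lambda>S w. f S w + g S w)"
proof -
  obtain c d where c: "\<And>S w. f S w \<noteq> 0 \<Longrightarrow> finite S \<and> card S + length w \<le> c"
    and d: "\<And>S w. g S w \<noteq> 0 \<Longrightarrow> finite S \<and> card S + length w \<le> d"
    using assms unfolding bounded_degree_def by blast
  have "finite S \<and> card S + length w \<le> max c d" if "f S w + g S w \<noteq> 0" for S w
    using c[of S w] d[of S w] that by (cases "f S w = 0") auto
  then show ?thesis unfolding bounded_degree_def by blast
qed

lemma bounded_degree_scale:
  "bounded_degree f \<Longrightarrow> bounded_degree (\<lambda>S w. c * f S w)"
  unfolding bounded_degree_def by auto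

lemma bounded_degree_mult:
  assumes "bounded_degree f" "bounded_degree g"
  shows "bounded_degree (mult_coeff f g)"
proof -
  obtain c d where c: "\<And>S w. f S w \<noteq> 0 \<Longrightarrow> finite S \<and> card S + length w \<le> c"
    and d: "\<And>S w. g S w \<noteq> 0 \<Longrightarrow> finite S \<and> card S + length w \<le> d"
    using assms unfolding bounded_degree_def by blast
  have "finite S \<and> card S + length w \<le> c + d" if nz: "mult_coeff f g S w \<noteq> 0" for S w
  proof -
    obtain T where T: "T \<subseteq> S"
      and "(\<Sum>k\<le>length w. shuffle_sign T (S - T) * f T (take k w) * g (S - T) (drop k w)) \<noteq> 0"
      using nz unfolding mult_coeff_def by (metis (no_types, lifting) PowD sum.neutral)
    then obtain k where k: "k \<le> length w" "f T (take k w) \<noteq> 0" "g (S - T) (drop k w) \<noteq> 0"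
      by (metis (no_types, lifting) atMost_iff mult_eq_0_iff sum.neutral)
    have "finite T" "finite (S - T)" using c d k by blast+
    then have fin: "finite S" by simp
    have "card S = card T + card (S - T)"
      using T fin by (metis add.commute card_Diff_subset card_mono finite_subset le_add_diff_inverse2)
    moreover have "length (take k w) + length (drop k w) = length w" using k(1) by simp
    ultimately show ?thesis using fin c[OF k(2)] d[OF k(3)] by linarith
  qed
  then show ?thesis unfolding bounded_degree_def by blast
qed

lemma shuffle_sign_empty [simp]: "shuffle_sign {} T = 1" "shuffle_sign S {} = 1"
  by (simp_all add: shuffle_sign_def)

lemma shuffle_sign_Un1:
  assumes "finite S" "finite S'" "finite T" "S \<inter> S' = {}"
  shows "shuffle_sign (S \<union> S') T = shuffle_sign S T * shuffle_sign S' T"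
proof -
  let ?I = "\<lambda>A. {(i, j). i \<in> A \<and> j \<in> T \<and> j < i}"
  have "?I (S \<union> S') = ?I S \<union> ?I S'" "?I S \<inter> ?I S' = {}" using assms by auto
  moreover have "finite (?I S)" "finite (?I S')"
    by (rule finite_subset[of _ "S \<times> T"] finite_subset[of _ "S' \<times> T"]; use assms in auto)+
  ultimately show ?thesis by (simp add: shuffle_sign_def card_Un_disjoint power_add)
qed

lemma shuffle_sign_Un2:
  assumes "finite S" "finite T" "finite T'" "T \<inter> T' = {}"
  shows "shuffle_sign S (T \<union> T') = shuffle_sign S T * shuffle_sign S T'"
proof -
  let ?I = "\<lambda>A. {(i, j). i \<in> S \<and> j \<in> A \<and> j < i}"
  have "?I (T \<union> T') = ?I T \<union> ?I T'" "?I T \<inter> ?I T' = {}" using assms by auto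
  moreover have "finite (?I T)" "finite (?I T')"
    by (rule finite_subset[of _ "S \<times> T"] finite_subset[of _ "S \<times> T'"]; use assms in auto)+
  ultimately show ?thesis by (simp add: shuffle_sign_def card_Un_disjoint power_add)
qed

lemma mult_coeff_assoc:
  assumes "finite S"
  shows "mult_coeff (mult_coeff f g) h S w = mult_coeff f (mult_coeff g h) S w"
proof -
  let ?t = "\<lambda>U V k l. shuffle_sign U V * shuffle_sign U (S - U - V) * shuffle_sign V (S - U - V) *
      f U (take k w) * g V (take l (drop k w)) * h (S - U - V) (drop l (drop k w))"
  have L: "mult_coeff (mult_coeff f g) h S w =
      (\<Sum>T\<in>Pow S. \<Sum>k\<le>length w. \<Sum>U\<in>Pow T. \<Sum>l\<le>k. ?t U (T - U) l (k - l))"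
    unfolding mult_coeff_def sum_distrib_left sum_distrib_right
  proof (intro sum.cong refl)
    fix T k U l
    assume T: "T \<in> Pow S" and k: "k \<in> {..length w}" and U: "U \<in> Pow T"
      and "l \<in> {..k}"
    then have l: "l \<le> k" by simp
    have fin: "finite U" "finite (T - U)" "finite (S - T)"
      using T U assms by (auto intro: finite_subset)
    have "shuffle_sign T (S - T) = shuffle_sign (U \<union> (T - U)) (S - T)"
      using U by (simp add: Un_absorb1)
    also have "\<dots> = shuffle_sign U (S - T) * shuffle_sign (T - U) (S - T)"
      by (rule shuffle_sign_Un1[OF fin]) auto
    finally have s: "shuffle_sign T (S - T) = \<dots>" .
    have d: "S - U - (T - U) = S - T" using U by auto
    have tk: "take l (take k w) = take l w" "drop l (take k w) = take (k - l) (drop l w)"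
      "drop (k - l) (drop l w) = drop k w"
      using l by (simp_all add: min_absorb1 drop_take)
    show "shuffle_sign T (S - T) * (shuffle_sign U (T - U) * f U (take l (take k w)) *
        g (T - U) (drop l (take k w))) * h (S - T) (drop k w) = ?t U (T - U) l (k - l)"
      unfolding d s tk by (simp add: algebra_simps)
  next
    fix T k U assume "k \<in> {..length w}"
    then show "{..length (take k w)} = {..k}" by simp
  qed
  have R: "mult_coeff f (mult_coeff g h) S w =
      (\<Sum>U\<in>Pow S. \<Sum>k\<le>length w. \<Sum>V\<in>Pow (S - U). \<Sum>l\<le>length w - k. ?t U V k l)"
    unfolding mult_coeff_def sum_distrib_left sum_distrib_right
  proof (intro sum.cong refl)
    fix U k V l
    assume U: "U \<in> Pow S" and V: "V \<in> Pow (S - U)"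
    have fin: "finite U" "finite V" "finite (S - U - V)"
      using U V assms by (auto intro: finite_subset)
    have "shuffle_sign U (S - U) = shuffle_sign U (V \<union> (S - U - V))"
      using V by (simp add: Un_absorb1)
    also have "\<dots> = shuffle_sign U V * shuffle_sign U (S - U - V)"
      by (rule shuffle_sign_Un2[OF fin]) auto
    finally have s: "shuffle_sign U (S - U) = \<dots>" .
    show "shuffle_sign U (S - U) * f U (take k w) * (shuffle_sign V (S - U - V) *
        g V (take l (drop k w)) * h (S - U - V) (drop l (drop k w))) = ?t U V k l"
      unfolding s by (simp add: algebra_simps)
  qed simp
  have fS: "finite T" if "T \<subseteq> S" for T using that assms by (rule finite_subset)
  have "mult_coeff (mult_coeff f g) h S w =
      (\<Sum>(T, k, U, l)\<in>(SIGMA T:Pow S. SIGMA k:{..length w}. SIGMA U:Pow T. {..k}).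
         ?t U (T - U) l (k - l))"
    unfolding L using assms fS by (simp add: sum.Sigma split_def del: drop_drop)
  also have "\<dots> = (\<Sum>(U, k, V, l)\<in>
      (SIGMA U:Pow S. SIGMA k:{..length w}. SIGMA V:Pow (S - U). {..length w - k}). ?t U V k l)"
    by (rule sum.reindex_bij_witness[where
          i = "\<lambda>(U, k, V, l). (U \<union> V, k + l, U, k)" and
          j = "\<lambda>(T, k, U, l). (U, l, T - U, k - l)"]) auto
  also have "\<dots> = mult_coeff f (mult_coeff g h) S w"
    unfolding R using assms fS by (simp add: sum.Sigma split_def)
  finally show ?thesis .
qed

definition one_coeff :: "nat set \<Rightarrow> nat list \<Rightarrow> rat" where
  "one_coeff S w = of_bool (S = {} \<and> w = [])"

lemma bounded_one: "bounded_degree one_coeff"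
  unfolding bounded_degree_def one_coeff_def by auto

lemma mult_one_coeff:
  assumes "finite S"
  shows "mult_coeff one_coeff f S w = f S w" "mult_coeff f one_coeff S w = f S w"
proof -
  have "mult_coeff one_coeff f S w = (\<Sum>T\<in>Pow S. if T = {} then f S w else 0)"
    unfolding mult_coeff_def
  proof (rule sum.cong[OF refl])
    fix T
    have "(\<Sum>k\<le>length w. shuffle_sign T (S - T) * one_coeff T (take k w) * f (S - T) (drop k w))
        = (\<Sum>k\<le>length w. if k = 0 then (if T = {} then f S w else 0) else 0)"
      by (rule sum.cong) (auto simp: one_coeff_def)
    then show "(\<Sum>k\<le>length w. shuffle_sign T (S - T) * one_coeff T (take k w) *
        f (S - T) (drop k w)) = (if T = {} then f S w else 0)" by simp
  qed
  also have "\<dots> = f S w" using assms by (simp add: sum.delta)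
  finally show "mult_coeff one_coeff f S w = f S w" .
  have "mult_coeff f one_coeff S w = (\<Sum>T\<in>Pow S. if T = S then f S w else 0)"
    unfolding mult_coeff_def
  proof (rule sum.cong[OF refl])
    fix T assume "T \<in> Pow S"
    then have "(\<Sum>k\<le>length w. shuffle_sign T (S - T) * f T (take k w) * one_coeff (S - T) (drop k w))
        = (\<Sum>k\<le>length w. if k = length w then (if T = S then f S w else 0) else 0)"
      by (intro sum.cong) (auto simp: one_coeff_def)
    then show "(\<Sum>k\<le>length w. shuffle_sign T (S - T) * f T (take k w) *
        one_coeff (S - T) (drop k w)) = (if T = S then f S w else 0)" by simp
  qed
  also have "\<dots> = f S w" using assms by (simp add: sum.delta)
  finally show "mult_coeff f one_coeff S w = f S w" .
qed

instantiation superseries :: ring_1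
begin

definition "0 = Abs_superseries (\<lambda>_ _. 0)"
definition "1 = Abs_superseries one_coeff"
definition "f + g = Abs_superseries (\<lambda>S w. coeff f S w + coeff g S w)"
definition "- f = Abs_superseries (\<lambda>S w. - coeff f S w)"
definition "f - g = f + - (g :: superseries)"
definition "f * g = Abs_superseries (mult_coeff (coeff f) (coeff g))"

lemma coeff_0 [simp]: "coeff 0 S w = 0"
  by (simp add: zero_superseries_def coeff_Abs bounded_degree_def)

lemma coeff_1: "coeff 1 = one_coeff"
  by (simp add: one_superseries_def coeff_Abs bounded_one)

lemma coeff_add [simp]: "coeff (f + g) S w = coeff f S w + coeff g S w"
  by (simp add: plus_superseries_def coeff_Abs bounded_degree_add)

lemma coeff_uminus [simp]: "coeff (- f) S w = - coeff f S w"
  using bounded_degree_scale[of "coeff f" "-1"]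
  by (simp add: uminus_superseries_def coeff_Abs)

lemma coeff_mult: "coeff (f * g) = mult_coeff (coeff f) (coeff g)"
  by (simp add: times_superseries_def coeff_Abs bounded_degree_mult)

instance
proof
  fix a b c :: superseries
  show "a * b * c = a * (b * c)"
    by (rule superseries_eqI) (simp add: coeff_mult mult_coeff_assoc)
  show "1 * a = a" "a * 1 = a"
    by (rule superseries_eqI; simp add: coeff_mult coeff_1 mult_one_coeff)+
  show "(a + b) * c = a * c + b * c" "a * (b + c) = a * b + a * c"
    by (rule superseries_eqI;
        simp add: coeff_mult mult_coeff_def distrib_left distrib_right sum.distrib)+
  show "(0 :: superseries) \<noteq> 1"
  proof
    assume "(0 :: superseries) = 1"
    then have "coeff 0 {} [] = coeff 1 {} []" by simp
    then show False by (simp add: coeff_1 one_coeff_def)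
  qed
qed (rule superseries_eqI; simp add: minus_superseries_def)+

end

definition scaleQ :: "rat \<Rightarrow> superseries \<Rightarrow> superseries" where
  "scaleQ c f = Abs_superseries (\<lambda>S w. c * coeff f S w)"

lemma coeff_scaleQ [simp]: "coeff (scaleQ c f) S w = c * coeff f S w"
  by (simp add: scaleQ_def coeff_Abs bounded_degree_scale)

lemma scaleQ_mult: "scaleQ c f * g = scaleQ c (f * g)" "f * scaleQ c g = scaleQ c (f * g)"
  by (rule superseries_eqI; simp add: coeff_mult mult_coeff_def sum_distrib_left algebra_simps)+

global_interpretation superseries: vector_space scaleQ
  by standard (rule superseries_eqI; simp add: algebra_simps)+

definition theta :: "nat \<Rightarrow> superseries" where
  "theta i = Abs_superseries (\<lambda>S w. of_bool (S = {i} \<and> w = []))"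

definition xvar :: "nat \<Rightarrow> superseries" where
  "xvar i = Abs_superseries (\<lambda>S w. of_bool (S = {} \<and> w = [i]))"

lemma coeff_theta: "coeff (theta i) S w = of_bool (S = {i} \<and> w = [])"
  unfolding theta_def by (subst coeff_Abs) (auto simp: bounded_degree_def intro!: exI[of _ 1])

lemma coeff_xvar: "coeff (xvar i) S w = of_bool (S = {} \<and> w = [i])"
  unfolding xvar_def by (subst coeff_Abs) (auto simp: bounded_degree_def intro!: exI[of _ 1])

lemma coeff_theta_mult:
  assumes "finite S"
  shows "coeff (theta i * f) S w =
    (if i \<in> S then shuffle_sign {i} (S - {i}) * coeff f (S - {i}) w else 0)"
proof -
  have "coeff (theta i * f) S w = (\<Sum>T\<in>Pow S. if T = {i} then
      shuffle_sign {i} (S - {i}) * coeff f (S - {i}) w else 0)"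
    unfolding coeff_mult mult_coeff_def
  proof (rule sum.cong[OF refl])
    fix T
    have "(\<Sum>k\<le>length w. shuffle_sign T (S - T) * coeff (theta i) T (take k w) *
        coeff f (S - T) (drop k w)) = (\<Sum>k\<le>length w. if k = 0 then
        (if T = {i} then shuffle_sign {i} (S - {i}) * coeff f (S - {i}) w else 0) else 0)"
      by (rule sum.cong) (auto simp: coeff_theta)
    then show "(\<Sum>k\<le>length w. shuffle_sign T (S - T) * coeff (theta i) T (take k w) *
        coeff f (S - T) (drop k w)) =
        (if T = {i} then shuffle_sign {i} (S - {i}) * coeff f (S - {i}) w else 0)" by simp
  qed
  also have "\<dots> = (if i \<in> S then shuffle_sign {i} (S - {i}) * coeff f (S - {i}) w else 0)"
    using assms by (simp add: sum.delta)
  finally show ?thesis .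
qed

lemma coeff_xvar_mult:
  assumes "finite S"
  shows "coeff (xvar i * f) S w = (if w \<noteq> [] \<and> hd w = i then coeff f S (tl w) else 0)"
proof -
  have "coeff (xvar i * f) S w = (\<Sum>T\<in>Pow S. if T = {} then
      (if w \<noteq> [] \<and> hd w = i then coeff f S (tl w) else 0) else 0)"
    unfolding coeff_mult mult_coeff_def
  proof (rule sum.cong[OF refl])
    fix T
    have *: "take k w = [i] \<longleftrightarrow> k = 1 \<and> w \<noteq> [] \<and> hd w = i" if "k \<le> length w" for k
      using that by (cases w; cases k) auto
    have "(\<Sum>k\<le>length w. shuffle_sign T (S - T) * coeff (xvar i) T (take k w) *
        coeff f (S - T) (drop k w)) = (\<Sum>k\<le>length w. if k = 1 then
        (if T = {} \<and> w \<noteq> [] \<and> hd w = i then coeff f S (tl w) else 0) else 0)"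
      by (rule sum.cong) (auto simp: coeff_xvar * drop_Suc)
    also have "\<dots> = (if T = {} then (if w \<noteq> [] \<and> hd w = i then coeff f S (tl w) else 0) else 0)"
      by (cases w) (auto simp: Suc_le_eq)
    finally show "(\<Sum>k\<le>length w. shuffle_sign T (S - T) * coeff (xvar i) T (take k w) *
        coeff f (S - T) (drop k w)) =
        (if T = {} then (if w \<noteq> [] \<and> hd w = i then coeff f S (tl w) else 0) else 0)" .
  qed
  also have "\<dots> = (if w \<noteq> [] \<and> hd w = i then coeff f S (tl w) else 0)"
    using assms by (simp add: sum.delta)
  finally show ?thesis .
qed

lemma shuffle_sign_single:
  "shuffle_sign {i} {j} = (if j < i then -1 else 1)"
proof -
  have "{(a, b). a \<in> {i} \<and> b \<in> {j} \<and> b < a} = (if j < i then {(i, j)} else {})" by auto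
  then show ?thesis by (simp add: shuffle_sign_def)
qed

lemma theta_theta: "theta i * theta j = - (theta j * theta i)"
proof (rule superseries_eqI)
  fix S :: "nat set" and w :: "nat list" assume S: "finite S"
  have eq: "a \<in> S \<and> S - {a} = {b} \<longleftrightarrow> S = {a, b} \<and> a \<noteq> b" for a b by auto
  have "coeff (theta a * theta b) S w =
      (if S = {a, b} \<and> a \<noteq> b \<and> w = [] then shuffle_sign {a} {b} else 0)" for a b
    using S eq[of a b] by (auto simp: coeff_theta_mult coeff_theta)
  then show "coeff (theta i * theta j) S w = coeff (- (theta j * theta i)) S w"
    by (auto simp: shuffle_sign_single)
qed

lemma xvar_theta: "xvar i * theta j = theta j * xvar i"
  by (rule superseries_eqI, simp add: coeff_theta_mult coeff_xvar_mult coeff_theta coeff_xvar)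
     (metis (no_types, opaque_lifting) Diff_cancel Diff_eq_empty_iff insertI1 list.collapse
        list.sel(1,3) not_Cons_self2 shuffle_sign_empty(2) singletonI subset_singletonD empty_iff
        list.distinct(1))


section \<open>Words, formal sums and invariant series\<close>

text \<open>
  The word $\theta_{a_1}\cdots\theta_{a_m}x_{b_1}\cdots x_{b_n}$ is represented by the pair of
  lists \<open>(a, b)\<close>, so that different pairs of lists count as different words even if they have the
  same value up to sign; \<open>word_val\<close> is the value in the algebra.
\<close>

type_synonym word = "nat list \<times> nat list"

definition words :: "nat \<Rightarrow> nat \<Rightarrow> word set" where
  "words n m = {(a, b). length a = m \<and> length b = n}"

definition word_val :: "word \<Rightarrow> superseries" where
  "word_val u = prod_list (map theta (fst u)) * prod_list (map xvar (snd u))"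

lemma word_val_nonzero:
  assumes "coeff (word_val (a, b)) S w \<noteq> 0"
  shows "S = set a \<and> distinct a \<and> w = b"
  using assms
proof (induction a arbitrary: S)
  case Nil
  have "finite S" using Nil coeff_infinite by blast
  with Nil show ?case
  proof (induction b arbitrary: w)
    case Nil then show ?case by (auto simp: word_val_def coeff_1 one_coeff_def split: if_splits)
  next
    case (Cons i b)
    from Cons.prems have "w \<noteq> []" "hd w = i" "coeff (word_val ([], b)) S (tl w) \<noteq> 0"
      by (auto simp: word_val_def coeff_xvar_mult split: if_splits)
    with Cons.IH[of "tl w"] Cons.prems(2) show ?case by (cases w) auto
  qed
next
  case (Cons i a)
  have "finite S" using Cons.prems coeff_infinite by blast
  with Cons.prems have "i \<in> S" "coeff (word_val (a, b)) (S - {i}) w \<noteq> 0"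
    by (auto simp: word_val_def coeff_theta_mult mult.assoc split: if_splits)
  with Cons.IH[of "S - {i}"] show ?case by auto
qed

text \<open>
  The formal sum $\sum_{u\in W}c_u u$ is taken coefficientwise. Only finitely many words
  contribute to a given coefficient (\<open>finite_contributions\<close>), and the result has bounded
  degree whenever the words that occur do (\<open>coeff_formal_sum\<close>).
\<close>

definition formal_sum :: "word set \<Rightarrow> (word \<Rightarrow> rat) \<Rightarrow> (word \<Rightarrow> superseries) \<Rightarrow> superseries" where
  "formal_sum W c g = Abs_superseries (\<lambda>S w.
     \<Sum>u | u \<in> W \<and> coeff (g u) S w \<noteq> 0. c u * coeff (g u) S w)"

lemma finite_contributions: "finite {u \<in> W. coeff (word_val u) S w \<noteq> 0}"
proof (cases "finite S")
  case True
  have "{u \<in> W. coeff (word_val u) S w \<noteq> 0} \<subseteq> {a. set a = S \<and> distinct a} \<times> {w}"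
    using word_val_nonzero by fastforce
  moreover have "finite {a. set a = S \<and> distinct a}"
    by (rule finite_subset[OF _ finite_subset_distinct[OF True]]) auto
  ultimately show ?thesis by (meson finite.emptyI finite_SigmaI finite_insert finite_subset)
qed (simp add: coeff_infinite)

lemma coeff_formal_sum:
  assumes "\<And>u S w. u \<in> W \<Longrightarrow> c u \<noteq> 0 \<Longrightarrow> coeff (g u) S w \<noteq> 0 \<Longrightarrow> card S + length w \<le> d"
  shows "coeff (formal_sum W c g) S w =
    (\<Sum>u | u \<in> W \<and> coeff (g u) S w \<noteq> 0. c u * coeff (g u) S w)"
proof -
  have "finite S \<and> card S + length w \<le> d"
    if "(\<Sum>u | u \<in> W \<and> coeff (g u) S w \<noteq> 0. c u * coeff (g u) S w) \<noteq> 0" for S w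
  proof -
    have "\<exists>u\<in>{u. u \<in> W \<and> coeff (g u) S w \<noteq> 0}. c u * coeff (g u) S w \<noteq> 0"
      using that by (meson sum.neutral)
    then obtain u where "u \<in> W" "c u \<noteq> 0" "coeff (g u) S w \<noteq> 0" by auto
    then show ?thesis using assms coeff_infinite by blast
  qed
  then show ?thesis
    unfolding formal_sum_def by (subst coeff_Abs) (auto simp: bounded_degree_def)
qed

lemma coeff_formal_sum_words:
  assumes "W \<subseteq> words n m"
  shows "coeff (formal_sum W c word_val) S w =
    (\<Sum>u | u \<in> W \<and> coeff (word_val u) S w \<noteq> 0. c u * coeff (word_val u) S w)"
proof (rule coeff_formal_sum)
  fix u S w assume "u \<in> W" and nz: "coeff (word_val u) S w \<noteq> 0"
  then obtain a b where u: "u = (a, b)" "length a = m" "length b = n"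
    using assms by (auto simp: words_def)
  then show "card S + length w \<le> m + n"
    using word_val_nonzero[of a b S w] nz by (simp add: distinct_card)
qed

text \<open>
  A permutation acts by replacing each index in each (sorted) monomial of a series; the same
  then holds for arbitrary words, see \<open>act_word_val\<close>.
\<close>

definition sorted_words :: "word set" where
  "sorted_words = {(a, b). sorted_wrt (<) a}"

definition act :: "(nat \<Rightarrow> nat) \<Rightarrow> superseries \<Rightarrow> superseries" where
  "act \<pi> f = formal_sum sorted_words (\<lambda>(a, b). coeff f (set a) b)
     (\<lambda>(a, b). word_val (map \<pi> a, map \<pi> b))"

lemma formal_sum_finite_support_act:
  assumes "inj \<pi>"
  shows "finite {u \<in> W. coeff (case u of (a, b) \<Rightarrow> word_val (map \<pi> a, map \<pi> b)) S w \<noteq> 0}"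
proof -
  let ?r = "\<lambda>(a, b). (map \<pi> a, map \<pi> b)"
  have "inj ?r" using assms by (auto simp: inj_def inj_map_eq_map)
  then have "finite (?r -` {u \<in> UNIV. coeff (word_val u) S w \<noteq> 0})"
    by (intro finite_vimageI finite_contributions)
  then show ?thesis by (rule rev_finite_subset) (auto simp: split_def)
qed

lemma word_val_move:
  "word_val (x # a1 @ a2, b) = scaleQ ((-1) ^ length a1) (word_val (a1 @ x # a2, b))"
proof (induction a1)
  case (Cons y a1)
  have cons: "word_val (z # c, b) = theta z * word_val (c, b)" for z c
    by (simp add: word_val_def mult.assoc)
  have neg: "scaleQ (- c) f = - scaleQ c f" for c f
    by (rule superseries_eqI) simp
  have "word_val (x # (y # a1) @ a2, b) = theta x * theta y * word_val (a1 @ a2, b)"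
    by (simp add: cons mult.assoc)
  also have "\<dots> = - (theta y * word_val (x # a1 @ a2, b))"
    by (subst theta_theta) (simp add: cons mult.assoc)
  also have "\<dots> = scaleQ ((-1) ^ length (y # a1)) (theta y * word_val (a1 @ x # a2, b))"
    unfolding Cons.IH by (simp add: scaleQ_mult neg)
  finally show ?case by (simp add: cons)
qed simp

lemma word_val_rearrange:
  assumes "mset a = mset a'"
  shows "\<exists>s. \<forall>\<pi> b. word_val (map \<pi> a, b) = scaleQ s (word_val (map \<pi> a', b))"
  using assms
proof (induction a arbitrary: a')
  case Nil
  then show ?case by (intro exI[of _ 1]) simp
next
  case (Cons x a)
  then obtain a1 a2 where a': "a' = a1 @ x # a2"
    by (metis list.set_intros(1) mset_eq_setD split_list)
  with Cons.prems have "mset a = mset (a1 @ a2)" by simp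
  with Cons.IH obtain s where
    s: "\<And>\<pi> b. word_val (map \<pi> a, b) = scaleQ s (word_val (map \<pi> (a1 @ a2), b))" by blast
  have "word_val (map \<pi> (x # a), b) = scaleQ (s * (-1) ^ length a1) (word_val (map \<pi> a', b))"
    for \<pi> b
  proof -
    have cons: "word_val (z # c, b) = theta z * word_val (c, b)" for z c
      by (simp add: word_val_def mult.assoc)
    have "word_val (map \<pi> (x # a), b) = scaleQ s (word_val (\<pi> x # map \<pi> a1 @ map \<pi> a2, b))"
      using s by (simp add: cons scaleQ_mult)
    then show ?thesis by (simp add: word_val_move a')
  qed
  then show ?case by blast
qed

lemma coeff_sorted_word:
  assumes "sorted_wrt (<) a"
  shows "coeff (word_val (a, b)) S w = of_bool (S = set a \<and> w = b)"
proof -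
  have "coeff (word_val (a, b)) (set a) b = 1"
    using assms
  proof (induction a)
    case Nil
    show ?case
    proof (induction b)
      case Nil show ?case by (simp add: word_val_def coeff_1 one_coeff_def)
    next
      case (Cons j b) then show ?case by (simp add: word_val_def coeff_xvar_mult)
    qed
  next
    case (Cons i a)
    then have "{(i', j). i' \<in> {i} \<and> j \<in> set a \<and> j < i'} = {}" by fastforce
    then have "shuffle_sign {i} (set a) = 1" by (simp only: shuffle_sign_def) simp
    moreover have "insert i (set a) - {i} = set a" using Cons.prems by auto
    moreover have "word_val (i # a, b) = theta i * word_val (a, b)"
      by (simp add: word_val_def mult.assoc)
    moreover have "coeff (word_val (a, b)) (set a) b = 1" using Cons by simp
    ultimately show ?case
      using coeff_theta_mult[of "insert i (set a)" i "word_val (a, b)" b] by simp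
  qed
  moreover have "coeff (word_val (a, b)) S w = 0" if "\<not> (S = set a \<and> w = b)"
    using word_val_nonzero[of a b S w] that by blast
  ultimately show ?thesis by (cases "S = set a \<and> w = b") simp_all
qed

theorem act_word_val:
  assumes "inj \<pi>"
  shows "act \<pi> (word_val (a, b)) = word_val (map \<pi> a, map \<pi> b)"
proof (rule superseries_eqI)
  fix S :: "nat set" and w :: "nat list"
  let ?g = "\<lambda>(a, b). word_val (map \<pi> a, map \<pi> b)"
  define c where "c = (\<lambda>(a', b'). coeff (word_val (a, b)) (set a') b')"
  have nz: "length a' = length a \<and> b' = b" if "(a', b') \<in> sorted_words" "c (a', b') \<noteq> 0" for a' b'
  proof -
    have "set a' = set a" "distinct a" "b' = b" using that word_val_nonzero by (auto simp: c_def)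
    moreover have "distinct a'"
      using that by (auto simp: sorted_words_def strict_sorted_iff)
    ultimately show ?thesis by (metis distinct_card)
  qed
  have "coeff (formal_sum sorted_words c ?g) S w =
      (\<Sum>u | u \<in> sorted_words \<and> coeff (?g u) S w \<noteq> 0. c u * coeff (?g u) S w)"
  proof (rule coeff_formal_sum[where d = "length a + length b"])
    fix u S w assume u: "u \<in> sorted_words" "c u \<noteq> 0" "coeff (?g u) S w \<noteq> 0"
    obtain a' b' where [simp]: "u = (a', b')" by (cases u)
    show "card S + length w \<le> length a + length b"
      using nz[of a' b'] u word_val_nonzero[of "map \<pi> a'" "map \<pi> b'" S w] card_length[of "map \<pi> a'"]
      by simp
  qed
  then have act: "coeff (act \<pi> (word_val (a, b))) S w =
      (\<Sum>u | u \<in> sorted_words \<and> coeff (?g u) S w \<noteq> 0. c u * coeff (?g u) S w)"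
    by (simp add: act_def c_def)
  show "coeff (act \<pi> (word_val (a, b))) S w = coeff (word_val (map \<pi> a, map \<pi> b)) S w"
  proof (cases "distinct a")
    case False
    then have "\<not> distinct (map \<pi> a)" by (simp add: distinct_map)
    then have "coeff (word_val (map \<pi> a, map \<pi> b)) S w = 0" using word_val_nonzero by blast
    moreover have "c u = 0" for u using False word_val_nonzero by (auto simp: c_def split_def)
    ultimately show ?thesis using act by simp
  next
    case True
    define a' where "a' = sort a"
    have a': "sorted_wrt (<) a'" "set a' = set a"
      using True by (simp_all add: a'_def strict_sorted_iff)
    obtain s where s: "\<And>\<pi> b. word_val (map \<pi> a, b) = scaleQ s (word_val (map \<pi> a', b))"
      using word_val_rearrange[of a a'] by (auto simp: a'_def)
    have c: "c u = (if u = (a', b) then s else 0)" if "u \<in> sorted_words" for u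
    proof -
      obtain d e where u: "u = (d, e)" "sorted_wrt (<) d"
        using \<open>u \<in> sorted_words\<close> by (auto simp: sorted_words_def)
      have "set d = set a' \<longleftrightarrow> d = a'"
        using u(2) a'(1) by (auto intro: strict_sorted_equal)
      then show ?thesis
        using s[of id] a' u by (auto simp: c_def coeff_sorted_word)
    qed
    have "coeff (act \<pi> (word_val (a, b))) S w =
        (\<Sum>u | u \<in> sorted_words \<and> coeff (?g u) S w \<noteq> 0.
           if u = (a', b) then s * coeff (?g (a', b)) S w else 0)"
      unfolding act by (rule sum.cong) (auto simp: c)
    also have "\<dots> = s * coeff (?g (a', b)) S w"
      using formal_sum_finite_support_act[OF assms, of sorted_words S w] a'(1)
      by (simp add: sum.delta) (simp add: sorted_words_def)
    finally show ?thesis by (simp add: s)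
  qed
qed

definition sNCSym :: "superseries set" where
  "sNCSym = {f. \<forall>\<pi>. permutation \<pi> \<longrightarrow> act \<pi> f = f}"


section \<open>Monomial word sets and the three families\<close>

text \<open>
  The entries of \<open>(a, b)\<close> are $a_{i+1}=$ \<open>a ! i\<close> and $b_j=$ \<open>b ! (j - 1)\<close>.
\<close>

definition M :: "nat set list \<Rightarrow> word set" where
  "M K = {(a, b) \<in> words (deg K) (fdeg K).
     (\<forall>i<fdeg K. \<forall>j\<in>{1..deg K}. a ! i = b ! (j - 1) \<longleftrightarrow> j \<in> pos (K ! i)) \<and>
     (\<forall>i\<in>{1..deg K}. \<forall>j\<in>{1..deg K}.
        b ! (i - 1) = b ! (j - 1) \<longleftrightarrow> (\<exists>B\<in>set K. i \<in> B \<and> j \<in> B))}"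

definition power_sum :: "nat set list \<Rightarrow> superseries" where
  "power_sum K = formal_sum
     {(a, b) \<in> words (deg K) (fdeg K).
        (\<forall>i<fdeg K. \<forall>j\<in>pos (K ! i). a ! i = b ! (j - 1)) \<and>
        (\<forall>B\<in>set K. \<forall>i\<in>pos B. \<forall>j\<in>pos B. b ! (i - 1) = b ! (j - 1))}
     (\<lambda>_. 1) word_val"

definition elementary :: "nat set list \<Rightarrow> superseries" where
  "elementary K = formal_sum
     {(a, b) \<in> words (deg K) (fdeg K).
        (\<forall>i<fdeg K. \<forall>j\<in>pos (K ! i). a ! i \<noteq> b ! (j - 1)) \<and>
        (\<forall>B\<in>set K. \<forall>i\<in>pos B. \<forall>j\<in>pos B. i \<noteq> j \<longrightarrow> b ! (i - 1) \<noteq> b ! (j - 1))}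
     (\<lambda>_. 1) word_val"

definition type_of_word :: "nat \<Rightarrow> nat \<Rightarrow> word \<Rightarrow> nat set list" where
  "type_of_word n m u = (THE L. L \<in> sC n m \<and> u \<in> M L)"

definition complete_homogeneous :: "nat set list \<Rightarrow> superseries" where
  "complete_homogeneous K = formal_sum
     {(a, b) \<in> words (deg K) (fdeg K). distinct a \<and> card (set a - set b) \<le> 1}
     (\<lambda>u. of_nat (tuple_fact
        (meet (deg K) (fdeg K) K (type_of_word (deg K) (fdeg K) u)))) word_val"

text \<open>
  A family is a basis of a subspace if its members are pairwise different and form a linearly
  independent set spanning that subspace.
\<close>

definition basis_family :: "('i \<Rightarrow> superseries) \<Rightarrow> 'i set \<Rightarrow> superseries set \<Rightarrow> bool" where
  "basis_family v J V \<longleftrightarrow>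
     inj_on v J \<and> superseries.independent (v ` J) \<and> superseries.span (v ` J) = V"

end

theory Submission
  imports Defs
begin

text \<open>
  A word with \<open>m\<close> fermionic and \<open>n\<close> bosonic letters is a function on \<open>m + n\<close> positions, and a
  supercomposition is a partition of the positions that separates the first \<open>m\<close> of them. The sum of
  all words constant on the classes of such a partition is, up to a factor, the power sum of the
  superpartition obtained by sorting the fermionic blocks; it vanishes if two fermionic blocks are
  \<open>{0}\<close>, because exchanging the two letters changes the sign. A symmetric series has no monomials with
  two fermionic indices outside the word, so it is determined by one coefficient for each
  superpartition, and with respect to these coefficients the power sums are triangular for the number
  of blocks.

  Let \<open>\<sigma>\<close> run over the permutations of the positions preserving the blocks of \<open>K\<close>. The coefficient of
  a word \<open>u\<close> in the complete homogeneous function of \<open>K\<close> is the number of \<open>\<sigma>\<close> fixing \<open>u\<close>, and in the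
  elementary function it is the sum of the signs of these \<open>\<sigma>\<close>. Exchanging summations, both functions
  are combinations of sums over the words constant on the orbits of \<open>\<sigma>\<close>, hence of the power sum of
  \<open>K\<close>, coming from the \<open>\<sigma>\<close> whose orbits are the blocks (all of the same sign), and of power sums
  with more blocks.
\<close>

section \<open>Triangular families\<close>

text \<open>Factorial weights and distinctness conditions come from one group, the permutations
  preserving both the blocks and the letters of a word: its order is the factorial product of the
  meet, and its signed count is 1 if it is trivial and 0 otherwise, since a nontrivial such group
  contains a transposition. After the summations are exchanged, a permutation may leave several
  fermionic positions fixed, so its orbits need not form a superpartition under any relabelling;
  exactly then its kernel sum vanishes. The signs caused by relabelling are never computed, because
  triangularity only asks that the other terms be scalar multiples of power sums with more blocks.
  Cancellation could do harm on the diagonal alone. There the sign of a permutation is determined by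
  its number of orbits, so all contributions are equal and add up to a nonzero multiple. Partitions
  are compared throughout as kernels of functions on positions: a meet is then the kernel of a pair
  of functions, and equality of two comparable partitions follows from equality of their numbers of
  blocks.\<close>

lemma basis_family_triangular:
  fixes r :: "'i \<Rightarrow> nat"
  assumes V: "superseries.subspace V"
    and add: "\<And>i x y. i \<in> J \<Longrightarrow> x \<in> V \<Longrightarrow> y \<in> V \<Longrightarrow> \<phi> i (x + y) = \<phi> i x + \<phi> i y"
    and scale: "\<And>i c x. i \<in> J \<Longrightarrow> x \<in> V \<Longrightarrow> \<phi> i (scaleQ c x) = c * \<phi> i x"
    and sep: "\<And>x. x \<in> V \<Longrightarrow> (\<And>i. i \<in> J \<Longrightarrow> \<phi> i x = 0) \<Longrightarrow> x = 0"
    and fin: "\<And>x. x \<in> V \<Longrightarrow> finite {i \<in> J. \<phi> i x \<noteq> 0}"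
    and v: "\<And>i. i \<in> J \<Longrightarrow> v i \<in> V"
    and diag: "\<And>i. i \<in> J \<Longrightarrow> \<phi> i (v i) \<noteq> 0"
    and tri: "\<And>i j. i \<in> J \<Longrightarrow> j \<in> J \<Longrightarrow> i \<noteq> j \<Longrightarrow> \<phi> i (v j) \<noteq> 0 \<Longrightarrow> r i < r j"
  shows "basis_family v J V"
proof -
  have zero: "\<phi> i 0 = 0" if "i \<in> J" for i
    using scale[OF that, of 0 0] superseries.subspace_0[OF V] by simp
  have lin: "\<phi> i (\<Sum>j\<in>A. scaleQ (c j) (v j)) = (\<Sum>j\<in>A. c j * \<phi> i (v j))"
    if "i \<in> J" "A \<subseteq> J" for i A and c :: "'i \<Rightarrow> rat"
    using that(2)
  proof (induction A rule: infinite_finite_induct)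
    case (insert j A)
    have "(\<Sum>j\<in>A. scaleQ (c j) (v j)) \<in> V"
      using insert.prems v by (intro superseries.subspace_sum[OF V] superseries.subspace_scale[OF V]) auto
    then show ?case
      using insert v that(1) by (simp add: add scale superseries.subspace_scale[OF V])
  qed (simp_all add: zero that)
  \<comment> \<open>If \<open>v i = v j\<close> with \<open>i \<noteq> j\<close>, then
    \<open>diag\<close> makes both mixed values nonzero, and \<open>tri\<close> gives
    \<open>r i < r j\<close> and \<open>r j < r i\<close>.\<close>
  have inj: "inj_on v J"
    by (rule inj_onI) (metis diag tri less_asym)
  have "superseries.independent (v ` J)"
  proof
    assume "superseries.dependent (v ` J)"
    then obtain T u x where T: "finite T" "T \<subseteq> v ` J" "(\<Sum>x\<in>T. scaleQ (u x) x) = 0" "x \<in> T" "u x \<noteq> 0"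
      unfolding superseries.dependent_explicit by blast
    define A where "A = {i \<in> J. v i \<in> T}"
    have bij: "bij_betw v A T"
      using T(2) inj by (auto simp: bij_betw_def A_def inj_on_def)
    have fA: "finite A" using bij T(1) bij_betw_finite by blast
    have sum0: "(\<Sum>i\<in>A. scaleQ (u (v i)) (v i)) = 0"
      using sum.reindex_bij_betw[OF bij, of "\<lambda>x. scaleQ (u x) x"] T(3) by simp
    define B where "B = {i \<in> A. u (v i) \<noteq> 0}"
    have "B \<noteq> {}" "finite B" using T(2,4,5) fA by (auto simp: B_def) (auto simp: A_def)
    \<comment> \<open>The relation is tested at an index of maximal rank among the nonzero
      coefficients: by \<open>tri\<close> every term but the diagonal one vanishes there.\<close>
    then have "Max (r ` B) \<in> r ` B" "\<And>j. j \<in> B \<Longrightarrow> r j \<le> Max (r ` B)" by auto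
    then obtain i where i: "i \<in> B" "\<And>j. j \<in> B \<Longrightarrow> r j \<le> r i" by auto
    have iJ: "i \<in> J" "i \<in> A" using i(1) by (auto simp: B_def A_def)
    have "0 = (\<Sum>j\<in>A. u (v j) * \<phi> i (v j))"
      using lin[of i A "u \<circ> v"] iJ sum0 zero[OF iJ(1)] by (auto simp: A_def)
    also have "\<dots> = (\<Sum>j\<in>A. if j = i then u (v i) * \<phi> i (v i) else 0)"
    proof (rule sum.cong[OF refl])
      fix j assume j: "j \<in> A"
      show "u (v j) * \<phi> i (v j) = (if j = i then u (v i) * \<phi> i (v i) else 0)"
      proof (cases "j = i \<or> u (v j) = 0")
        case False
        then have "r j \<le> r i" using i(2) j by (auto simp: B_def)
        then show ?thesis using tri[of i j] iJ j False by (auto simp: A_def)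
      qed auto
    qed
    also have "\<dots> = u (v i) * \<phi> i (v i)" using fA iJ by simp
    finally show False using diag[OF iJ(1)] i(1) by (simp add: B_def)
  qed
  moreover have "superseries.span (v ` J) = V"
  proof
    show "superseries.span (v ` J) \<subseteq> V"
      using v by (intro superseries.span_minimal V) auto
    \<comment> \<open>Elimination from the top: the strict bound \<open>R\<close> on the ranks seen
      by \<open>x\<close> is lowered by one, by adding multiples of the members of the highest
      admissible rank. Those members do not see each other, so one correction clears that
      rank.\<close>
    have "x \<in> superseries.span (v ` J)"
      if "x \<in> V" "\<And>i. i \<in> J \<Longrightarrow> \<phi> i x \<noteq> 0 \<Longrightarrow> r i < R" for x R
      using that
    proof (induction R arbitrary: x)
      case 0
      then show ?case using sep[of x] superseries.span_zero by auto
    next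
      case (Suc R)
      define A where "A = {i \<in> J. \<phi> i x \<noteq> 0 \<and> r i = R}"
      define c where "c i = - (\<phi> i x / \<phi> i (v i))" for i
      define y where "y = (\<Sum>i\<in>A. scaleQ (c i) (v i))"
      have fA: "finite A"
        by (rule finite_subset[OF _ fin[OF Suc.prems(1)]]) (auto simp: A_def)
      have AJ: "A \<subseteq> J" by (auto simp: A_def)
      have yV: "y \<in> V" unfolding y_def
        using AJ v by (intro superseries.subspace_sum[OF V] superseries.subspace_scale[OF V]) auto
      have yspan: "y \<in> superseries.span (v ` J)" unfolding y_def
        using AJ by (intro superseries.span_sum superseries.span_scale superseries.span_base) auto
      have "x + y \<in> superseries.span (v ` J)"
      proof (rule Suc.IH)
        show "x + y \<in> V" using Suc.prems(1) yV superseries.subspace_add[OF V] by blast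
        fix k assume k: "k \<in> J" "\<phi> k (x + y) \<noteq> 0"
        have phi: "\<phi> k (x + y) = \<phi> k x + (\<Sum>j\<in>A. c j * \<phi> k (v j))"
          unfolding y_def[symmetric] lin[OF k(1) AJ, of c, folded y_def, symmetric]
          using add[OF k(1) Suc.prems(1) yV] .
        show "r k < R"
        proof (rule ccontr)
          assume "\<not> r k < R"
          then have *: "c j * \<phi> k (v j) = (if j = k then c k * \<phi> k (v k) else 0)" if "j \<in> A" for j
            using tri[of k j] k(1) that by (auto simp: A_def)
          have "(\<Sum>j\<in>A. c j * \<phi> k (v j)) = (if k \<in> A then c k * \<phi> k (v k) else 0)"
            using fA by (simp add: * cong: sum.cong)
          moreover have "r k < Suc R" if "\<phi> k x \<noteq> 0" using Suc.prems(2) k(1) that by blast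
          ultimately show False
            using phi k diag[OF k(1)] \<open>\<not> r k < R\<close> by (auto simp: A_def c_def split: if_splits)
        qed
      qed
      from superseries.span_diff[OF this yspan] show ?case by simp
    qed
    moreover have "\<exists>R. \<forall>i\<in>J. \<phi> i x \<noteq> 0 \<longrightarrow> r i < R" if "x \<in> V" for x
    proof -
      have "\<forall>i\<in>J. \<phi> i x \<noteq> 0 \<longrightarrow> r i < Suc (Max (r ` {i \<in> J. \<phi> i x \<noteq> 0}))"
        using fin[OF that] by (auto simp: less_Suc_eq_le)
      then show ?thesis ..
    qed
    ultimately show "V \<subseteq> superseries.span (v ` J)" by blast
  qed
  ultimately show ?thesis using inj by (simp add: basis_family_def)
qed

text \<open>The triangularity is tested with the coordinate functionals of the basis \<open>p\<close>.\<close>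

lemma basis_family_change:
  fixes r :: "'i \<Rightarrow> nat"
  assumes p: "basis_family p J V"
    and v: "\<And>i. i \<in> J \<Longrightarrow> \<exists>d. d \<noteq> 0 \<and>
      v i - scaleQ d (p i) \<in> superseries.span (p ` {j \<in> J. r j < r i})"
  shows "basis_family v J V"
proof -
  let ?B = "p ` J"
  define \<phi> where "\<phi> i x = superseries.representation ?B x (p i)" for i x
  have inj: "inj_on p J" and ind: "superseries.independent ?B" and span: "superseries.span ?B = V"
    using p by (auto simp: basis_family_def)
  have pV: "p i \<in> V" if "i \<in> J" for i
    using that superseries.span_base[of "p i" ?B] span by blast
  have V: "superseries.subspace V" using superseries.subspace_span span by blast
  have phi_v: "(i = j \<longrightarrow> \<phi> i (v j) \<noteq> 0) \<and> (i \<noteq> j \<longrightarrow> \<phi> i (v j) \<noteq> 0 \<longrightarrow> r i < r j) \<and> v j \<in> V"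
    if ij: "i \<in> J" "j \<in> J" for i j
  proof -
    let ?S = "p ` {k \<in> J. r k < r j}"
    obtain d where d: "d \<noteq> 0" and y: "v j - scaleQ d (p j) \<in> superseries.span ?S"
      using v[OF ij(2)] by blast
    define y where "y = v j - scaleQ d (p j)"
    have yS: "y \<in> superseries.span ?S" using y y_def by simp
    have yV: "y \<in> superseries.span ?B"
      using yS superseries.span_mono[of ?S ?B] by blast
    have vj: "v j = scaleQ d (p j) + y" by (simp add: y_def)
    have sV: "scaleQ d (p j) \<in> superseries.span ?B"
      using pV[OF ij(2)] span superseries.span_scale by blast
    have "\<phi> i (v j) = d * of_bool (i = j) + \<phi> i y"
      unfolding \<phi>_def vj using sV yV pV[OF ij(2)] span ij inj
      by (auto simp: superseries.representation_add[OF ind] superseries.representation_scale[OF ind]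
          superseries.representation_basis[OF ind] inj_on_eq_iff)
    moreover have "r i < r j" if "\<phi> i y \<noteq> 0"
    proof -
      \<comment> \<open>Coordinates do not change when the independent set is enlarged, so the
        remainder has nonzero coordinates only at members of smaller rank.\<close>
      have "superseries.representation ?B y = superseries.representation ?S y"
        by (rule superseries.representation_extend[OF ind yS]) auto
      then have "p i \<in> ?S"
        using that superseries.representation_ne_zero unfolding \<phi>_def by metis
      then show ?thesis using inj ij(1) by (auto simp: inj_on_def)
    qed
    moreover have "v j \<in> V"
      unfolding vj using superseries.span_add[OF sV yV] span by simp
    ultimately show ?thesis using d by auto
  qed
  show ?thesis
  proof (rule basis_family_triangular[where \<phi> = \<phi> and r = r])
    show "x = 0" if "x \<in> V" "\<And>i. i \<in> J \<Longrightarrow> \<phi> i x = 0" for x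
    proof -
      have "superseries.representation ?B x b = 0" for b
        using that(2) superseries.representation_ne_zero[of ?B x b] unfolding \<phi>_def by auto
      then show ?thesis
        using superseries.sum_nonzero_representation_eq[OF ind, of x] that(1) span by simp
    qed
    show "finite {i \<in> J. \<phi> i x \<noteq> 0}" if "x \<in> V" for x
    proof -
      have "p ` {i \<in> J. \<phi> i x \<noteq> 0} \<subseteq> {b. superseries.representation ?B x b \<noteq> 0}"
        by (auto simp: \<phi>_def)
      then have "finite (p ` {i \<in> J. \<phi> i x \<noteq> 0})"
        using superseries.finite_representation finite_subset by blast
      then show ?thesis
        by (rule finite_imageD) (rule inj_on_subset[OF inj], auto)
    qed
  qed (use V phi_v span in \<open>auto simp: \<phi>_def superseries.representation_add[OF ind]
        superseries.representation_scale[OF ind]\<close>)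
qed

section \<open>Sums over words\<close>

lemma coeff_sum: "coeff (\<Sum>i\<in>A. f i) S w = (\<Sum>i\<in>A. coeff (f i) S w)"
  by (induction A rule: infinite_finite_induct) auto

text \<open>All families are written as weights on the fixed set of words of a bidegree, so that
  conditions on words and linear combinations are handled alike.\<close>

definition word_sum :: "nat \<Rightarrow> nat \<Rightarrow> (word \<Rightarrow> rat) \<Rightarrow> superseries" where
  "word_sum n m C = formal_sum (words n m) C word_val"

lemma coeff_word_sum:
  assumes "finite S"
  shows "coeff (word_sum n m C) S w = (if length w = n then
    \<Sum>a | set a \<subseteq> S \<and> length a = m. C (a, w) * coeff (word_val (a, w)) S w else 0)"
proof -
  let ?A = "{u. u \<in> words n m \<and> coeff (word_val u) S w \<noteq> 0}"
  let ?L = "{a. set a \<subseteq> S \<and> length a = m}"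
  have e: "coeff (word_sum n m C) S w = (\<Sum>u\<in>?A. C u * coeff (word_val u) S w)"
    unfolding word_sum_def by (rule coeff_formal_sum_words[OF subset_refl])
  have sub: "u \<in> (\<lambda>a. (a, w)) ` ?L \<and> length w = n" if "u \<in> ?A" for u
    using that word_val_nonzero[of "fst u" "snd u" S w] by (cases u) (auto simp: words_def)
  show ?thesis
  proof (cases "length w = n")
    case True
    have "(\<Sum>u\<in>?A. C u * coeff (word_val u) S w) =
        (\<Sum>u\<in>(\<lambda>a. (a, w)) ` ?L. C u * coeff (word_val u) S w)"
      using sub True assms
      by (intro sum.mono_neutral_left) (auto simp: words_def finite_lists_length_eq)
    also have "\<dots> = (\<Sum>a\<in>?L. C (a, w) * coeff (word_val (a, w)) S w)"
      by (subst sum.reindex) (auto simp: inj_on_def)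
    finally show ?thesis using e True by simp
  next
    case False
    then have A: "?A = {}" using sub by blast
    show ?thesis unfolding e A using False by simp
  qed
qed

lemma formal_sum_eq_word_sum:
  assumes "W \<subseteq> words n m"
  shows "formal_sum W C word_val = word_sum n m (\<lambda>u. if u \<in> W then C u else 0)"
proof (rule superseries_eqI)
  fix S w
  show "coeff (formal_sum W C word_val) S w =
      coeff (word_sum n m (\<lambda>u. if u \<in> W then C u else 0)) S w"
    unfolding word_sum_def coeff_formal_sum_words[OF assms] coeff_formal_sum_words[OF subset_refl]
    using assms finite_contributions[of "words n m" S w]
    by (intro sum.mono_neutral_cong_left) auto
qed

text \<open>A word with a repeated fermionic letter has value zero, so weights need only be compared
  on words with \<open>distinct a\<close>.\<close>

lemma word_sum_cong:
  assumes "\<And>a b. length a = m \<Longrightarrow> length b = n \<Longrightarrow> distinct a \<Longrightarrow> C (a, b) = D (a, b)"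
  shows "word_sum n m C = word_sum n m D"
proof (rule superseries_eqI)
  fix S :: "nat set" and w assume "finite S"
  then show "coeff (word_sum n m C) S w = coeff (word_sum n m D) S w"
    using assms word_val_nonzero by (fastforce simp: coeff_word_sum intro!: sum.cong)
qed

lemma word_sum_linear:
  "word_sum n m (\<lambda>u. \<Sum>i\<in>A. k i * C i u) = (\<Sum>i\<in>A. scaleQ (k i) (word_sum n m (C i)))"
proof (rule superseries_eqI)
  fix S :: "nat set" and w assume "finite S"
  then show "coeff (word_sum n m (\<lambda>u. \<Sum>i\<in>A. k i * C i u)) S w =
      coeff (\<Sum>i\<in>A. scaleQ (k i) (word_sum n m (C i))) S w"
    by (auto simp: coeff_sum coeff_word_sum sum_distrib_left sum_distrib_right mult.assoc
        intro: sum.swap)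
qed

text \<open>The rearrangement scalar depends on the order of the positions and not on the
  substituted letters. Hence both sides may be brought to the order starting with
  \<open>x, y\<close> at the same cost, and there the claim is anticommutation of the first two
  factors.\<close>

lemma word_val_swap:
  assumes "distinct xs" "x \<in> set xs" "y \<in> set xs" "x \<noteq> y"
  shows "word_val (map (g \<circ> transpose x y) xs, b) = - word_val (map g xs, b)"
proof -
  define R where "R = filter (\<lambda>z. z \<noteq> x \<and> z \<noteq> y) xs"
  have "set xs = set (x # y # R)" "distinct (x # y # R)" using assms by (auto simp: R_def)
  then have "mset xs = mset (x # y # R)"
    using assms(1) set_eq_iff_mset_eq_distinct by blast
  then obtain s where s: "\<And>\<pi> b. word_val (map \<pi> xs, b) = scaleQ s (word_val (map \<pi> (x # y # R), b))"
    using word_val_rearrange by metis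
  have R: "map (g \<circ> transpose x y) (x # y # R) = g y # g x # map g R"
    by (auto simp: R_def transpose_def)
  have "word_val (g y # g x # map g R, b) = - word_val (g x # g y # map g R, b)"
    using word_val_move[of "g y" "[g x]" "map g R" b]
    by (auto intro!: superseries_eqI)
  then show ?thesis
    unfolding s R by (auto intro!: superseries_eqI)
qed

text \<open>For a bijection, only the monomial of \<open>S\<close> and \<open>w\<close> can be sent
  to this coefficient. The factor in front is the sign of resorting; it is left unevaluated, since
  all that matters is that it does not depend on \<open>f\<close>.\<close>

lemma coeff_act:
  assumes "bij \<pi>" "finite S"
  shows "coeff (act \<pi> f) (\<pi> ` S) (map \<pi> w) =
    coeff (word_val (map \<pi> (sorted_list_of_set S), map \<pi> w)) (\<pi> ` S) (map \<pi> w) * coeff f S w"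
proof -
  let ?g = "\<lambda>(a, b). word_val (map \<pi> a, map \<pi> b)"
  let ?c = "\<lambda>(a, b). coeff f (set a) b"
  let ?u = "(sorted_list_of_set S, w)"
  obtain d where d: "\<And>S w. coeff f S w \<noteq> 0 \<Longrightarrow> finite S \<and> card S + length w \<le> d"
    using bounded_coeff[of f] unfolding bounded_degree_def by blast
  have inj: "inj \<pi>" using assms(1) bij_is_inj by blast
  have "coeff (act \<pi> f) T v =
      (\<Sum>u | u \<in> sorted_words \<and> coeff (?g u) T v \<noteq> 0. ?c u * coeff (?g u) T v)" for T v
    unfolding act_def
  proof (rule coeff_formal_sum[where d = d])
    fix u T v assume u: "u \<in> sorted_words" "?c u \<noteq> 0" "coeff (?g u) T v \<noteq> 0"
    obtain a b where [simp]: "u = (a, b)" by (cases u)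
    have "T = \<pi> ` set a" "v = map \<pi> b" using u(3) word_val_nonzero[of "map \<pi> a" "map \<pi> b" T v] by auto
    moreover have "card (set a) + length b \<le> d" using u(2) d by simp
    ultimately show "card T + length v \<le> d"
      by (simp add: card_image[OF inj_on_subset[OF inj subset_UNIV]])
  qed
  then have "coeff (act \<pi> f) (\<pi> ` S) (map \<pi> w) =
      (\<Sum>u | u \<in> sorted_words \<and> coeff (?g u) (\<pi> ` S) (map \<pi> w) \<noteq> 0.
        ?c u * coeff (?g u) (\<pi> ` S) (map \<pi> w))" .
  also have "\<dots> = (\<Sum>u\<in>{?u}. ?c u * coeff (?g u) (\<pi> ` S) (map \<pi> w))"
  proof (rule sum.mono_neutral_left)
    show "{u. u \<in> sorted_words \<and> coeff (?g u) (\<pi> ` S) (map \<pi> w) \<noteq> 0} \<subseteq> {?u}"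
    proof clarsimp
      fix a b assume ab: "(a, b) \<in> sorted_words"
        "coeff (word_val (map \<pi> a, map \<pi> b)) (\<pi> ` S) (map \<pi> w) \<noteq> 0"
      have "\<pi> ` S = \<pi> ` set a" "map \<pi> w = map \<pi> b"
        using word_val_nonzero[OF ab(2)] by auto
      then have "S = set a" "w = b"
        using inj by (auto simp: inj_image_eq_iff)
      then show "a = sorted_list_of_set S \<and> b = w"
        using ab(1) by (simp add: sorted_words_def sorted_list_of_set.idem_if_sorted_distinct
            strict_sorted_iff)
    qed
  qed (auto simp: sorted_words_def)
  also have "\<dots> = coeff (word_val (map \<pi> (sorted_list_of_set S), map \<pi> w)) (\<pi> ` S) (map \<pi> w) *
      coeff f S w"
    using assms(2) by simp
  finally show ?thesis .
qed

lemma word_sum_in_sNCSym: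
  assumes C: "\<And>\<pi> a b. bij \<pi> \<Longrightarrow> length a = m \<Longrightarrow> length b = n \<Longrightarrow> C (map \<pi> a, map \<pi> b) = C (a, b)"
  shows "word_sum n m C \<in> sNCSym"
  unfolding sNCSym_def
proof (clarify, rule superseries_eqI)
  fix \<pi> :: "nat \<Rightarrow> nat" and T :: "nat set" and v :: "nat list"
  assume "permutation \<pi>" and T: "finite T"
  then have bij: "bij \<pi>" by (simp add: permutation_bijective)
  then have inj: "inj \<pi>" and surj: "surj \<pi>" by (auto simp: bij_def)
  define S w where "S = inv \<pi> ` T" and "w = map (inv \<pi>) v"
  have Tv: "T = \<pi> ` S" "v = map \<pi> w"
    using surj by (simp_all add: S_def w_def image_image surj_f_inv_f map_idI)
  have fS: "finite S" using T by (simp add: S_def)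
  let ?k = "coeff (word_val (map \<pi> (sorted_list_of_set S), map \<pi> w)) (\<pi> ` S) (map \<pi> w)"
  have "coeff (word_sum n m C) T v = ?k * coeff (word_sum n m C) S w"
  proof (cases "length w = n")
    case True
    let ?L = "\<lambda>S. {a. set a \<subseteq> S \<and> length a = m}"
    have L: "?L T = map \<pi> ` ?L S"
    proof
      show "?L T \<subseteq> map \<pi> ` ?L S"
      proof
        fix a assume "a \<in> ?L T"
        then have "map (inv \<pi>) a \<in> ?L S" "a = map \<pi> (map (inv \<pi>) a)"
          using surj by (auto simp: S_def surj_f_inv_f map_idI)
        then show "a \<in> map \<pi> ` ?L S" by blast
      qed
      show "map \<pi> ` ?L S \<subseteq> ?L T" unfolding Tv(1) by (auto intro!: imageI elim!: subsetD)
    qed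
    have "coeff (word_sum n m C) T v =
        (\<Sum>a\<in>map \<pi> ` ?L S. C (a, v) * coeff (word_val (a, v)) T v)"
      unfolding L[symmetric] using True T by (simp add: coeff_word_sum Tv(2))
    also have "\<dots> = (\<Sum>a\<in>?L S. C (map \<pi> a, v) * coeff (word_val (map \<pi> a, v)) T v)"
      by (subst sum.reindex) (use inj_on_subset[OF inj_mapI[OF inj]] in \<open>auto simp: o_def\<close>)
    also have "\<dots> = (\<Sum>a\<in>?L S. ?k * (C (a, w) * coeff (word_val (a, w)) S w))"
    proof (intro sum.cong refl)
      \<comment> \<open>Applied to the single word \<open>(a, w)\<close>, \<open>coeff_act\<close>
        shows that its image acquires the same factor \<open>?k\<close> for every arrangement
        \<open>a\<close>.\<close>
      fix a assume "a \<in> ?L S"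
      then show "C (map \<pi> a, v) * coeff (word_val (map \<pi> a, v)) T v =
          ?k * (C (a, w) * coeff (word_val (a, w)) S w)"
        using coeff_act[OF bij fS, of "word_val (a, w)" w] C[OF bij, of a w] True
        unfolding Tv by (simp add: act_word_val[OF inj])
    qed
    also have "\<dots> = ?k * coeff (word_sum n m C) S w"
      using True fS by (simp add: coeff_word_sum sum_distrib_left)
    finally show ?thesis .
  qed (use fS T in \<open>simp add: coeff_word_sum Tv(2)\<close>)
  then show "coeff (act \<pi> (word_sum n m C)) T v = coeff (word_sum n m C) T v"
    by (simp add: Tv coeff_act[OF bij fS])
qed

section \<open>Coefficients of symmetric series\<close>

lemma sNCSym_coeff_eq:
  assumes "f \<in> sNCSym" "permutation \<pi>" "finite S" "coeff f S w = 0"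
  shows "coeff f (\<pi> ` S) (map \<pi> w) = 0"
  using coeff_act[OF permutation_bijective[OF assms(2)] assms(3), of f w] assms
  by (simp add: sNCSym_def)

text \<open>The transposition of \<open>x\<close> and \<open>y\<close> fixes \<open>w\<close> and
  the set \<open>S\<close> but reverses the sign of the monomial, so invariance makes the
  coefficient its own negative.\<close>

lemma sNCSym_coeff_zero:
  assumes f: "f \<in> sNCSym" and xy: "x \<in> S - set w" "y \<in> S - set w" "x \<noteq> y"
  shows "coeff f S w = 0"
proof (cases "finite S")
  case True
  let ?t = "transpose x y" and ?a = "sorted_list_of_set S"
  have w: "map ?t w = w" using xy by (auto intro!: map_idI simp: transpose_def)
  have S: "?t ` S = S"
    using xy by (simp add: transpose_image_eq)
  have "word_val (map ?t ?a, w) = - word_val (?a, w)"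
    using word_val_swap[of ?a x y id w] xy True by simp
  moreover have "coeff (word_val (?a, w)) S w = 1"
    using True by (simp add: coeff_sorted_word)
  ultimately have "coeff (word_val (map ?t ?a, w)) S w = - 1" by simp
  moreover have "act ?t f = f"
    using f by (simp add: sNCSym_def permutation_swap_id)
  ultimately have "coeff f S w = - coeff f S w"
    using coeff_act[of ?t S f w] True unfolding w S by simp
  then show ?thesis by simp
qed (rule coeff_infinite)

lemma sNCSym_subspace: "superseries.subspace sNCSym"
proof -
  have *: "act \<pi> (scaleQ c x + y) = scaleQ c x + y"
    if "permutation \<pi>" "act \<pi> x = x" "act \<pi> y = y" for c x y \<pi>
  proof (rule superseries_eqI)
    fix T :: "nat set" and v :: "nat list" assume T: "finite T"
    have bij: "bij \<pi>" using that(1) by (simp add: permutation_bijective)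
    then have surj: "surj \<pi>" by (auto simp: bij_def)
    define S w where "S = inv \<pi> ` T" and "w = map (inv \<pi>) v"
    have Tv: "T = \<pi> ` S" "v = map \<pi> w"
      using surj by (simp_all add: S_def w_def image_image surj_f_inv_f map_idI)
    have fS: "finite S" using T by (simp add: S_def)
    show "coeff (act \<pi> (scaleQ c x + y)) T v = coeff (scaleQ c x + y) T v"
      using coeff_act[OF bij fS, of x w] coeff_act[OF bij fS, of y w] that(2,3)
      by (simp add: Tv coeff_act[OF bij fS] algebra_simps)
  qed
  have "act \<pi> 0 = 0" for \<pi>
    by (rule superseries_eqI) (simp add: act_def formal_sum_def coeff_Abs bounded_degree_def split_def)
  then show ?thesis
    using *[where y = 0] *[where c = 1] unfolding superseries.subspace_def sNCSym_def by simp
qed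

section \<open>Supercompositions as kernels\<close>

text \<open>Containment of kernels on the first \<open>N\<close> positions. The two value types are
  independent, so block indices, letters, pairs and whole functions can be compared with each
  other.\<close>

definition finer :: "nat \<Rightarrow> (nat \<Rightarrow> 'a) \<Rightarrow> (nat \<Rightarrow> 'b) \<Rightarrow> bool" where
  "finer N c d \<longleftrightarrow> (\<forall>x<N. \<forall>y<N. c x = c y \<longrightarrow> d x = d y)"

lemma finerD: "finer N c d \<Longrightarrow> x < N \<Longrightarrow> y < N \<Longrightarrow> c x = c y \<Longrightarrow> d x = d y"
  unfolding finer_def by blast

lemma finer_trans: "finer N c d \<Longrightarrow> finer N d e \<Longrightarrow> finer N c e"
  unfolding finer_def by blast

text \<open>The values of \<open>d\<close> are a function \<open>g\<close> of those of
  \<open>c\<close>. If the images have the same size, \<open>g\<close> is injective and the kernels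
  coincide; this turns equal numbers of blocks into equal partitions.\<close>

lemma finer_card:
  assumes "finer N c d"
  shows "card (d ` {..<N}) \<le> card (c ` {..<N})"
    and "card (c ` {..<N}) \<le> card (d ` {..<N}) \<Longrightarrow> finer N d c"
proof -
  define g where "g = d \<circ> inv_into {..<N} c"
  have g: "g (c x) = d x" if "x < N" for x
  proof -
    have "inv_into {..<N} c (c x) < N" using inv_into_into[of "c x" c "{..<N}"] that by auto
    moreover have "c (inv_into {..<N} c (c x)) = c x" using that by (simp add: f_inv_into_f)
    ultimately show ?thesis using finerD[OF assms, OF _ that] by (simp add: g_def)
  qed
  have d: "d ` {..<N} = g ` (c ` {..<N})" using g by (auto simp: image_image)
  show le: "card (d ` {..<N}) \<le> card (c ` {..<N})" unfolding d by (rule card_image_le) simp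
  assume "card (c ` {..<N}) \<le> card (d ` {..<N})"
  with le have "card (g ` (c ` {..<N})) = card (c ` {..<N})" unfolding d by simp
  then have "inj_on g (c ` {..<N})" by (intro eq_card_imp_inj_on) auto
  then have "c x = c y" if "x < N" "y < N" "d x = d y" for x y
    using g that inj_onD[of g "c ` {..<N}" "c x" "c y"] by auto
  then show "finer N d c" unfolding finer_def by blast
qed

text \<open>
  A word \<open>(a, b)\<close> with \<open>m\<close> fermionic letters is read as the function \<open>(!) (a @ b)\<close> on the positions
  \<open>{..<m + n}\<close>: the position \<open>i < m\<close> stands for the element 0 of the \<open>i\<close>-th block and the position
  \<open>m + j - 1\<close> for the element \<open>j \<ge> 1\<close>. A supercomposition becomes the function sending a position
  to the index of its block.
\<close>

definition idx :: "nat \<Rightarrow> nat set list \<Rightarrow> nat \<Rightarrow> nat" where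
  "idx m K x = (if x < m then x else THE i. i < length K \<and> Suc (x - m) \<in> K ! i)"

lemma idx_less_m [simp]: "x < m \<Longrightarrow> idx m K x = x"
  by (simp add: idx_def)

context
  fixes n m K assumes K: "K \<in> sC n m"
begin

lemma idx_eq_iff:
  assumes "m \<le> x" "x < m + n"
  shows "idx m K x = i \<longleftrightarrow> i < length K \<and> Suc (x - m) \<in> K ! i"
proof -
  have "Suc (x - m) \<in> {1..n}" using assms by auto
  moreover have "(\<Union>B\<in>set K. pos B) = {1..n}" using K by (simp add: sC_def)
  ultimately have "Suc (x - m) \<in> (\<Union>B\<in>set K. pos B)" by (rule ssubst[rotated])
  then obtain B where "B \<in> set K" "Suc (x - m) \<in> B" unfolding pos_def by blast
  then obtain k where k: "k < length K" "Suc (x - m) \<in> K ! k" by (auto simp: in_set_conv_nth)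
  have uniq: "j = k" if "j < length K" "Suc (x - m) \<in> K ! j" for j
  proof (rule ccontr)
    assume "j \<noteq> k"
    then have "K ! j \<inter> K ! k \<subseteq> {0}" using K that(1) k(1) by (simp add: sC_def)
    then show False using that(2) k(2) by auto
  qed
  have "(THE i. i < length K \<and> Suc (x - m) \<in> K ! i) = k"
    by (rule the_equality) (use k uniq in blast)+
  then have "idx m K x = k" using assms by (simp add: idx_def)
  then show ?thesis using k uniq by blast
qed

lemma idx_pos_iff:
  assumes "1 \<le> j" "j \<le> n"
  shows "idx m K (m + j - 1) = i \<longleftrightarrow> i < length K \<and> j \<in> K ! i"
  using idx_eq_iff[of "m + j - 1" i] assms by auto

lemma idx_less_length: "x < m + n \<Longrightarrow> idx m K x < length K"
  using K idx_eq_iff[of x "idx m K x"] by (cases "x < m") (auto simp: sC_def)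

lemma zero_in_block_iff: "i < length K \<Longrightarrow> 0 \<in> K ! i \<longleftrightarrow> i < m"
  using K by (simp_all add: sC_def)

lemma block_eq:
  assumes "i < length K"
  shows "K ! i = (if i < m then {0} else {}) \<union> {j \<in> {1..n}. idx m K (m + j - 1) = i}"
proof -
  have sub: "K ! i \<subseteq> {0..n}" using K assms by (simp add: sC_def)
  have "j \<in> K ! i \<longleftrightarrow> j \<in> (if i < m then {0} else {}) \<union> {j \<in> {1..n}. idx m K (m + j - 1) = i}" for j
    using zero_in_block_iff[OF assms] idx_pos_iff[of j i] assms sub
    by (cases "j = 0") (auto simp: not_less_eq_eq)
  then show ?thesis by blast
qed

lemma pos_block_eq: "i < length K \<Longrightarrow> pos (K ! i) = {j \<in> {1..n}. idx m K (m + j - 1) = i}"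
  by (subst block_eq) (auto simp: pos_def)

lemma idx_image: "idx m K ` {..<m + n} = {..<length K}"
proof (intro equalityI subsetI)
  fix i assume "i \<in> {..<length K}"
  then have i: "i < length K" by simp
  show "i \<in> idx m K ` {..<m + n}"
  proof (cases "i < m")
    case True
    then show ?thesis by (intro image_eqI[of _ _ i]) auto
  next
    case False
    have "K ! i \<noteq> {}" using K i by (simp add: sC_def)
    then obtain j where "j \<in> {1..n}" "idx m K (m + j - 1) = i"
      using block_eq[OF i] False by auto
    then show ?thesis by (intro image_eqI[of _ _ "m + j - 1"]) auto
  qed
qed (use idx_less_length in auto)

lemma length_eq_card: "length K = card (idx m K ` {..<m + n})"
  by (simp add: idx_image)

lemma fermionic_length: "m \<le> length K" "m \<le> n + 1"
  using K by (simp_all add: sC_def)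

lemma length_le: "length K \<le> m + n"
  using length_eq_card card_image_le[of "{..<m + n}" "idx m K"] by simp

lemma Min_blocks_sorted: "sorted_wrt (<) (map Min (drop m K))"
  using K by (auto simp: sC_def sorted_wrt_iff_nth_less)

end

lemma in_set_drop_iff: "B \<in> set (drop m L) \<longleftrightarrow> (\<exists>i\<ge>m. i < length L \<and> B = L ! i)"
proof
  assume "B \<in> set (drop m L)"
  then obtain k where "k < length L - m" "B = L ! (m + k)" by (auto simp: in_set_conv_nth)
  then show "\<exists>i\<ge>m. i < length L \<and> B = L ! i" by (intro exI[of _ "m + k"]) auto
next
  assume "\<exists>i\<ge>m. i < length L \<and> B = L ! i"
  then obtain i where "m \<le> i" "i < length L" "B = L ! i" by blast
  then have "i - m < length (drop m L)" "drop m L ! (i - m) = B" by auto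
  then show "B \<in> set (drop m L)" using nth_mem by blast
qed

text \<open>The kernel fixes the unordered partition. The order is then forced: a fermionic block is
  named by its own position below \<open>m\<close>, and the other blocks are sorted by
  minimum.\<close>

lemma sC_eqI:
  assumes K: "K \<in> sC n m" and L: "L \<in> sC n m"
    and fin: "finer (m + n) (idx m K) (idx m L)" "finer (m + n) (idx m L) (idx m K)"
  shows "K = L"
proof -
  have iff: "idx m K x = idx m K y \<longleftrightarrow> idx m L x = idx m L y" if "x < m + n" "y < m + n" for x y
    using finerD[OF fin(1) that] finerD[OF fin(2) that] by blast
  have sub: "set (drop m K) \<subseteq> set (drop m L)"
    if K: "K \<in> sC n m" and L: "L \<in> sC n m"
      and iff: "\<And>x y. x < m + n \<Longrightarrow> y < m + n \<Longrightarrow> idx m K x = idx m K y \<longleftrightarrow> idx m L x = idx m L y"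
    for K L
  proof
    fix B assume "B \<in> set (drop m K)"
    then obtain i where i: "m \<le> i" "i < length K" "B = K ! i"
      unfolding in_set_drop_iff by blast
    then obtain x where x: "x < m + n" "idx m K x = i"
      using idx_image[OF K] by (metis imageE lessThan_iff)
    define k where "k = idx m L x"
    have k: "k < length L" using idx_less_length[OF L x(1)] by (simp add: k_def)
    have "\<not> k < m"
    proof
      assume "k < m"
      then have "idx m K x = idx m K k" using iff[of x k] x(1) by (simp add: k_def)
      then show False using x(2) i(1) \<open>k < m\<close> by simp
    qed
    then have "L ! k = {j \<in> {1..n}. idx m L (m + j - 1) = k}" using block_eq[OF L k] by simp
    moreover have "K ! i = {j \<in> {1..n}. idx m K (m + j - 1) = i}"
      using block_eq[OF K i(2)] i(1) by simp
    moreover have "idx m K (m + j - 1) = i \<longleftrightarrow> idx m L (m + j - 1) = k" if "j \<in> {1..n}" for j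
      using iff[of "m + j - 1" x] x that by (auto simp: k_def)
    ultimately have "L ! k = K ! i" by blast
    then show "B \<in> set (drop m L)"
      using i(3) k \<open>\<not> k < m\<close> unfolding in_set_drop_iff by (intro exI[of _ k]) simp
  qed
  have sets: "set (drop m K) = set (drop m L)"
  proof
    show "set (drop m K) \<subseteq> set (drop m L)" by (rule sub[OF K L]) (rule iff)
    show "set (drop m L) \<subseteq> set (drop m K)" by (rule sub[OF L K]) (rule iff[symmetric])
  qed
  \<comment> \<open>Equal sets of blocks have equal sets of minima; the lists of minima are strictly
    sorted, hence equal, and \<open>Min\<close> is injective on these disjoint blocks.\<close>
  have "map Min (drop m K) = map Min (drop m L)"
    using Min_blocks_sorted[OF K] Min_blocks_sorted[OF L] sets
    by (intro strict_sorted_equal) (simp_all add: sets)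
  moreover have "inj_on Min (set (drop m K) \<union> set (drop m L))"
    using Min_blocks_sorted[OF L] unfolding sets
    by (simp add: strict_sorted_iff distinct_map)
  ultimately have d: "drop m K = drop m L" by (rule map_inj_on)
  have "take m K = take m L"
  proof (rule nth_equalityI)
    show "length (take m K) = length (take m L)"
      using fermionic_length(1)[OF K] fermionic_length(1)[OF L] by simp
    fix i assume "i < length (take m K)"
    then have i: "i < m" "i < length K" "i < length L"
      using fermionic_length(1)[OF K] fermionic_length(1)[OF L] by auto
    have "idx m K (m + j - 1) = i \<longleftrightarrow> idx m L (m + j - 1) = i" if "j \<in> {1..n}" for j
      using iff[of "m + j - 1" i] that i by auto
    then show "take m K ! i = take m L ! i"
      using i block_eq[OF K i(2)] block_eq[OF L i(3)] by auto
  qed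
  with d show ?thesis by (metis append_take_drop_id)
qed

text \<open>Each class is represented by its first position, and blocks are listed in the order of
  their representatives. This is the order required by \<open>sC\<close> once the first
  \<open>m\<close> positions are pairwise inequivalent.\<close>

definition of_kernel :: "nat \<Rightarrow> nat \<Rightarrow> (nat \<Rightarrow> 'a) \<Rightarrow> nat set list" where
  "of_kernel n m c = map (\<lambda>x. (if x < m then {0} else {}) \<union> {j \<in> {1..n}. c (m + j - 1) = c x})
     (filter (\<lambda>x. \<forall>y<x. c y \<noteq> c x) [0..<m + n])"

lemma of_kernel:
  assumes inj: "inj_on c {..<m}" and m: "m \<le> n + 1"
  shows "of_kernel n m c \<in> sC n m"
    and "finer (m + n) c (idx m (of_kernel n m c))" "finer (m + n) (idx m (of_kernel n m c)) c"
proof -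
  define R where "R = filter (\<lambda>x. \<forall>y<x. c y \<noteq> c x) [0..<m + n]"
  define K where "K = of_kernel n m c"
  have len: "length K = length R" by (simp add: K_def of_kernel_def R_def)
  have nth: "K ! i = (if R ! i < m then {0} else {}) \<union> {j \<in> {1..n}. c (m + j - 1) = c (R ! i)}"
    if "i < length R" for i
    using that by (simp add: K_def of_kernel_def R_def)
  have "R = filter (\<lambda>x. \<forall>y<x. c y \<noteq> c x) [0..<m] @ filter (\<lambda>x. \<forall>y<x. c y \<noteq> c x) [m..<m + n]"
    unfolding R_def by (simp only: upt_add_eq_append[of 0 m n, simplified] filter_append)
  \<comment> \<open>By injectivity each position below \<open>m\<close> is the first of its class,
    so block \<open>i < m\<close> is the class of position \<open>i\<close>.\<close>
  also have "filter (\<lambda>x. \<forall>y<x. c y \<noteq> c x) [0..<m] = [0..<m]"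
    unfolding filter_id_conv using inj_onD[OF inj] by fastforce
  finally have R: "R = [0..<m] @ filter (\<lambda>x. \<forall>y<x. c y \<noteq> c x) [m..<m + n]" .
  have mR: "m \<le> length R" using arg_cong[OF R, of length] by simp
  have R1: "R ! i = i" if "i < m" for i using that by (simp add: arg_cong[OF R, of "\<lambda>R. R ! i"] nth_append)
  have R2: "m \<le> R ! i" if "m \<le> i" "i < length R" for i
  proof -
    let ?F = "filter (\<lambda>x. \<forall>y<x. c y \<noteq> c x) [m..<m + n]"
    have "i - m < length ?F" using that arg_cong[OF R, of length] by simp
    then have "?F ! (i - m) \<in> set [m..<m + n]" using nth_mem[of "i - m" ?F] by auto
    moreover have "R ! i = ?F ! (i - m)" using that(1) by (simp add: arg_cong[OF R, of "\<lambda>R. R ! i"] nth_append)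
    ultimately show ?thesis by simp
  qed
  have Rm: "R ! i < m \<longleftrightarrow> i < m" if "i < length R" for i
    using R1[of i] R2[of i] that by (cases "i < m") auto
  have srt: "sorted_wrt (<) R" by (simp add: R_def sorted_wrt_filter)
  have RN: "R ! i < m + n" "\<And>y. y < R ! i \<Longrightarrow> c y \<noteq> c (R ! i)" if "i < length R" for i
    using nth_mem[OF that] by (auto simp: R_def)
  have Rless: "R ! i < R ! j" if "i < j" "j < length R" for i j
    using srt that by (auto simp: sorted_wrt_iff_nth_less)
  have Rinj: "i = j" if "i < length R" "j < length R" "c (R ! i) = c (R ! j)" for i j
    using that Rless RN by (metis nat_neq_iff)
  have rep: "\<exists>i<length R. c (R ! i) = c x" if "x < m + n" for x
  proof -
    define y where "y = (LEAST y. c y = c x)"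
    have y: "c y = c x" unfolding y_def by (rule LeastI[of _ x]) simp
    moreover have "y \<le> x" unfolding y_def by (rule Least_le) simp
    moreover have "c z \<noteq> c x" if "z < y" for z
      using not_less_Least[of z "\<lambda>y. c y = c x"] that by (simp add: y_def)
    ultimately have "y \<in> set R" using that by (auto simp: R_def)
    then show ?thesis using y by (metis in_set_conv_nth)
  qed
  \<comment> \<open>In a nonfermionic block the least element is the one at the representative; the
    successor converts positions counted from 0 into elements counted from 1. Sorted representatives
    thus give sorted minima.\<close>
  have Kfst: "m \<le> i \<Longrightarrow> i < length R \<Longrightarrow> Min (K ! i) = Suc (R ! i - m)" for i
  proof (rule Min_eqI)
    assume i: "m \<le> i" "i < length R"
    then show "finite (K ! i)" by (simp add: nth)
    show "Suc (R ! i - m) \<in> K ! i"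
      using R2[OF i] RN(1)[OF i(2)] by (auto simp: nth[OF i(2)])
    fix j assume j: "j \<in> K ! i"
    then have "c (m + j - 1) = c (R ! i)" "1 \<le> j" using i Rm[OF i(2)] by (auto simp: nth[OF i(2)])
    then show "Suc (R ! i - m) \<le> j" using RN(2)[OF i(2), of "m + j - 1"] by linarith
  qed
  have K: "K \<in> sC n m"
    unfolding sC_def mem_Collect_eq
  proof (intro conjI allI impI ballI)
    show "m \<le> n + 1" "m \<le> length K" using m mR len by auto
    fix B assume "B \<in> set K"
    then obtain i where i: "i < length R" "B = K ! i" by (auto simp: in_set_conv_nth len)
    show "B \<subseteq> {0..n}" using i by (auto simp: nth)
    show "B \<noteq> {}"
    proof (cases "i < m")
      case False
      then have "Suc (R ! i - m) \<in> K ! i"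
        using R2[of i] RN(1)[OF i(1)] i(1) by (auto simp: nth[OF i(1)])
      then show ?thesis using i by auto
    qed (use i Rm in \<open>auto simp: nth\<close>)
  next
    show "(\<Union>B\<in>set K. pos B) = {1..n}"
    proof
      show "(\<Union>B\<in>set K. pos B) \<subseteq> {1..n}"
        by (auto simp: in_set_conv_nth len nth pos_def split: if_splits)
      show "{1..n} \<subseteq> (\<Union>B\<in>set K. pos B)"
      proof
        fix j assume j: "j \<in> {1..n}"
        then have "m + j - 1 < m + n" by auto
        then obtain i where i: "i < length R" "c (R ! i) = c (m + j - 1)"
          using rep by blast
        then have "j \<in> pos (K ! i)" using j by (auto simp: nth pos_def)
        then show "j \<in> (\<Union>B\<in>set K. pos B)" using i(1) len by auto
      qed
    qed
  next
    fix i j assume "i < length K" "j < length K" "i \<noteq> j"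
    then show "K ! i \<inter> K ! j \<subseteq> {0}" using Rinj[of i j] by (auto simp: len nth split: if_splits)
  next
    fix i assume "i < length K"
    then show "0 \<in> K ! i \<longleftrightarrow> i < m" by (auto simp: len nth Rm)
  next
    fix i j assume "m \<le> i \<and> i < j \<and> j < length K"
    then show "Min (K ! i) < Min (K ! j)"
      using Kfst[of i] Kfst[of j] Rless[of i j] R2[of i] by (simp add: len)
  qed
  have idx: "idx m K x < length R \<and> c (R ! idx m K x) = c x" if "x < m + n" for x
  proof (cases "x < m")
    case True
    then show ?thesis using R1 mR by simp
  next
    case False
    let ?i = "idx m K x"
    have i: "?i < length R" using idx_less_length[OF K that] len by simp
    have "Suc (x - m) \<in> K ! ?i" using idx_eq_iff[OF K, of x ?i] False that by simp
    then show ?thesis using False i by (auto simp: nth[OF i] split: if_splits)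
  qed
  show "of_kernel n m c \<in> sC n m" using K by (simp add: K_def)
  show "finer (m + n) c (idx m (of_kernel n m c))" "finer (m + n) (idx m (of_kernel n m c)) c"
    using idx Rinj unfolding finer_def K_def[symmetric] by metis+
qed

section \<open>Refinement, meets and types of words\<close>

text \<open>A block of \<open>K\<close> that is a union of blocks of \<open>J\<close> contains every
  block of \<open>J\<close> it meets, because the blocks of \<open>J\<close> share at most 0. The
  fermionic blocks need separate care, as they are matched by index.\<close>

lemma refines_iff_finer:
  assumes J: "J \<in> sC n m" and K: "K \<in> sC n m"
  shows "refines m J K \<longleftrightarrow> finer (m + n) (idx m J) (idx m K)"
proof
  have dropE: "\<exists>i. m \<le> i \<and> i < length L \<and> B = L ! i" if "B \<in> set (drop m L)" for B :: "nat set" and L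
    using that unfolding in_set_drop_iff by blast
  have dropI: "L ! i \<in> set (drop m L)" if "m \<le> i" "i < length L" for L :: "nat set list" and i
    using that unfolding in_set_drop_iff by blast
  {
    assume ref: "refines m J K"
    \<comment> \<open>The last condition is harmless by symmetry: it removes the case where only
      \<open>y\<close> is fermionic.\<close>
    have "idx m K x = idx m K y"
      if xy: "x < m + n" "y < m + n" "idx m J x = idx m J y" "y < m \<longrightarrow> x < m" for x y
    proof (cases "y < m")
      case True
      then show ?thesis using xy by simp
    next
      case y: False
      show ?thesis
      proof (cases "x < m")
        case True
        then have "Suc (y - m) \<in> J ! x"
          using idx_eq_iff[OF J, of y x] y xy by auto
        moreover have "J ! x \<subseteq> K ! x" using ref True by (auto simp: refines_def)
        ultimately show ?thesis
          using idx_eq_iff[OF K, of y x] y xy True fermionic_length(1)[OF K] by auto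
      next
        case x: False
        define i where "i = idx m J x"
        have i: "i < length J" "Suc (x - m) \<in> J ! i" "Suc (y - m) \<in> J ! i"
          using idx_eq_iff[OF J, of x i] idx_eq_iff[OF J, of y i] x y xy by (auto simp: i_def)
        define k where "k = idx m K x"
        have k: "k < length K" "Suc (x - m) \<in> K ! k"
          using idx_eq_iff[OF K, of x k] x xy by (auto simp: k_def)
        obtain S where S: "S \<subseteq> set (drop m J)" "K ! k = (if k < m then J ! k else {}) \<union> \<Union>S"
        proof (cases "k < m")
          case True
          then show ?thesis using ref that unfolding refines_def by (metis (full_types))
        next
          case False
          then have "K ! k \<in> set (drop m K)" using dropI k(1) by simp
          then show ?thesis using ref that False unfolding refines_def by fastforce
        qed
        have "J ! i \<subseteq> K ! k"
        proof (cases "Suc (x - m) \<in> \<Union>S")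
          case True
          then obtain B where B: "B \<in> S" "Suc (x - m) \<in> B" by blast
          obtain i' where i': "i' < length J" "B = J ! i'" using S(1) B(1) dropE by blast
          then have "idx m J x = i'" using idx_eq_iff[OF J, of x i'] x xy(1) B(2) by auto
          then show ?thesis using B(1) S(2) i'(2) by (auto simp: i_def)
        next
          case False
          then have k': "k < m" "Suc (x - m) \<in> J ! k" using k(2) S(2) by (auto split: if_splits)
          then have "idx m J x = k"
            using idx_eq_iff[OF J, of x k] x xy(1) fermionic_length(1)[OF J] by auto
          then show ?thesis using S(2) k'(1) by (auto simp: i_def)
        qed
        then have "Suc (y - m) \<in> K ! k" using i(3) by blast
        then have "idx m K y = k" using idx_eq_iff[OF K, of y k] y xy(2) k(1) by auto
        then show ?thesis by (simp add: k_def)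
      qed
    qed
    then show "finer (m + n) (idx m J) (idx m K)"
      unfolding finer_def by (metis (full_types))
  }
  {
    assume fin: "finer (m + n) (idx m J) (idx m K)"
    have sub: "J ! i \<subseteq> K ! k"
      if i: "i < length J" and k: "k < length K" "i < m \<longrightarrow> k = i"
        and x: "1 \<le> j" "j \<le> n" "j \<in> J ! i" "j \<in> K ! k" for i j k
    proof
      fix l assume l: "l \<in> J ! i"
      show "l \<in> K ! k"
      proof (cases "l = 0")
        case True
        then show ?thesis using l zero_in_block_iff[OF J i] zero_in_block_iff[OF K k(1)] k(2) by simp
      next
        case False
        then have ln: "1 \<le> l" "l \<le> n" using l block_eq[OF J i] by (auto split: if_splits)
        have "idx m J (m + l - 1) = idx m J (m + j - 1)"
          using idx_pos_iff[OF J ln, of i] idx_pos_iff[OF J x(1,2), of i] i l x by auto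
        then have "idx m K (m + l - 1) = idx m K (m + j - 1)"
          using finerD[OF fin, of "m + l - 1" "m + j - 1"] ln x by auto
        then show ?thesis
          using idx_pos_iff[OF K ln, of k] idx_pos_iff[OF K x(1,2), of k] k x by auto
      qed
    qed
    have union: "\<exists>S \<subseteq> set (drop m J). K ! k = (if k < m then J ! k else {}) \<union> \<Union>S"
      if k: "k < length K" for k
    proof (intro exI conjI)
      \<comment> \<open>The largest possible witness: all nonfermionic blocks of \<open>J\<close>
        inside the given block of \<open>K\<close>.\<close>
      let ?S = "{B \<in> set (drop m J). B \<subseteq> K ! k}"
      show "?S \<subseteq> set (drop m J)" by auto
      have fk: "j \<in> K ! k" if km: "k < m" and j: "j \<in> J ! k" for j
      proof (cases "j = 0")
        case True
        then show ?thesis using zero_in_block_iff[OF K k] km by simp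
      next
        case False
        have kJ: "k < length J" using fermionic_length(1)[OF J] km by simp
        then have jn: "1 \<le> j" "j \<le> n" using j False block_eq[OF J kJ] by (auto split: if_splits)
        have "idx m J (m + j - 1) = idx m J k" using idx_pos_iff[OF J jn, of k] j kJ km by auto
        then have "idx m K (m + j - 1) = k" using finerD[OF fin, of "m + j - 1" k] jn km by auto
        then show ?thesis using idx_pos_iff[OF K jn, of k] by simp
      qed
      show "K ! k = (if k < m then J ! k else {}) \<union> \<Union>?S"
      proof
        show "(if k < m then J ! k else {}) \<union> \<Union>?S \<subseteq> K ! k" using fk by auto
        show "K ! k \<subseteq> (if k < m then J ! k else {}) \<union> \<Union>?S"
        proof
          fix j assume j: "j \<in> K ! k"
          show "j \<in> (if k < m then J ! k else {}) \<union> \<Union>?S"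
          proof (cases "j = 0")
            case True
            then have "k < m" using j zero_in_block_iff[OF K k] by simp
            then show ?thesis
              using True zero_in_block_iff[OF J, of k] fermionic_length(1)[OF J] by simp
          next
            case False
            then have jn: "1 \<le> j" "j \<le> n" using j block_eq[OF K k] by (auto split: if_splits)
            define i where "i = idx m J (m + j - 1)"
            have i: "i < length J" "j \<in> J ! i"
              using idx_pos_iff[OF J jn, of i] by (auto simp: i_def)
            have kk: "idx m K (m + j - 1) = k" using idx_pos_iff[OF K jn, of k] j k by simp
            have im: "k = i" if "i < m"
              using finerD[OF fin, of "m + j - 1" i] that jn kk by (auto simp: i_def)
            then have "J ! i \<subseteq> K ! k" using sub[OF i(1) k _ jn i(2) j] by blast
            then show ?thesis
              using im i dropI[of i J] by (cases "i < m") auto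
          qed
        qed
      qed
    qed
    show "refines m J K"
      unfolding refines_def
    proof (intro conjI allI impI ballI)
      fix i assume "i < m"
      then show "\<exists>S\<subseteq>set (drop m J). K ! i = J ! i \<union> \<Union>S"
        using union[of i] fermionic_length(1)[OF K] by auto
    next
      fix B assume "B \<in> set (drop m K)"
      then obtain k where "m \<le> k" "k < length K" "B = K ! k" using dropE by blast
      then show "\<exists>S\<subseteq>set (drop m J). B = \<Union>S" using union[of k] by (simp add: not_less)
    qed
  }
qed

text \<open>The meet is the intersection of the two equivalence relations, that is, the kernel of
  the pair of index functions. It still separates the fermionic positions, so
  \<open>of_kernel\<close> applies.\<close>

lemma meet:
  assumes K: "K \<in> sC n m" and L: "L \<in> sC n m"
  shows "meet n m K L \<in> sC n m"
    and "finer (m + n) (idx m (meet n m K L)) (\<lambda>x. (idx m K x, idx m L x))"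
    and "finer (m + n) (\<lambda>x. (idx m K x, idx m L x)) (idx m (meet n m K L))"
proof -
  let ?c = "\<lambda>x. (idx m K x, idx m L x)"
  define J where "J = of_kernel n m ?c"
  have "inj_on ?c {..<m}" by (auto simp: inj_on_def)
  note J = of_kernel[OF this fermionic_length(2)[OF K], folded J_def]
  have "is_meet n m K L J"
    unfolding is_meet_def refines_iff_finer[OF J(1) K] refines_iff_finer[OF J(1) L]
  proof (intro conjI ballI impI)
    show "finer (m + n) (idx m J) (idx m K)" "finer (m + n) (idx m J) (idx m L)"
      using J(3) unfolding finer_def by blast+
    fix J' assume J': "J' \<in> sC n m" "refines m J' K \<and> refines m J' L"
    then have "finer (m + n) (idx m J') ?c"
      unfolding refines_iff_finer[OF J'(1) K] refines_iff_finer[OF J'(1) L] finer_def by blast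
    then show "refines m J' J"
      unfolding refines_iff_finer[OF J'(1) J(1)] using J(2) finer_trans by blast
  qed (rule J(1))
  moreover have "J' = J" if J': "is_meet n m K L J'" for J'
    using J' \<open>is_meet n m K L J\<close> unfolding is_meet_def
    by (metis sC_eqI refines_iff_finer)
  ultimately have "meet n m K L = J" unfolding meet_def by (rule the_equality)
  then show "meet n m K L \<in> sC n m"
    "finer (m + n) (idx m (meet n m K L)) ?c" "finer (m + n) ?c (idx m (meet n m K L))"
    using J by simp_all
qed

definition entry :: "word \<Rightarrow> nat \<Rightarrow> nat" where
  "entry u x = (fst u @ snd u) ! x"

lemma entry_fst: "i < length a \<Longrightarrow> entry (a, b) i = a ! i"
  by (simp add: entry_def nth_append)

lemma entry_snd: "length a = m \<Longrightarrow> 1 \<le> j \<Longrightarrow> entry (a, b) (m + j - 1) = b ! (j - 1)"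
  by (cases j) (simp_all add: entry_def nth_append)

text \<open>The conditions in \<open>M\<close> never compare two fermionic letters;
  \<open>distinct a\<close> supplies this case, since \<open>idx\<close> also separates the
  positions below \<open>m\<close>.\<close>

lemma in_M_iff:
  assumes L: "L \<in> sC n m" and ab: "length a = m" "length b = n" "distinct a"
  shows "(a, b) \<in> M L \<longleftrightarrow>
    finer (m + n) (idx m L) (entry (a, b)) \<and> finer (m + n) (entry (a, b)) (idx m L)"
proof -
  let ?e = "entry (a, b)" and ?i = "idx m L"
  have p2: "(\<exists>B\<in>set L. i \<in> B \<and> j \<in> B) \<longleftrightarrow> ?i (m + i - 1) = ?i (m + j - 1)"
    if "i \<in> {1..n}" "j \<in> {1..n}" for i j
  proof -
    have ij: "?i (m + i - 1) = k \<longleftrightarrow> k < length L \<and> i \<in> L ! k"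
      "?i (m + j - 1) = k \<longleftrightarrow> k < length L \<and> j \<in> L ! k" for k
      using that idx_pos_iff[OF L, of i k] idx_pos_iff[OF L, of j k] by auto
    show ?thesis unfolding ij by (metis ij in_set_conv_nth)
  qed
  have p1: "j \<in> pos (L ! i) \<longleftrightarrow> ?i (m + j - 1) = i" if "i < m" "j \<in> {1..n}" for i j
    using that idx_pos_iff[OF L, of j i] fermionic_length(1)[OF L] by (auto simp: pos_def)
  have M: "(a, b) \<in> M L \<longleftrightarrow>
      (\<forall>i<m. \<forall>j\<in>{1..n}. ?e i = ?e (m + j - 1) \<longleftrightarrow> ?i (m + j - 1) = i) \<and>
      (\<forall>i\<in>{1..n}. \<forall>j\<in>{1..n}. ?e (m + i - 1) = ?e (m + j - 1) \<longleftrightarrow> ?i (m + i - 1) = ?i (m + j - 1))"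
    unfolding M_def sC_bidegree[OF L] words_def mem_Collect_eq prod.case
    by (simp add: ab p1 p2 entry_fst entry_snd[OF ab(1)] del: One_nat_def cong: conj_cong)
  have e_inj: "?e x = ?e y \<longleftrightarrow> x = y" if "x < m" "y < m" for x y
    using that ab by (auto simp: entry_fst nth_eq_iff_index_eq)
  show ?thesis
  proof
    assume "(a, b) \<in> M L"
    note M' = this[unfolded M]
    have pos: "\<exists>j\<in>{1..n}. y = m + j - 1" if "m \<le> y" "y < m + n" for y
      using that by (intro bexI[of _ "y - m + 1"]) auto
    have 1: "?e x = ?e y \<longleftrightarrow> ?i y = x" if "x < m" "m \<le> y" "y < m + n" for x y
      using M' pos[OF that(2,3)] that(1) by blast
    have 2: "?e x = ?e y \<longleftrightarrow> ?i x = ?i y" if "m \<le> x" "m \<le> y" "x < m + n" "y < m + n" for x y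
      using M' pos[OF that(1,3)] pos[OF that(2,4)] by blast
    have "?e x = ?e y \<longleftrightarrow> ?i x = ?i y" if xy: "x < m + n" "y < m + n" for x y
    proof (cases "x < m"; cases "y < m")
      assume "x < m" "\<not> y < m"
      then show ?thesis using 1[of x y] xy by auto
    next
      assume "\<not> x < m" "y < m"
      then show ?thesis using 1[of y x] xy by auto
    qed (use 2[of x y] e_inj[of x y] xy in auto)
    then show "finer (m + n) ?i ?e \<and> finer (m + n) ?e ?i" unfolding finer_def by blast
  next
    assume "finer (m + n) ?i ?e \<and> finer (m + n) ?e ?i"
    then have *: "?e x = ?e y \<longleftrightarrow> ?i x = ?i y" if "x < m + n" "y < m + n" for x y
      using that unfolding finer_def by blast
    show "(a, b) \<in> M L" unfolding M
      by (intro conjI allI impI ballI; subst *) auto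
  qed
qed

lemma type_of_word:
  assumes ab: "length a = m" "length b = n" "distinct a" and card: "card (set a - set b) \<le> 1"
  shows "type_of_word n m (a, b) \<in> sC n m"
    and "finer (m + n) (idx m (type_of_word n m (a, b))) (entry (a, b))"
    and "finer (m + n) (entry (a, b)) (idx m (type_of_word n m (a, b)))"
proof -
  let ?e = "entry (a, b)"
  \<comment> \<open>At most one fermionic letter lies outside \<open>b\<close> and at most
    \<open>n\<close> lie inside, which yields the bound \<open>m \<le> n + 1\<close> built into
    \<open>sC\<close>.\<close>
  have "card (set a) \<le> card (set a - set b) + card (set a \<inter> set b)"
    by (metis Diff_Int2 Int_Diff_Un Un_Diff_Int add.commute card_Un_le inf_commute le_refl)
  also have "card (set a \<inter> set b) \<le> length b"
    by (meson List.finite_set card_length card_mono inf_le2 le_trans)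
  finally have m: "m \<le> n + 1" using card ab distinct_card by fastforce
  have "inj_on ?e {..<m}" using ab by (auto simp: inj_on_def entry_fst nth_eq_iff_index_eq)
  note J = of_kernel[OF this m]
  have "type_of_word n m (a, b) = of_kernel n m ?e"
    unfolding type_of_word_def
  proof (rule the_equality)
    show "of_kernel n m ?e \<in> sC n m \<and> (a, b) \<in> M (of_kernel n m ?e)"
      using J in_M_iff[OF _ ab] by blast
    fix L assume "L \<in> sC n m \<and> (a, b) \<in> M L"
    then show "L = of_kernel n m ?e"
      using J in_M_iff[OF _ ab] finer_trans by (intro sC_eqI[of _ n m]) blast+
  qed
  then show "type_of_word n m (a, b) \<in> sC n m"
    "finer (m + n) (idx m (type_of_word n m (a, b))) ?e"
    "finer (m + n) ?e (idx m (type_of_word n m (a, b)))"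
    using J by simp_all
qed

section \<open>Superpartitions up to reordering\<close>

text \<open>Two fermionic blocks meet exactly in 0, so their differences are their positive parts.
  Pairs whose second block is nonfermionic satisfy the inequality automatically.\<close>

lemma superpartitions_iff:
  assumes I: "I \<in> sC n m"
  shows "I \<in> superpartitions \<longleftrightarrow>
    (\<forall>i j. i < j \<and> j < m \<longrightarrow> min0 (pos (I ! i)) < min0 (pos (I ! j)))"
proof -
  have fin: "finite (I ! i)" if "i < length I" for i
    using I that finite_subset[of "I ! i" "{0..n}"] by (simp add: sC_def)
  have disj: "I ! i \<inter> I ! j \<subseteq> {0}" if "i < length I" "j < length I" "i \<noteq> j" for i j
    using I that by (simp add: sC_def)
  have ne: "I ! i \<noteq> {}" if "i < length I" for i using I that by (simp add: sC_def)
  have Min_less: "Min (I ! i) < Min (I ! j)" if "m \<le> i" "i < j" "j < length I" for i j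
    using I that by (simp add: sC_def)
  note z = zero_in_block_iff[OF I]
  have ferm: "I ! i - I ! j = pos (I ! i) \<and> I ! j - I ! i = pos (I ! j)"
    if "i < j" "j < m" for i j
  proof -
    have "i < length I" "j < length I" using that fermionic_length(1)[OF I] by auto
    then show ?thesis using disj[of i j] z[of i] z[of j] that unfolding pos_def by fastforce
  qed
  have rest: "min0 (I ! i - I ! j) < min0 (I ! j - I ! i)"
    if ij: "i < j" "m \<le> j" "j < length I" for i j
  proof -
    have zj: "0 \<notin> I ! j" using z[of j] ij by simp
    then have d: "I ! i - I ! j = I ! i" "I ! j - I ! i = I ! j"
      using disj[of i j] ij by auto
    have *: "min0 (I ! i) = Min (I ! i)" "min0 (I ! j) = Min (I ! j)"
      using ne[of i] ne[of j] ij by (simp_all add: min0_def)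
    \<comment> \<open>A fermionic block has minimum 0 and precedes every nonfermionic one, whose
      minimum is positive.\<close>
    have "Min (I ! j) \<noteq> 0" using zj Min_in[OF fin[of j] ne[of j]] ij by metis
    moreover have "Min (I ! i) = 0" if "i < m"
      using Min_le[OF fin[of i], of 0] z[of i] that ij by simp
    ultimately show ?thesis
      unfolding d * using Min_less[of i j] ij by (cases "i < m") auto
  qed
  have "I \<in> superpartitions \<longleftrightarrow> (\<forall>i j. i < j \<and> j < length I \<longrightarrow>
      min0 (I ! i - I ! j) < min0 (I ! j - I ! i))"
  proof -
    \<comment> \<open>Distinctness of the blocks comes with the strict inequality: for equal blocks
      both differences would be empty.\<close>
    have "\<exists>n m. I \<in> sC n m" using I by blast
    then show ?thesis
      unfolding superpartitions_def mem_Collect_eq by (metis Diff_cancel less_irrefl)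
  qed
  also have "\<dots> \<longleftrightarrow> (\<forall>i j. i < j \<and> j < m \<longrightarrow>
      min0 (I ! i - I ! j) < min0 (I ! j - I ! i))"
    using rest fermionic_length(1)[OF I] by (meson le_trans not_le)
  also have "\<dots> \<longleftrightarrow> (\<forall>i j. i < j \<and> j < m \<longrightarrow> min0 (pos (I ! i)) < min0 (pos (I ! j)))"
    using ferm by auto
  finally show ?thesis .
qed

lemma superpartition_bidegree:
  "I \<in> superpartitions \<Longrightarrow> I \<in> sC (deg I) (fdeg I)"
  by (auto simp: superpartitions_def sC_bidegree)

lemma min0_eq_0_iff: "finite A \<Longrightarrow> 0 \<notin> A \<Longrightarrow> min0 A = 0 \<longleftrightarrow> A = {}"
  by (metis Min_in min0_def)

text \<open>The fermionic positions are sorted by \<open>\<mu>\<close>, the least positive element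
  of their class, or 0 if there is none. Nonempty positive parts of different classes are disjoint,
  and \<open>single\<close> allows only one empty part, so \<open>\<mu>\<close> has no ties.\<close>

lemma superpartition_exists:
  fixes c :: "nat \<Rightarrow> 'a"
  assumes inj: "inj_on c {..<m}"
    and single: "\<And>x y. x < m \<Longrightarrow> y < m \<Longrightarrow>
      (\<And>z. z < m + n \<Longrightarrow> c z = c x \<Longrightarrow> z = x) \<Longrightarrow>
      (\<And>z. z < m + n \<Longrightarrow> c z = c y \<Longrightarrow> z = y) \<Longrightarrow> x = y"
  shows "\<exists>\<tau> J. \<tau> permutes {..<m} \<and> J \<in> superpartitions \<and> J \<in> sC n m \<and>
    finer (m + n) (c \<circ> \<tau>) (idx m J) \<and> finer (m + n) (idx m J) (c \<circ> \<tau>)"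
proof -
  define P where "P x = {j \<in> {1..n}. c (m + j - 1) = c x}" for x
  define \<mu> where "\<mu> x = min0 (P x)" for x
  have Pfin: "finite (P x)" "0 \<notin> P x" for x by (auto simp: P_def)
  have mu_in: "\<mu> x \<in> P x" if "\<mu> x \<noteq> 0" for x
    using that Min_in[OF Pfin(1)] by (auto simp: \<mu>_def min0_def split: if_splits)
  have mu_inj: "inj_on \<mu> {..<m}"
  proof (rule inj_onI)
    fix x y assume xy: "x \<in> {..<m}" "y \<in> {..<m}" "\<mu> x = \<mu> y"
    show "x = y"
    proof (cases "\<mu> x = 0")
      case True
      have alone: "z = x" if "x < m" "\<mu> x = 0" "z < m + n" "c z = c x" for x z
      proof (cases "z < m")
        case True
        then show ?thesis using inj_onD[OF inj that(4)] that(1) by simp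
      next
        case False
        have "P x = {}" using that(2) Pfin min0_eq_0_iff by (auto simp: \<mu>_def)
        moreover have "z - m + 1 \<in> P x" using False that(3,4) by (auto simp: P_def)
        ultimately show ?thesis by simp
      qed
      with xy True have "x < m" "y < m" "\<mu> x = 0" "\<mu> y = 0" by auto
      then show ?thesis using single[of x y] alone by blast
    next
      case False
      then have "\<mu> x \<in> P x" "\<mu> x \<in> P y" using mu_in[of x] mu_in[of y] xy(3) by auto
      then have "c x = c y" by (auto simp: P_def)
      then show ?thesis using inj_onD[OF inj] xy by blast
    qed
  qed
  have "\<mu> ` {..<m} \<subseteq> {0..n}"
  proof
    fix k assume "k \<in> \<mu> ` {..<m}"
    then obtain x where "k = \<mu> x" by blast
    then show "k \<in> {0..n}" using mu_in[of x] by (cases "k = 0") (auto simp: P_def)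
  qed
  \<comment> \<open>The bound on \<open>m\<close> is not assumed: it follows by counting the values
    of the injective \<open>\<mu>\<close>.\<close>
  then have "card {..<m} \<le> card {0..n}" using mu_inj by (metis card_inj_on_le finite_atLeastAtMost)
  then have m: "m \<le> n + 1" by simp
  define xs where "xs = sort_key \<mu> [0..<m]"
  have xs: "set xs = {..<m}" "distinct xs" "length xs = m" "sorted (map \<mu> xs)"
    by (auto simp: xs_def)
  have strict: "\<mu> (xs ! i) < \<mu> (xs ! j)" if "i < j" "j < m" for i j
  proof -
    have "\<mu> (xs ! i) \<le> \<mu> (xs ! j)"
      using sorted_nth_mono[OF xs(4), of i j] that xs(3) by simp
    moreover have "\<mu> (xs ! i) \<noteq> \<mu> (xs ! j)"
    proof
      assume "\<mu> (xs ! i) = \<mu> (xs ! j)"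
      then have "xs ! i = xs ! j"
        using inj_onD[OF mu_inj] nth_mem[of i xs] nth_mem[of j xs] that xs by simp
      then show False using that xs nth_eq_iff_index_eq by fastforce
    qed
    ultimately show ?thesis by simp
  qed
  define \<tau> where "\<tau> i = (if i < m then xs ! i else i)" for i
  have \<tau>: "\<tau> permutes {..<m}"
  proof (rule bij_imp_permutes)
    have "bij_betw ((!) xs) {..<m} {..<m}" by (rule bij_betw_nth) (simp_all add: xs(1-3))
    then show "bij_betw \<tau> {..<m} {..<m}"
      by (subst bij_betw_cong[where g = "(!) xs"]) (auto simp: \<tau>_def)
  qed (simp add: \<tau>_def)
  have \<tau>m: "\<tau> i < m" if "i < m" for i using permutes_in_image[OF \<tau>, of i] that by simp
  have "inj_on (c \<circ> \<tau>) {..<m}"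
    by (rule comp_inj_on) (use permutes_inj_on[OF \<tau>] inj permutes_image[OF \<tau>] in auto)
  note J = of_kernel[OF this m]
  define J where "J = of_kernel n m (c \<circ> \<tau>)"
  note J = J[folded J_def]
  have posJ: "pos (J ! i) = P (xs ! i)" if "i < m" for i
  proof -
    have i: "i < length J" using that fermionic_length(1)[OF J(1)] by simp
    have "idx m J (m + j - 1) = i \<longleftrightarrow> c (m + j - 1) = c (xs ! i)" if j: "j \<in> {1..n}" for j
    proof -
      have N: "m + j - 1 < m + n" "i < m + n" "\<not> m + j - 1 < m" using j \<open>i < m\<close> by auto
      have "idx m J (m + j - 1) = idx m J i \<longleftrightarrow> (c \<circ> \<tau>) (m + j - 1) = (c \<circ> \<tau>) i"
        using finerD[OF J(2) N(1,2)] finerD[OF J(3) N(1,2)] by blast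
      then show ?thesis using N(3) \<open>i < m\<close> by (simp add: \<tau>_def)
    qed
    then show ?thesis unfolding pos_block_eq[OF J(1) i] P_def by blast
  qed
  have "J \<in> superpartitions"
    unfolding superpartitions_iff[OF J(1)] using strict posJ by (simp add: \<mu>_def)
  then show ?thesis using \<tau> J by blast
qed

text \<open>The bound on the lengths upgrades \<open>finer\<close> to equality of kernels. Then
  \<open>\<tau>\<close> carries one strictly increasing sequence of fermionic minima to another, so
  it is increasing, and an increasing permutation is the identity.\<close>

lemma superpartition_unique:
  assumes I: "I \<in> superpartitions" "I \<in> sC n m" and J: "J \<in> superpartitions" "J \<in> sC n m"
    and \<tau>: "\<tau> permutes {..<m}" and fin: "finer (m + n) (idx m J) (idx m I \<circ> \<tau>)"
    and len: "length J \<le> length I"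
  shows "I = J \<and> \<tau> = id"
proof -
  let ?N = "m + n"
  have \<tau>N: "\<tau> permutes {..<?N}" by (rule permutes_subset[OF \<tau>]) auto
  have \<tau>m: "\<tau> i < m" if "i < m" for i using permutes_in_image[OF \<tau>, of i] that by simp
  have \<tau>ge: "\<tau> i = i" if "\<not> i < m" for i using permutes_not_in[OF \<tau>] that by simp
  have "(idx m I \<circ> \<tau>) ` {..<?N} = idx m I ` {..<?N}"
    using permutes_image[OF \<tau>N] by (metis image_comp)
  then have rev: "finer ?N (idx m I \<circ> \<tau>) (idx m J)"
    using finer_card(2)[OF fin] len length_eq_card[OF I(2)] length_eq_card[OF J(2)] by simp
  have posJ: "pos (J ! i) = pos (I ! \<tau> i)" if i: "i < m" for i
  proof -
    have iJ: "i < length J" and iI: "\<tau> i < length I"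
      using i \<tau>m[OF i] fermionic_length(1)[OF J(2)] fermionic_length(1)[OF I(2)] by auto
    have "idx m J (m + j - 1) = i \<longleftrightarrow> idx m I (m + j - 1) = \<tau> i" if j: "j \<in> {1..n}" for j
    proof -
      have N: "m + j - 1 < ?N" "i < ?N" "\<not> m + j - 1 < m" using j i by auto
      have "idx m J (m + j - 1) = idx m J i \<longleftrightarrow> (idx m I \<circ> \<tau>) (m + j - 1) = (idx m I \<circ> \<tau>) i"
        using finerD[OF fin N(1,2)] finerD[OF rev N(1,2)] by blast
      then show ?thesis using i \<tau>m[OF i] \<tau>ge[OF N(3)] by simp
    qed
    then show ?thesis unfolding pos_block_eq[OF J(2) iJ] pos_block_eq[OF I(2) iI] by blast
  qed
  have mono: "\<tau> i < \<tau> j" if "i < j" "j < m" for i j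
  proof (rule ccontr)
    assume "\<not> \<tau> i < \<tau> j"
    then have "min0 (pos (I ! \<tau> j)) \<le> min0 (pos (I ! \<tau> i))"
      using I(1)[unfolded superpartitions_iff[OF I(2)]] \<tau>m[of i] that
      by (cases "\<tau> i = \<tau> j") (auto simp: not_less intro: less_imp_le)
    moreover have "min0 (pos (J ! i)) < min0 (pos (J ! j))"
      using J(1)[unfolded superpartitions_iff[OF J(2)]] that by blast
    ultimately show False using posJ that by simp
  qed
  have "map \<tau> [0..<m] = [0..<m]"
  proof (rule strict_sorted_equal)
    show "sorted_wrt (<) (map \<tau> [0..<m])"
      using mono by (auto simp: sorted_wrt_iff_nth_less)
    show "set (map \<tau> [0..<m]) = set [0..<m]"
      using permutes_image[OF \<tau>] by (simp add: atLeast0LessThan)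
  qed simp
  then have "\<tau> i = i" if "i < m" for i
    using that by (metis add_0 diff_zero length_upt nth_map nth_upt)
  then have "\<tau> = id" using \<tau>ge by (intro ext) (metis id_apply)
  moreover from this have "I = J"
    using sC_eqI[OF I(2) J(2)] fin rev by simp
  ultimately show ?thesis by blast
qed

lemma finite_sC: "finite (sC n m)"
proof (rule finite_subset)
  show "sC n m \<subseteq> {K. set K \<subseteq> Pow {0..n} \<and> length K \<le> m + n}"
  proof
    fix K assume K: "K \<in> sC n m"
    then have "set K \<subseteq> Pow {0..n}" by (auto simp: sC_def)
    then show "K \<in> {K. set K \<subseteq> Pow {0..n} \<and> length K \<le> m + n}" using length_le[OF K] by simp
  qed
qed (rule finite_lists_length_le, simp)

section \<open>Kernel sums\<close>

lemma word_sum_zero: "word_sum n m (\<lambda>_. 0) = 0"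
  using word_sum_linear[of n m "\<lambda>_. 0" "\<lambda>_ _. 0" "{}"] by simp

text \<open>Permuting entries is a bijection of the arrangements with letters in \<open>S\<close>.
  The factor \<open>s\<close> is a hypothesis, so that one argument serves both an unknown scalar
  and the value -1 of a transposition.\<close>

lemma word_sum_permute:
  assumes \<tau>: "\<tau> permutes {..<m}"
    and s: "\<And>a b. length a = m \<Longrightarrow>
      word_val (map (\<lambda>i. a ! \<tau> i) [0..<m], b) = scaleQ s (word_val (a, b))"
  shows "word_sum n m C = scaleQ s (word_sum n m (\<lambda>(a, b). C (map (\<lambda>i. a ! \<tau> i) [0..<m], b)))"
proof (rule superseries_eqI)
  fix S :: "nat set" and w assume S: "finite S"
  let ?h = "\<lambda>\<tau> a. map (\<lambda>i. a ! \<tau> i) [0..<m]" and ?L = "{a. set a \<subseteq> S \<and> length a = m}"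
  have h: "?h \<tau> a \<in> ?L" if "\<tau> permutes {..<m}" "a \<in> ?L" for \<tau> :: "nat \<Rightarrow> nat" and a
  proof -
    have "a ! \<tau> i \<in> set a" if "i < m" for i
      using permutes_in_image[OF \<open>\<tau> permutes {..<m}\<close>, of i] that \<open>a \<in> ?L\<close> by auto
    then show ?thesis using that(2) by auto
  qed
  have hh: "?h (inv \<sigma>) (?h \<sigma> a) = a" if "\<sigma> permutes {..<m}" "a \<in> ?L" for \<sigma> a
  proof (rule nth_equalityI)
    fix i assume "i < length (?h (inv \<sigma>) (?h \<sigma> a))"
    then have i: "i < m" by simp
    then have "inv \<sigma> i < m" using permutes_in_image[OF permutes_inv[OF that(1)], of i] by simp
    then show "?h (inv \<sigma>) (?h \<sigma> a) ! i = a ! i"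
      using i permutes_inverses(1)[OF that(1)] by simp
  qed (use that in simp)
  have "(\<Sum>a\<in>?L. C (a, w) * coeff (word_val (a, w)) S w) =
      (\<Sum>a\<in>?L. C (?h \<tau> a, w) * coeff (word_val (?h \<tau> a, w)) S w)"
  proof (rule sum.reindex_bij_witness[where i = "?h \<tau>" and j = "?h (inv \<tau>)"])
    fix a assume a: "a \<in> ?L"
    show "?h \<tau> (?h (inv \<tau>) a) = a"
      using hh[OF permutes_inv[OF \<tau>] a] permutes_inv_inv[OF \<tau>] by simp
    show "?h (inv \<tau>) a \<in> ?L" by (rule h[OF permutes_inv[OF \<tau>] a])
    show "?h (inv \<tau>) (?h \<tau> a) = a" by (rule hh[OF \<tau> a])
    show "?h \<tau> a \<in> ?L" by (rule h[OF \<tau> a])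
    show "C (?h \<tau> (?h (inv \<tau>) a), w) * coeff (word_val (?h \<tau> (?h (inv \<tau>) a), w)) S w =
        C (a, w) * coeff (word_val (a, w)) S w"
      using \<open>?h \<tau> (?h (inv \<tau>) a) = a\<close> by simp
  qed
  also have "\<dots> = (\<Sum>a\<in>?L. s * (C (?h \<tau> a, w) * coeff (word_val (a, w)) S w))"
    by (rule sum.cong) (auto simp: s)
  finally show "coeff (word_sum n m C) S w =
      coeff (scaleQ s (word_sum n m (\<lambda>(a, b). C (?h \<tau> a, b)))) S w"
    using S by (simp add: coeff_word_sum sum_distrib_left)
qed

text \<open>The power sum of an arbitrary partition of the positions, including those that merge
  fermionic positions or correspond to unsorted tuples; the orbits of a permutation give such
  partitions.\<close>

definition kernel_sum :: "nat \<Rightarrow> nat \<Rightarrow> (nat \<Rightarrow> 'a) \<Rightarrow> superseries" where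
  "kernel_sum n m c = word_sum n m (\<lambda>u. of_bool (finer (m + n) c (entry u)))"

lemma kernel_sum_cong:
  "finer (m + n) c d \<Longrightarrow> finer (m + n) d c \<Longrightarrow> kernel_sum n m c = kernel_sum n m d"
  unfolding kernel_sum_def
  by (rule word_sum_cong, rule arg_cong[where f = of_bool]) (blast intro: finer_trans)

lemma finer_permute:
  assumes "\<tau> permutes {..<N}"
  shows "finer N (c \<circ> \<tau>) (d \<circ> \<tau>) \<longleftrightarrow> finer N c d"
proof -
  have *: "finer N (c \<circ> \<tau>) (d \<circ> \<tau>)" if "finer N c d" "\<tau> permutes {..<N}"
    for c :: "nat \<Rightarrow> 'a" and d :: "nat \<Rightarrow> 'b" and \<tau>
    using finerD[OF that(1)] permutes_in_image[OF that(2)] unfolding finer_def by auto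
  have "f \<circ> \<tau> \<circ> inv \<tau> = f" for f :: "nat \<Rightarrow> 'c"
    by (simp add: comp_assoc permutes_inv_o(1)[OF assms])
  then show ?thesis using *[of c d \<tau>] *[of "c \<circ> \<tau>" "d \<circ> \<tau>" "inv \<tau>"] assms permutes_inv[OF assms]
    by (metis comp_assoc comp_id permutes_inv_o(1))
qed

section \<open>Permuting and cancelling fermionic positions\<close>

lemma entry_permute:
  assumes "\<tau> permutes {..<m}" "length a = m" "x < m + n"
  shows "entry (map (\<lambda>i. a ! \<tau> i) [0..<m], b) x = entry (a, b) (\<tau> x)"
  using permutes_in_image[OF assms(1), of x] permutes_not_in[OF assms(1), of x] assms(2,3)
  by (cases "x < m") (auto simp: entry_def nth_append)

lemma finer_cong_right:
  "(\<And>x. x < N \<Longrightarrow> d x = e x) \<Longrightarrow> finer N c d \<longleftrightarrow> finer N c e"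
  unfolding finer_def by auto

lemma kernel_sum_permute_sign:
  assumes \<tau>: "\<tau> permutes {..<m}"
    and s: "\<And>a b. length a = m \<Longrightarrow>
      word_val (map (\<lambda>i. a ! inv \<tau> i) [0..<m], b) = scaleQ s (word_val (a, b))"
  shows "kernel_sum n m c = scaleQ s (kernel_sum n m (c \<circ> \<tau>))"
proof -
  have \<tau>N: "\<tau> permutes {..<m + n}" by (rule permutes_subset[OF \<tau>]) auto
  have "finer (m + n) c (entry (map (\<lambda>i. a ! inv \<tau> i) [0..<m], b)) \<longleftrightarrow>
      finer (m + n) (c \<circ> \<tau>) (entry (a, b))" if "length a = m" for a b
  proof -
    have "finer (m + n) c (entry (map (\<lambda>i. a ! inv \<tau> i) [0..<m], b)) \<longleftrightarrow>
        finer (m + n) c (entry (a, b) \<circ> inv \<tau>)"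
      by (rule finer_cong_right) (simp add: entry_permute[OF permutes_inv[OF \<tau>] that])
    also have "\<dots> \<longleftrightarrow> finer (m + n) (c \<circ> \<tau>) (entry (a, b) \<circ> inv \<tau> \<circ> \<tau>)"
      by (rule finer_permute[OF \<tau>N, symmetric])
    finally show ?thesis by (simp add: comp_assoc permutes_inv_o(2)[OF \<tau>])
  qed
  then have "word_sum n m (\<lambda>(a, b). of_bool (finer (m + n) c (entry (map (\<lambda>i. a ! inv \<tau> i) [0..<m], b)))) =
      kernel_sum n m (c \<circ> \<tau>)"
    unfolding kernel_sum_def by (intro word_sum_cong) simp
  then show ?thesis
    unfolding kernel_sum_def[of _ _ c] by (subst word_sum_permute[OF permutes_inv[OF \<tau>] s]) simp_all
qed

lemma kernel_sum_permute:
  assumes "\<tau> permutes {..<m}"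
  shows "\<exists>s. kernel_sum n m c = scaleQ s (kernel_sum n m (c \<circ> \<tau>))"
proof -
  have "mset (map (inv \<tau>) [0..<m]) = mset [0..<m]"
    using permutes_inv[OF assms] permutes_image permutes_inj_on
    by (intro set_eq_iff_mset_eq_distinct[THEN iffD1]) (auto simp: distinct_map atLeast0LessThan)
  \<comment> \<open>The list of positions itself is rearranged; substituting \<open>(!) a\<close>
    for \<open>\<pi>\<close> then gives the same scalar for all words.\<close>
  then obtain s where
    s: "\<And>\<pi> b. word_val (map \<pi> (map (inv \<tau>) [0..<m]), b) = scaleQ s (word_val (map \<pi> [0..<m], b))"
    using word_val_rearrange by blast
  have "word_val (map (\<lambda>i. a ! inv \<tau> i) [0..<m], b) = scaleQ s (word_val (a, b))"
    if "length a = m" for a b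
    using s[of "(!) a" b] that map_nth[of a] by (simp add: comp_def)
  then show ?thesis using kernel_sum_permute_sign[OF assms] by blast
qed

lemma kernel_sum_two_singletons:
  assumes xy: "x < m" "y < m" "x \<noteq> y"
    and x: "\<And>z. z < m + n \<Longrightarrow> c z = c x \<Longrightarrow> z = x" and y: "\<And>z. z < m + n \<Longrightarrow> c z = c y \<Longrightarrow> z = y"
  shows "kernel_sum n m c = 0"
proof -
  let ?t = "transpose x y"
  have t: "?t permutes {..<m}" by (rule permutes_swap_id) (use xy in auto)
  have inv: "inv ?t = ?t" by simp
  have "word_val (map (\<lambda>i. a ! inv ?t i) [0..<m], b) = scaleQ (- 1) (word_val (a, b))"
    if "length a = m" for a b
  proof -
    have "word_val (map ((!) a \<circ> ?t) [0..<m], b) = - word_val (map ((!) a) [0..<m], b)"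
      by (rule word_val_swap) (use xy in auto)
    then show ?thesis using that map_nth[of a] unfolding inv
      by (auto simp: comp_def intro!: superseries_eqI)
  qed
  from kernel_sum_permute_sign[OF t this]
  have "kernel_sum n m c = scaleQ (- 1) (kernel_sum n m (c \<circ> ?t))" .
  moreover have "kernel_sum n m (c \<circ> ?t) = kernel_sum n m c"
  proof (rule kernel_sum_cong)
    have *: "c (?t p) = c (?t q) \<longleftrightarrow> c p = c q" if "p < m + n" "q < m + n" for p q
      using x[of p] x[of q] y[of p] y[of q] x[of y] that xy
      by (auto simp: transpose_def)
    show "finer (m + n) (c \<circ> ?t) c" "finer (m + n) c (c \<circ> ?t)"
      unfolding finer_def using * by simp_all
  qed
  ultimately have "kernel_sum n m c = - kernel_sum n m c"
    by (metis add.inverse_inverse superseries.scale_minus_left superseries.scale_one)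
  then have "coeff (kernel_sum n m c) S w = - coeff (kernel_sum n m c) S w" for S w
    by (metis coeff_uminus)
  then show ?thesis by (intro superseries_eqI) simp
qed

text \<open>Every word in the sum repeats a fermionic letter and so has value zero.\<close>

lemma kernel_sum_not_inj:
  assumes "\<not> inj_on c {..<m}"
  shows "kernel_sum n m c = 0"
proof -
  obtain x y where xy: "x < m" "y < m" "x \<noteq> y" "c x = c y"
    using assms by (auto simp: inj_on_def)
  have "\<not> finer (m + n) c (entry (a, b))" if "length a = m" "distinct a" for a b
    using xy that finerD[of "m + n" c "entry (a, b)" x y]
    by (auto simp: entry_fst nth_eq_iff_index_eq)
  then show ?thesis
    unfolding kernel_sum_def by (subst word_sum_cong[where D = "\<lambda>_. 0"]) (auto simp: word_sum_zero)
qed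

lemma kernel_sum_in_sNCSym: "kernel_sum n m c \<in> sNCSym"
  unfolding kernel_sum_def
proof (rule word_sum_in_sNCSym)
  fix \<pi> :: "nat \<Rightarrow> nat" and a b :: "nat list"
  assume pi: "bij \<pi>" and ab: "length a = m" "length b = n"
  have e: "entry (map \<pi> a, map \<pi> b) x = \<pi> (entry (a, b) x)" if "x < m + n" for x
    using that ab by (simp add: entry_def nth_append)
  have "finer (m + n) c (entry (map \<pi> a, map \<pi> b)) \<longleftrightarrow> finer (m + n) c (entry (a, b))"
    using bij_is_inj[OF pi] unfolding finer_def by (simp add: e inj_eq)
  then show "of_bool (finer (m + n) c (entry (map \<pi> a, map \<pi> b))) =
    (of_bool (finer (m + n) c (entry (a, b))) :: rat)" by simp
qed

text \<open>Passes from conditions on elements of blocks to conditions on positions.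
  \<open>P\<close> is equality of letters for power sums, and equality of positions or difference of
  letters for elementary functions. Reflexivity covers two fermionic positions, symmetry a fermionic
  position in second place.\<close>

lemma ball_blocks_iff:
  assumes K: "K \<in> sC n m" and refl: "\<And>x. P x x" and sym: "\<And>x y. P x y \<Longrightarrow> P y x"
  shows "(\<forall>i<m. \<forall>j\<in>pos (K ! i). P i (m + j - 1)) \<and>
      (\<forall>B\<in>set K. \<forall>i\<in>pos B. \<forall>j\<in>pos B. P (m + i - 1) (m + j - 1)) \<longleftrightarrow>
    (\<forall>x<m + n. \<forall>y<m + n. idx m K x = idx m K y \<longrightarrow> P x y)" (is "?L1 \<and> ?L2 \<longleftrightarrow> ?R")
proof
  assume R: "?R"
  show "?L1 \<and> ?L2"
  proof (intro conjI allI ballI impI)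
    fix i j assume ij: "i < m" "j \<in> pos (K ! i)"
    have "i < length K" using ij(1) fermionic_length(1)[OF K] by simp
    then have "j \<in> {1..n}" "idx m K (m + j - 1) = i" using ij(2) pos_block_eq[OF K] by auto
    moreover have "m + j - 1 < m + n" using calculation(1) by auto
    ultimately show "P i (m + j - 1)" using R ij(1) by simp
  next
    fix B i j assume B: "B \<in> set K" "i \<in> pos B" "j \<in> pos B"
    then obtain k where k: "k < length K" "B = K ! k" by (auto simp: in_set_conv_nth)
    then have "i \<in> {1..n}" "j \<in> {1..n}" "idx m K (m + i - 1) = k" "idx m K (m + j - 1) = k"
      using B(2,3) pos_block_eq[OF K] by auto
    moreover have "m + i - 1 < m + n" "m + j - 1 < m + n" using calculation(1,2) by auto
    ultimately show "P (m + i - 1) (m + j - 1)" using R by simp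
  qed
next
  assume L: "?L1 \<and> ?L2"
  have posI: "x - m + 1 \<in> pos (K ! idx m K x) \<and> m + (x - m + 1) - 1 = x" if "\<not> x < m" "x < m + n" for x
    using idx_eq_iff[OF K, of x "idx m K x"] that by (auto simp: pos_def)
  show "?R"
  proof (intro allI impI)
    fix x y assume xy: "x < m + n" "y < m + n" "idx m K x = idx m K y"
    have mix: "P x y" if "x < m" "\<not> y < m" "y < m + n" "idx m K x = idx m K y" for x y
      using L posI[OF that(2,3)] that by (metis idx_less_m)
    show "P x y"
    proof (cases "x < m"; cases "y < m")
      assume "x < m" "y < m" then show ?thesis using xy refl by simp
    next
      assume "\<not> x < m" "\<not> y < m"
      then show ?thesis
        using L posI[of x] posI[of y] xy nth_mem[OF idx_less_length[OF K xy(1)]] by metis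
    qed (use mix[of x y] mix[of y x] sym xy in auto)
  qed
qed

lemma power_sum_eq_kernel_sum:
  assumes K: "K \<in> sC n m"
  shows "power_sum K = kernel_sum n m (idx m K)"
proof -
  let ?W = "{(a, b) \<in> words n m.
        (\<forall>i<m. \<forall>j\<in>pos (K ! i). a ! i = b ! (j - 1)) \<and>
        (\<forall>B\<in>set K. \<forall>i\<in>pos B. \<forall>j\<in>pos B. b ! (i - 1) = b ! (j - 1))}"
  have "power_sum K = word_sum n m (\<lambda>u. if u \<in> ?W then 1 else 0)"
    unfolding power_sum_def sC_bidegree[OF K] by (rule formal_sum_eq_word_sum) auto
  also have "\<dots> = kernel_sum n m (idx m K)"
    unfolding kernel_sum_def
  proof (rule word_sum_cong)
    fix a b :: "nat list" assume ab: "length a = m" "length b = n"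
    have pos: "1 \<le> j" if "j \<in> pos B" for j B using that by (cases j) (auto simp: pos_def)
    have "(a, b) \<in> ?W \<longleftrightarrow>
      (\<forall>i<m. \<forall>j\<in>pos (K ! i). entry (a, b) i = entry (a, b) (m + j - 1)) \<and>
      (\<forall>B\<in>set K. \<forall>i\<in>pos B. \<forall>j\<in>pos B. entry (a, b) (m + i - 1) = entry (a, b) (m + j - 1))"
      using ab by (simp add: words_def entry_fst entry_snd[OF ab(1)] pos del: One_nat_def cong: conj_cong)
    also have "\<dots> \<longleftrightarrow> finer (m + n) (idx m K) (entry (a, b))"
      unfolding finer_def by (rule ball_blocks_iff[OF K]) auto
    finally show "(if (a, b) \<in> ?W then 1 else 0) =
        of_bool (finer (m + n) (idx m K) (entry (a, b)))" by simp
  qed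
  finally show ?thesis .
qed

text \<open>The two vanishing lemmas, read backwards, say that a nonzero kernel sum separates the
  fermionic positions and isolates at most one of them. These are the hypotheses of
  \<open>superpartition_exists\<close>.\<close>

lemma kernel_sum_power_sum:
  assumes "kernel_sum n m c \<noteq> 0"
  shows "\<exists>s J. J \<in> superpartitions \<and> J \<in> sC n m \<and> length J = card (c ` {..<m + n}) \<and>
    kernel_sum n m c = scaleQ s (power_sum J)"
proof -
  have inj: "inj_on c {..<m}" using kernel_sum_not_inj assms by blast
  have "\<exists>\<tau> J. \<tau> permutes {..<m} \<and> J \<in> superpartitions \<and> J \<in> sC n m \<and>
    finer (m + n) (c \<circ> \<tau>) (idx m J) \<and> finer (m + n) (idx m J) (c \<circ> \<tau>)"
  proof (rule superpartition_exists[OF inj])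
    fix x y assume "x < m" "y < m" "\<And>z. z < m + n \<Longrightarrow> c z = c x \<Longrightarrow> z = x"
      "\<And>z. z < m + n \<Longrightarrow> c z = c y \<Longrightarrow> z = y"
    then show "x = y" using kernel_sum_two_singletons[of x m y n c] assms by blast
  qed
  then obtain \<tau> J where J: "\<tau> permutes {..<m}" "J \<in> superpartitions" "J \<in> sC n m"
    "finer (m + n) (c \<circ> \<tau>) (idx m J)" "finer (m + n) (idx m J) (c \<circ> \<tau>)" by blast
  obtain s where "kernel_sum n m c = scaleQ s (kernel_sum n m (c \<circ> \<tau>))"
    using kernel_sum_permute[OF J(1)] by blast
  moreover have "kernel_sum n m (c \<circ> \<tau>) = power_sum J"
    using kernel_sum_cong[OF J(4,5)] power_sum_eq_kernel_sum[OF J(3)] by simp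
  moreover have "length J = card (c ` {..<m + n})"
  proof -
    have "\<tau> permutes {..<m + n}" by (rule permutes_subset[OF J(1)]) auto
    then have "(c \<circ> \<tau>) ` {..<m + n} = c ` {..<m + n}" by (metis image_comp permutes_image)
    then show ?thesis
      using finer_card(1)[OF J(4)] finer_card(1)[OF J(5)] length_eq_card[OF J(3)] by simp
  qed
  ultimately show ?thesis using J by auto
qed

section \<open>Power sums form a basis\<close>

text \<open>The points of the image outside \<open>A\<close> and the points of \<open>A\<close>
  outside the image are equinumerous, so the map closes up to a permutation of the finite
  union.\<close>

lemma extend_to_permutation:
  assumes A: "finite A" and inj: "inj_on f A"
  shows "\<exists>\<pi>. permutation \<pi> \<and> (\<forall>x\<in>A. \<pi> x = f x)"
proof -
  let ?B = "f ` A"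
  have "card (?B - A) = card (A - ?B)"
    using A by (simp add: card_Diff_subset_Int card_image[OF inj] Int_commute)
  then obtain g where g: "bij_betw g (?B - A) (A - ?B)"
    using A by (metis finite_Diff finite_imageI finite_same_card_bij)
  define \<pi> where "\<pi> x = (if x \<in> A then f x else if x \<in> ?B then g x else x)" for x
  have "bij_betw \<pi> (A \<union> (?B - A)) (?B \<union> (A - ?B))"
  proof (rule bij_betw_combine)
    show "bij_betw \<pi> A ?B" using inj by (auto simp: bij_betw_def \<pi>_def inj_on_def)
    show "bij_betw \<pi> (?B - A) (A - ?B)"
      using g by (subst bij_betw_cong[where g = g]) (auto simp: \<pi>_def)
  qed auto
  moreover have "A \<union> (?B - A) = A \<union> ?B" "?B \<union> (A - ?B) = A \<union> ?B" by auto
  ultimately have "\<pi> permutes (A \<union> ?B)" by (intro bij_imp_permutes) (auto simp: \<pi>_def)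
  moreover have "finite (A \<union> ?B)" using A by simp
  ultimately have "permutation \<pi>" unfolding permutation_permutes by blast
  then show ?thesis by (intro exI[of _ \<pi>]) (simp add: \<pi>_def)
qed

text \<open>The coefficient at the simplest word of type \<open>I\<close>: the letter at each
  position is the index of its block.\<close>

definition canonical_coeff :: "nat set list \<Rightarrow> superseries \<Rightarrow> rat" where
  "canonical_coeff I f =
    coeff f {..<fdeg I} (map (idx (fdeg I) I) [fdeg I..<fdeg I + deg I])"

text \<open>A monomial with at most one fermionic index outside its word is, up to sign, the image
  of a canonical one under a finite permutation of the indices; all other coefficients vanish by
  \<open>sNCSym_coeff_zero\<close>.\<close>

lemma canonical_coeff_separating:
  assumes f: "f \<in> sNCSym" and zero: "\<And>I. I \<in> superpartitions \<Longrightarrow> canonical_coeff I f = 0"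
  shows "f = 0"
proof (rule superseries_eqI)
  fix S :: "nat set" and w :: "nat list" assume S: "finite S"
  define m n a where "m = card S" and "n = length w" and "a = sorted_list_of_set S"
  define c where "c = entry (a, w)"
  have a: "length a = m" "set a = S" "distinct a" using S by (auto simp: a_def m_def)
  have c1: "c x = a ! x" if "x < m" for x using that a(1) by (simp add: c_def entry_fst)
  have c2: "c x = w ! (x - m)" if "\<not> x < m" for x using that a(1) by (simp add: c_def entry_def nth_append)
  have inj: "inj_on c {..<m}" using a by (auto simp: inj_on_def c1 nth_eq_iff_index_eq)
  have "coeff f S w = 0"
  proof (cases "\<exists>x y. x \<in> S - set w \<and> y \<in> S - set w \<and> x \<noteq> y")
    case True
    then show ?thesis using sNCSym_coeff_zero[OF f] by blast
  next
    case False
    have out: "c x \<in> S - set w" if "x < m" "\<And>z. z < m + n \<Longrightarrow> c z = c x \<Longrightarrow> z = x" for x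
    proof -
      have "c x \<notin> set w"
      proof
        assume "c x \<in> set w"
        then obtain k where "k < n" "w ! k = c x" by (auto simp: in_set_conv_nth n_def)
        then have "m + k = x" using that(2)[of "m + k"] c2[of "m + k"] by simp
        then show False using that(1) by simp
      qed
      then show ?thesis using c1[OF that(1)] that(1) a by auto
    qed
    obtain \<tau> J where J: "\<tau> permutes {..<m}" "J \<in> superpartitions" "J \<in> sC n m"
      "finer (m + n) (c \<circ> \<tau>) (idx m J)" "finer (m + n) (idx m J) (c \<circ> \<tau>)"
    proof -
      have "x = y" if "x < m" "y < m" "\<And>z. z < m + n \<Longrightarrow> c z = c x \<Longrightarrow> z = x"
        "\<And>z. z < m + n \<Longrightarrow> c z = c y \<Longrightarrow> z = y" for x y
      proof -
        have "c x = c y" using False out[OF that(1,3)] out[OF that(2,4)] by blast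
        then show ?thesis using inj_onD[OF inj] that(1,2) by blast
      qed
      then show ?thesis using superpartition_exists[OF inj, of n] that by blast
    qed
    \<comment> \<open>The renaming from block indices to actual letters, well defined and injective
      because both functions have the same kernel.\<close>
    define g where "g k = (c \<circ> \<tau>) (inv_into {..<m + n} (idx m J) k)" for k
    have g: "g (idx m J x) = c (\<tau> x)" if "x < m + n" for x
    proof -
      let ?y = "inv_into {..<m + n} (idx m J) (idx m J x)"
      have "?y < m + n" "idx m J ?y = idx m J x"
        using inv_into_into[of "idx m J x" "idx m J" "{..<m + n}"] that by (auto simp: f_inv_into_f)
      then show ?thesis using finerD[OF J(5), of ?y x] that by (simp add: g_def)
    qed
    have "inj_on g (idx m J ` {..<m + n})"
    proof (rule inj_onI)
      fix k l assume "k \<in> idx m J ` {..<m + n}" "l \<in> idx m J ` {..<m + n}" and kl: "g k = g l"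
      then obtain x y where xy: "x < m + n" "y < m + n" "k = idx m J x" "l = idx m J y" by blast
      then have "(c \<circ> \<tau>) x = (c \<circ> \<tau>) y" using kl g[of x] g[of y] by simp
      then show "k = l" using finerD[OF J(4) xy(1,2)] xy(3,4) by simp
    qed
    then obtain \<pi> where pi0: "permutation \<pi>" "\<forall>k\<in>idx m J ` {..<m + n}. \<pi> k = g k"
      using extend_to_permutation[of "idx m J ` {..<m + n}" g] by auto
    have pi: "\<pi> (idx m J x) = c (\<tau> x)" if "x < m + n" for x
      using pi0(2) g[OF that] that by simp
    have "\<pi> ` {..<m} = c ` (\<tau> ` {..<m})"
      unfolding image_image
    proof (rule image_cong[OF refl])
      fix x assume "x \<in> {..<m}"
      then show "\<pi> x = c (\<tau> x)" using pi[of x] by simp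
    qed
    also have "\<dots> = S"
      using permutes_image[OF J(1)] c1 a by (auto simp: set_conv_nth image_iff)
    finally have S': "\<pi> ` {..<m} = S" .
    have w': "map \<pi> (map (idx m J) [m..<m + n]) = w"
    proof (rule nth_equalityI)
      fix i assume "i < length (map \<pi> (map (idx m J) [m..<m + n]))"
      then have i: "i < n" by simp
      then have "map \<pi> (map (idx m J) [m..<m + n]) ! i = c (\<tau> (m + i))" using pi by simp
      also have "\<tau> (m + i) = m + i" using permutes_not_in[OF J(1)] by simp
      finally show "map \<pi> (map (idx m J) [m..<m + n]) ! i = w ! i" using c2 by simp
    qed (simp add: n_def)
    have "coeff f {..<m} (map (idx m J) [m..<m + n]) = 0"
      using zero[OF J(2)] by (simp add: canonical_coeff_def sC_bidegree[OF J(3)])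
    from sNCSym_coeff_eq[OF f pi0(1) _ this] show ?thesis unfolding S' w' by simp
  qed
  then show "coeff f S w = coeff 0 S w" by simp
qed

lemma finite_canonical_coeff:
  "finite {I \<in> superpartitions. canonical_coeff I f \<noteq> 0}"
proof -
  obtain d where d: "\<And>S w. coeff f S w \<noteq> 0 \<Longrightarrow> card S + length w \<le> d"
    using bounded_coeff[of f] unfolding bounded_degree_def by blast
  have "{I \<in> superpartitions. canonical_coeff I f \<noteq> 0} \<subseteq> (\<Union>n\<in>{..d}. \<Union>m\<in>{..d}. sC n m)"
  proof
    fix I assume "I \<in> {I \<in> superpartitions. canonical_coeff I f \<noteq> 0}"
    then have "I \<in> sC (deg I) (fdeg I)" "fdeg I + deg I \<le> d"
      using superpartition_bidegree d unfolding canonical_coeff_def by fastforce+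
    then show "I \<in> (\<Union>n\<in>{..d}. \<Union>m\<in>{..d}. sC n m)" by (intro UN_I[of "deg I"] UN_I[of "fdeg I"]) auto
  qed
  then show ?thesis by (rule finite_subset) (simp add: finite_sC)
qed

text \<open>A contributing arrangement \<open>a\<close> lists \<open>0, ..., m - 1\<close> in some
  order, so it is a permutation of the fermionic positions. The term survives only if
  \<open>J\<close> is finer than \<open>I\<close> relabelled by it, and
  \<open>superpartition_unique\<close> applies.\<close>

lemma canonical_coeff_term:
  assumes I: "I \<in> superpartitions" "I \<in> sC n m" and J: "J \<in> superpartitions" "J \<in> sC n m'"
    and a: "length a = m'"
    and fin: "finer (m' + n) (idx m' J) (entry (a, map (idx m I) [m..<m + n]))"
    and nz: "coeff (word_val (a, map (idx m I) [m..<m + n])) {..<m} (map (idx m I) [m..<m + n]) \<noteq> 0"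
    and len: "length J \<le> length I"
  shows "I = J \<and> a = [0..<m]"
proof -
  let ?b = "map (idx m I) [m..<m + n]"
  have da: "set a = {..<m}" "distinct a" using word_val_nonzero[OF nz] by auto
  then have m: "m' = m" using a distinct_card by fastforce
  define \<tau> where "\<tau> i = (if i < m then a ! i else i)" for i
  have \<tau>: "\<tau> permutes {..<m}"
  proof (rule bij_imp_permutes)
    have "bij_betw ((!) a) {..<m} {..<m}" by (rule bij_betw_nth) (use da a m in auto)
    then show "bij_betw \<tau> {..<m} {..<m}"
      by (subst bij_betw_cong[where g = "(!) a"]) (auto simp: \<tau>_def)
  qed (simp add: \<tau>_def)
  have "entry (a, ?b) x = (idx m I \<circ> \<tau>) x" if "x < m + n" for x
  proof (cases "x < m")
    case True
    then have "a ! x < m" using nth_mem[of x a] a m da(1) by simp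
    then show ?thesis using True a m by (simp add: entry_fst \<tau>_def)
  qed (use that a m in \<open>simp add: entry_def nth_append \<tau>_def\<close>)
  then have "finer (m + n) (idx m J) (idx m I \<circ> \<tau>)"
    using fin finer_cong_right[of "m + n" "entry (a, ?b)" "idx m I \<circ> \<tau>" "idx m J"] m by blast
  from superpartition_unique[OF I J(1) _ \<tau> this len] J(2) m have "I = J" "\<tau> = id" by auto
  moreover have "a = [0..<m]"
  proof (rule nth_equalityI)
    fix i assume "i < length a"
    then show "a ! i = [0..<m] ! i"
      using fun_cong[OF \<open>\<tau> = id\<close>, of i] a m by (simp add: \<tau>_def)
  qed (use a m in simp)
  ultimately show ?thesis by simp
qed

lemma canonical_coeff_power_sum:
  assumes I: "I \<in> superpartitions" and J: "J \<in> superpartitions"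
  shows "canonical_coeff I (power_sum I) \<noteq> 0"
    and "canonical_coeff I (power_sum J) \<noteq> 0 \<Longrightarrow> I \<noteq> J \<Longrightarrow> length I < length J"
proof -
  define n m where "n = deg I" and "m = fdeg I"
  note In = superpartition_bidegree[OF I, folded n_def m_def]
  let ?b = "map (idx m I) [m..<m + n]"
  let ?L = "\<lambda>m'. {a. set a \<subseteq> {..<m} \<and> length a = m'}"
  have e: "canonical_coeff I (power_sum J) = (if deg J = n then
      \<Sum>a\<in>?L (fdeg J). of_bool (finer (fdeg J + n) (idx (fdeg J) J) (entry (a, ?b))) *
        coeff (word_val (a, ?b)) {..<m} ?b else 0)" if J: "J \<in> superpartitions" for J
    unfolding canonical_coeff_def power_sum_eq_kernel_sum[OF superpartition_bidegree[OF J]]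
      kernel_sum_def by (simp add: coeff_word_sum n_def m_def)
  \<comment> \<open>Only the increasing arrangement contributes, so there is nothing to cancel and
    the value is 1.\<close>
  have "canonical_coeff I (power_sum I) = (\<Sum>a\<in>?L m. if a = [0..<m] then 1 else 0)"
    unfolding e[OF I] m_def[symmetric] n_def[symmetric]
  proof (simp, intro sum.cong refl)
    fix a assume "a \<in> ?L m"
    then have len: "length a = m" by simp
    show "of_bool (finer (m + n) (idx m I) (entry (a, ?b))) * coeff (word_val (a, ?b)) {..<m} ?b =
        (if a = [0..<m] then 1 else 0)"
    proof (cases "a = [0..<m]")
      case True
      have "entry (a, ?b) x = idx m I x" if "x < m + n" for x
        using that True by (cases "x < m") (auto simp: entry_def nth_append)
      then have "finer (m + n) (idx m I) (entry (a, ?b))" unfolding finer_def by simp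
      moreover have "coeff (word_val (a, ?b)) {..<m} ?b = 1"
        using True by (simp add: coeff_sorted_word atLeast0LessThan)
      ultimately show ?thesis using True by simp
    next
      case False
      then show ?thesis using canonical_coeff_term[OF I In I In len] by auto
    qed
  qed
  also have "\<dots> = 1"
    by (subst sum.delta) (auto simp: finite_lists_length_eq)
  finally show "canonical_coeff I (power_sum I) \<noteq> 0" by simp
  assume nz: "canonical_coeff I (power_sum J) \<noteq> 0" and ne: "I \<noteq> J"
  then have dJ: "deg J = n" using e[OF J] by (auto split: if_splits)
  with nz e[OF J] have "(\<Sum>a\<in>?L (fdeg J). of_bool (finer (fdeg J + n) (idx (fdeg J) J) (entry (a, ?b))) *
        coeff (word_val (a, ?b)) {..<m} ?b) \<noteq> 0" by simp
  then obtain a where a: "a \<in> ?L (fdeg J)" "of_bool (finer (fdeg J + n) (idx (fdeg J) J) (entry (a, ?b))) *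
        coeff (word_val (a, ?b)) {..<m} ?b \<noteq> 0" by (meson sum.neutral)
  show "length I < length J"
  proof (rule ccontr)
    assume "\<not> length I < length J"
    then show False
      using canonical_coeff_term[OF I In J _ _ _ _, of "fdeg J" a] superpartition_bidegree[OF J] a ne dJ
      by (auto split: if_splits)
  qed
qed

lemma basis_family_power_sum: "basis_family power_sum superpartitions sNCSym"
proof (rule basis_family_triangular[where \<phi> = canonical_coeff and r = length])
  show "superseries.subspace sNCSym" by (rule sNCSym_subspace)
  show "canonical_coeff i (x + y) = canonical_coeff i x + canonical_coeff i y" for i x y
    by (simp add: canonical_coeff_def)
  show "canonical_coeff i (scaleQ c x) = c * canonical_coeff i x" for i c x
    by (simp add: canonical_coeff_def)
  show "power_sum i \<in> sNCSym" if "i \<in> superpartitions" for i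
    using power_sum_eq_kernel_sum[OF superpartition_bidegree[OF that]] kernel_sum_in_sNCSym by simp
qed (use canonical_coeff_separating finite_canonical_coeff canonical_coeff_power_sum in blast)+

section \<open>Permutations preserving the fibres of a function\<close>

text \<open>The Young subgroup of the partition of \<open>A\<close> into the fibres of
  \<open>g\<close>.\<close>

definition stabiliser :: "'a set \<Rightarrow> ('a \<Rightarrow> 'b) \<Rightarrow> ('a \<Rightarrow> 'a) set" where
  "stabiliser A g = {\<sigma>. \<sigma> permutes A \<and> (\<forall>x\<in>A. g (\<sigma> x) = g x)}"

lemma finite_stabiliser: "finite A \<Longrightarrow> finite (stabiliser A g)"
  unfolding stabiliser_def by (rule finite_subset[OF _ finite_permutations]) auto

text \<open>Coset decomposition by the image of \<open>a\<close>: a transposition inside the fibre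
  brings \<open>a\<close> back, and the remaining factor lives on \<open>A\<close>. The counting of
  the group and the sign formula below proceed by this induction.\<close>

lemma stabiliser_insert:
  assumes a: "a \<notin> A" and \<sigma>: "\<sigma> \<in> stabiliser (insert a A) g"
  shows "transpose a (\<sigma> a) \<circ> \<sigma> \<in> stabiliser A g" "\<sigma> a \<in> insert a A" "g (\<sigma> a) = g a"
    "\<sigma> = transpose a (\<sigma> a) \<circ> (transpose a (\<sigma> a) \<circ> \<sigma>)"
proof -
  have p: "\<sigma> permutes insert a A" and g: "\<And>x. x \<in> insert a A \<Longrightarrow> g (\<sigma> x) = g x"
    using \<sigma> by (auto simp: stabiliser_def)
  show "\<sigma> a \<in> insert a A" using permutes_in_image[OF p] by simp
  show ga: "g (\<sigma> a) = g a" using g by simp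
  show "\<sigma> = transpose a (\<sigma> a) \<circ> (transpose a (\<sigma> a) \<circ> \<sigma>)"
    by (simp add: fun_eq_iff)
  have "g (transpose a (\<sigma> a) y) = g y" for y using ga by (simp add: transpose_def)
  then show "transpose a (\<sigma> a) \<circ> \<sigma> \<in> stabiliser A g"
    using permutes_insert_lemma[OF p] g by (simp add: stabiliser_def)
qed

lemma stabiliser_insertI:
  assumes a: "a \<notin> A" and p: "p \<in> stabiliser A g" and b: "b \<in> insert a A" "g b = g a"
  shows "transpose a b \<circ> p \<in> stabiliser (insert a A) g" "(transpose a b \<circ> p) a = b"
proof -
  have p': "p permutes A" and g: "\<And>x. x \<in> A \<Longrightarrow> g (p x) = g x"
    using p by (auto simp: stabiliser_def)
  have pa: "p a = a" using permutes_not_in[OF p' a] .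
  then show "(transpose a b \<circ> p) a = b" by simp
  have "transpose a b \<circ> p permutes insert a A"
  proof (rule permutes_compose)
    show "p permutes insert a A" by (rule permutes_subset[OF p']) auto
    show "transpose a b permutes insert a A" by (rule permutes_swap_id) (use b in auto)
  qed
  moreover have "g (transpose a b y) = g y" for y using b by (simp add: transpose_def)
  ultimately show "transpose a b \<circ> p \<in> stabiliser (insert a A) g"
    using g pa b(2) by (auto simp: stabiliser_def)
qed

text \<open>Adding \<open>a\<close> enlarges its fibre from \<open>k\<close> to \<open>k + 1\<close>
  points, and these are the possible images of \<open>a\<close>; this is the step from
  \<open>k\<close> factorial to the next.\<close>

lemma card_stabiliser:
  assumes "finite A"
  shows "card (stabiliser A g) = (\<Prod>v\<in>g ` A. fact (card {x \<in> A. g x = v}))"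
  using assms
proof (induction A)
  case empty
  have "stabiliser {} g = {id}" by (auto simp: stabiliser_def)
  then show ?case by simp
next
  case (insert a A)
  let ?C = "{b \<in> insert a A. g b = g a}"
  let ?k = "\<lambda>v. card {x \<in> A. g x = v}"
  have "bij_betw (\<lambda>(b, p). transpose a b \<circ> p) (?C \<times> stabiliser A g) (stabiliser (insert a A) g)"
  proof (rule bij_betw_byWitness[where f' = "\<lambda>\<sigma>. (\<sigma> a, transpose a (\<sigma> a) \<circ> \<sigma>)"])
    show "\<forall>bp\<in>?C \<times> stabiliser A g. (\<lambda>\<sigma>. (\<sigma> a, transpose a (\<sigma> a) \<circ> \<sigma>)) ((\<lambda>(b, p). transpose a b \<circ> p) bp) = bp"
    proof (clarify, intro conjI)
      fix b p assume "b \<in> insert a A" "p \<in> stabiliser A g" "g b = g a"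
      from stabiliser_insertI(2)[OF insert.hyps(2) this(2,1,3)]
      have e: "(transpose a b \<circ> p) a = b" .
      then show "(transpose a b \<circ> p) a = b" .
      show "transpose a ((transpose a b \<circ> p) a) \<circ> (transpose a b \<circ> p) = p"
        unfolding e by (simp add: fun_eq_iff)
    qed
    show "\<forall>\<sigma>\<in>stabiliser (insert a A) g.
        (\<lambda>(b, p). transpose a b \<circ> p) (\<sigma> a, transpose a (\<sigma> a) \<circ> \<sigma>) = \<sigma>"
      using stabiliser_insert(4)[OF insert.hyps(2)] by auto
    show "(\<lambda>(b, p). transpose a b \<circ> p) ` (?C \<times> stabiliser A g) \<subseteq> stabiliser (insert a A) g"
      using stabiliser_insertI(1)[OF insert.hyps(2)] by auto
    show "(\<lambda>\<sigma>. (\<sigma> a, transpose a (\<sigma> a) \<circ> \<sigma>)) ` stabiliser (insert a A) g \<subseteq> ?C \<times> stabiliser A g"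
      using stabiliser_insert(1-3)[OF insert.hyps(2), of _ g] by blast
  qed
  from bij_betw_same_card[OF this]
  have "card (stabiliser (insert a A) g) = card ?C * card (stabiliser A g)"
    by (simp only: card_cartesian_product)
  moreover have "card ?C = Suc (?k (g a))"
  proof -
    have "?C = insert a {x \<in> A. g x = g a}" by auto
    then show ?thesis using insert.hyps by simp
  qed
  moreover have "(\<Prod>v\<in>g ` A. fact (?k v) :: nat) =
      fact (?k (g a)) * (\<Prod>v\<in>g ` A - {g a}. fact (?k v))"
  proof (cases "g a \<in> g ` A")
    case True
    then show ?thesis using insert.hyps(1) by (simp add: prod.remove)
  next
    case False
    then have "g x \<noteq> g a" if "x \<in> A" for x using that by (metis imageI)
    then have "{x \<in> A. g x = g a} = {}" by blast
    then show ?thesis using False by (simp del: Collect_empty_eq)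
  qed
  moreover have "(\<Prod>v\<in>g ` insert a A. fact (card {x \<in> insert a A. g x = v}) :: nat) =
      fact (card ?C) * (\<Prod>v\<in>g ` A - {g a}. fact (?k v))"
  proof -
    have "{x \<in> insert a A. g x = v} = {x \<in> A. g x = v}" if "v \<noteq> g a" for v
      using that by auto
    then show ?thesis
      using insert.hyps(1) by (simp only: image_insert prod.insert_remove finite_imageI) simp
  qed
  ultimately show ?case using insert.IH by (simp only: fact_Suc of_nat_id mult.assoc)
qed

text \<open>
  The orbits of \<open>\<sigma>\<close> are the nonempty fibres of \<open>g\<close>; orbits are described by the invariant functions.
\<close>

definition orbits_are_fibres :: "'a set \<Rightarrow> ('a \<Rightarrow> 'b) \<Rightarrow> ('a \<Rightarrow> 'a) \<Rightarrow> bool" where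
  "orbits_are_fibres A g \<sigma> \<longleftrightarrow> \<sigma> \<in> stabiliser A g \<and>
     (\<forall>v :: 'a \<Rightarrow> nat. (\<forall>x\<in>A. v (\<sigma> x) = v x) \<longrightarrow> (\<forall>x\<in>A. \<forall>y\<in>A. g x = g y \<longrightarrow> v x = v y))"

lemma orbits_are_fibresD:
  fixes v :: "'a \<Rightarrow> nat"
  assumes "orbits_are_fibres A g \<sigma>" "\<And>x. x \<in> A \<Longrightarrow> v (\<sigma> x) = v x" "x \<in> A" "y \<in> A" "g x = g y"
  shows "v x = v y"
  using assms unfolding orbits_are_fibres_def by blast

text \<open>Composing with the transposition of \<open>a\<close> and its image cuts \<open>a\<close>
  out of its cycle. The sign changes exactly when \<open>a\<close> shares its fibre with another
  point, which is when the exponent grows by one.\<close>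

lemma sign_orbits_are_fibres:
  assumes "finite A" "orbits_are_fibres A g \<sigma>"
  shows "sign \<sigma> = (-1) ^ (card A - card (g ` A))"
  using assms
proof (induction A arbitrary: \<sigma>)
  case empty
  then show ?case by (simp add: orbits_are_fibres_def stabiliser_def)
next
  case (insert a A)
  define b p where "b = \<sigma> a" and "p = transpose a b \<circ> \<sigma>"
  have st: "\<sigma> \<in> stabiliser (insert a A) g" using insert.prems by (simp add: orbits_are_fibres_def)
  note stab = stabiliser_insert[OF insert.hyps(2) st, folded b_def, folded p_def]
  have p: "p permutes A" using stab(1) by (simp add: stabiliser_def)
  have pa: "p a = a" using permutes_not_in[OF p insert.hyps(2)] .
  have sign: "sign \<sigma> = (if a = b then 1 else - 1) * sign p"
    using stab(4) permutes_imp_permutation[OF insert.hyps(1) p]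
      sign_compose[OF permutation_swap_id[of a b], of p] by (simp add: sign_swap_id)
  have orb: "orbits_are_fibres A g p"
    unfolding orbits_are_fibres_def
  proof (intro conjI allI impI ballI)
    show "p \<in> stabiliser A g" by (rule stab(1))
    fix v :: "'a \<Rightarrow> nat" and x y
    assume v: "\<forall>x\<in>A. v (p x) = v x" and xy: "x \<in> A" "y \<in> A" "g x = g y"
    \<comment> \<open>An invariant of \<open>p\<close> becomes an invariant of
      \<open>\<sigma>\<close> when \<open>a\<close> is given the value at its image
      \<open>b\<close>.\<close>
    define w where "w = (if b = a then v else v(a := v b))"
    have wA: "w z = v z" if "z \<in> A" for z using that insert.hyps(2) by (auto simp: w_def)
    have "w (\<sigma> z) = w z" if z: "z \<in> insert a A" for z
    proof (cases "z = a")
      case True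
      then show ?thesis using b_def by (auto simp: w_def)
    next
      case False
      then have zA: "z \<in> A" "p z \<in> A" using z permutes_in_image[OF p] by auto
      have "\<sigma> z = transpose a b (p z)" using stab(4) by (metis comp_apply)
      moreover have "w (transpose a b (p z)) = v (p z)"
        using zA insert.hyps(2) by (auto simp: w_def transpose_def)
      ultimately show ?thesis using v zA wA by simp
    qed
    then have "w x = w y" using orbits_are_fibresD[OF insert.prems] xy by blast
    then show "v x = v y" using wA xy by simp
  qed
  note IH = insert.IH[OF orb]
  show ?case
  proof (cases "g a \<in> g ` A")
    case True
    then obtain a' where a': "a' \<in> A" "g a' = g a" by force
    have "a \<noteq> b"
    proof
      assume ab: "a = b"
      \<comment> \<open>If \<open>a\<close> were fixed, its indicator function would be invariant
        and would separate it from \<open>a'\<close> in the same fibre.\<close>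
      define v where "v x = (if x = a then 1 else 0 :: nat)" for x
      have "v (\<sigma> x) = v x" if "x \<in> insert a A" for x
        using ab b_def st permutes_inj[of \<sigma> "insert a A"]
        by (auto simp: v_def stabiliser_def inj_eq dest: injD)
      then have "v a = v a'" using orbits_are_fibresD[OF insert.prems] a' by (metis insertCI)
      then show False using a'(1) insert.hyps(2) by (auto simp: v_def split: if_splits)
    qed
    moreover have "card (g ` A) \<le> card A" using insert.hyps(1) by (rule card_image_le)
    ultimately show ?thesis
      using sign IH True insert.hyps by (simp add: insert_absorb Suc_diff_le)
  next
    case False
    then have "a = b" using stab(2,3) by (metis image_eqI insertE)
    then show ?thesis using sign IH False insert.hyps by simp
  qed
qed

lemma orbits_are_fibres_exists:
  assumes "finite A"
  shows "\<exists>\<sigma>. orbits_are_fibres A g \<sigma>"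
  using assms
proof (induction A)
  case empty
  show ?case by (intro exI[of _ id]) (auto simp: orbits_are_fibres_def stabiliser_def fun_eq_iff)
next
  case (insert a A)
  then obtain p where p: "orbits_are_fibres A g p" by blast
  then have pst: "p \<in> stabiliser A g" by (simp add: orbits_are_fibres_def)
  then have pA: "p permutes A" by (simp add: stabiliser_def)
  \<comment> \<open>The new point is inserted into the cycle of a point of its fibre, or left fixed
    if the fibre is new.\<close>
  define b where "b = (if g a \<in> g ` A then (SOME b. b \<in> A \<and> g b = g a) else a)"
  have b: "b \<in> A \<and> g b = g a" if "g a \<in> g ` A"
  proof -
    have "\<exists>b. b \<in> A \<and> g b = g a" using that by force
    then show ?thesis unfolding b_def using that by (simp add: someI_ex[of "\<lambda>b. b \<in> A \<and> g b = g a"])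
  qed
  have b': "b \<in> insert a A" "g b = g a" using b by (cases "g a \<in> g ` A"; simp add: b_def)+
  let ?s = "transpose a b \<circ> p"
  note s = stabiliser_insertI[OF insert.hyps(2) pst b']
  have "orbits_are_fibres (insert a A) g ?s"
    unfolding orbits_are_fibres_def
  proof (intro conjI allI impI)
    fix v :: "'a \<Rightarrow> nat" assume "\<forall>x\<in>insert a A. v (?s x) = v x"
    then have v: "v (?s x) = v x" if "x \<in> insert a A" for x using that by blast
    have vb: "v b = v a" using v[of a] s(2) by simp
    then have tv: "v (transpose a b y) = v y" for y by (simp add: transpose_def)
    have "v (p x) = v x" if "x \<in> A" for x using v[of x] that tv by simp
    then have vA: "v x = v y" if "x \<in> A" "y \<in> A" "g x = g y" for x y
      using orbits_are_fibresD[OF p] that by blast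
    have va: "v x = v a" if "x \<in> A" "g x = g a" for x
    proof -
      have "g a \<in> g ` A" using that by (intro image_eqI[of _ _ x]) auto
      then show ?thesis using vA[of x b] b that vb by simp
    qed
    show "\<forall>x\<in>insert a A. \<forall>y\<in>insert a A. g x = g y \<longrightarrow> v x = v y"
    proof (intro ballI impI)
      fix x y assume xy: "x \<in> insert a A" "y \<in> insert a A" "g x = g y"
      show "v x = v y"
      proof (cases "x = a"; cases "y = a")
        assume "x = a" "y \<noteq> a"
        then show ?thesis using va[of y] xy by auto
      next
        assume "x \<noteq> a" "y = a"
        then show ?thesis using va[of x] xy by auto
      qed (use vA[of x y] xy in auto)
    qed
  qed (rule s(1))
  then show ?case by blast
qed

text \<open>The sum runs over the group preserving both \<open>g\<close> and \<open>u\<close>. It is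
  trivial if no two points agree in both; otherwise composition with the transposition of such a
  pair is a sign-reversing involution of the group.\<close>

lemma signed_stabiliser:
  assumes A: "finite A"
  shows "(\<Sum>\<sigma>\<in>stabiliser A g. of_int (sign \<sigma>) * of_bool (\<forall>x\<in>A. u (\<sigma> x) = u x)) =
    (of_bool (\<forall>x\<in>A. \<forall>y\<in>A. g x = g y \<longrightarrow> x = y \<or> u x \<noteq> u y) :: rat)"
proof -
  let ?S = "stabiliser A (\<lambda>x. (g x, u x))"
  have S: "?S = {\<sigma> \<in> stabiliser A g. \<forall>x\<in>A. u (\<sigma> x) = u x}"
    by (auto simp: stabiliser_def)
  have "(\<Sum>\<sigma>\<in>stabiliser A g. of_int (sign \<sigma>) * of_bool (\<forall>x\<in>A. u (\<sigma> x) = u x)) =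
      (\<Sum>\<sigma>\<in>?S. of_int (sign \<sigma>) :: rat)"
    unfolding S by (subst sum.inter_filter[OF finite_stabiliser[OF A]]) (rule sum.cong, auto)
  also have "\<dots> = of_bool (\<forall>x\<in>A. \<forall>y\<in>A. g x = g y \<longrightarrow> x = y \<or> u x \<noteq> u y)"
  proof (cases "\<forall>x\<in>A. \<forall>y\<in>A. g x = g y \<longrightarrow> x = y \<or> u x \<noteq> u y")
    case True
    have "?S = {id}"
    proof (intro equalityI subsetI)
      fix \<sigma> assume \<sigma>: "\<sigma> \<in> ?S"
      then have p: "\<sigma> permutes A" by (simp add: stabiliser_def)
      have "\<sigma> x = x" for x
      proof (cases "x \<in> A")
        case x: True
        then have "g (\<sigma> x) = g x" "u (\<sigma> x) = u x" using \<sigma> by (auto simp: stabiliser_def)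
        then show ?thesis using True x permutes_in_image[OF p] by blast
      qed (use permutes_not_in[OF p] in simp)
      then show "\<sigma> \<in> {id}" by auto
    qed (auto simp: stabiliser_def permutes_id)
    then show ?thesis using True by simp
  next
    case False
    then obtain x y where xy: "x \<in> A" "y \<in> A" "g x = g y" "u x = u y" "x \<noteq> y" by blast
    let ?t = "transpose x y"
    have t: "?t permutes A" using xy by (intro permutes_swap_id)
    have gu: "g (?t z) = g z" "u (?t z) = u z" for z using xy by (auto simp: transpose_def)
    have mem: "?t \<circ> \<sigma> \<in> ?S" if "\<sigma> \<in> ?S" for \<sigma>
      using that t gu by (auto simp: stabiliser_def intro: permutes_compose)
    have inv: "?t \<circ> (?t \<circ> \<sigma>) = \<sigma>" for \<sigma> by (simp add: fun_eq_iff)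
    have "(\<Sum>\<sigma>\<in>?S. of_int (sign \<sigma>) :: rat) = (\<Sum>\<sigma>\<in>?S. of_int (sign (?t \<circ> \<sigma>)))"
      by (rule sum.reindex_bij_witness[where i = "\<lambda>\<sigma>. ?t \<circ> \<sigma>" and j = "\<lambda>\<sigma>. ?t \<circ> \<sigma>"])
        (simp_all only: inv mem)
    also have "\<dots> = (\<Sum>\<sigma>\<in>?S. - of_int (sign \<sigma>))"
    proof (rule sum.cong[OF refl])
      fix \<sigma> assume "\<sigma> \<in> ?S"
      then have "permutation \<sigma>" using A permutes_imp_permutation by (auto simp: stabiliser_def)
      then show "of_int (sign (?t \<circ> \<sigma>)) = (- of_int (sign \<sigma>) :: rat)"
        using xy(5) by (simp add: sign_compose permutation_swap_id sign_swap_id)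
    qed
    finally show ?thesis using False by (simp add: sum_negf)
  qed
  finally show ?thesis .
qed

section \<open>Expansion in power sums\<close>

text \<open>Two positions have the same image iff no invariant function separates them.\<close>

definition orbit_map :: "nat \<Rightarrow> (nat \<Rightarrow> nat) \<Rightarrow> nat \<Rightarrow> (nat \<Rightarrow> nat) \<Rightarrow> nat" where
  "orbit_map N \<sigma> x = (\<lambda>v. if \<forall>y<N. v (\<sigma> y) = v y then v x else 0)"

lemma orbit_map_eqD:
  fixes v :: "nat \<Rightarrow> nat"
  assumes "orbit_map N \<sigma> x = orbit_map N \<sigma> y" "\<And>z. z < N \<Longrightarrow> v (\<sigma> z) = v z"
  shows "v x = v y"
  using fun_cong[OF assms(1), of v] assms(2) by (simp add: orbit_map_def)

lemma orbit_map_invariant: "x < N \<Longrightarrow> orbit_map N \<sigma> (\<sigma> x) = orbit_map N \<sigma> x"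
  by (rule ext) (auto simp: orbit_map_def)

lemma finer_orbit_map_iff:
  fixes u :: "nat \<Rightarrow> nat"
  assumes "\<sigma> permutes {..<N}"
  shows "finer N (orbit_map N \<sigma>) u \<longleftrightarrow> (\<forall>x<N. u (\<sigma> x) = u x)"
proof
  assume f: "finer N (orbit_map N \<sigma>) u"
  show "\<forall>x<N. u (\<sigma> x) = u x"
  proof (intro allI impI)
    fix x assume x: "x < N"
    then have "\<sigma> x < N" using permutes_in_image[OF assms, of x] by simp
    then show "u (\<sigma> x) = u x" using finerD[OF f _ x orbit_map_invariant[OF x]] by blast
  qed
next
  assume "\<forall>x<N. u (\<sigma> x) = u x"
  then show "finer N (orbit_map N \<sigma>) u" unfolding finer_def using orbit_map_eqD by blast
qed

text \<open>The common form of two families: \<open>\<epsilon>\<close> is the sign for elementary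
  functions and constantly 1 for complete homogeneous ones.\<close>

definition weighted_sum :: "nat \<Rightarrow> nat \<Rightarrow> ((nat \<Rightarrow> nat) \<Rightarrow> rat) \<Rightarrow> nat set list \<Rightarrow> superseries" where
  "weighted_sum n m \<epsilon> K = word_sum n m (\<lambda>u. \<Sum>\<sigma>\<in>stabiliser {..<m + n} (idx m K).
     \<epsilon> \<sigma> * of_bool (\<forall>x\<in>{..<m + n}. entry u (\<sigma> x) = entry u x))"

lemma weighted_sum_eq:
  "weighted_sum n m \<epsilon> K = (\<Sum>\<sigma>\<in>stabiliser {..<m + n} (idx m K).
     scaleQ (\<epsilon> \<sigma>) (kernel_sum n m (orbit_map (m + n) \<sigma>)))"
proof -
  have "kernel_sum n m (orbit_map (m + n) \<sigma>) =
      word_sum n m (\<lambda>u. of_bool (\<forall>x\<in>{..<m + n}. entry u (\<sigma> x) = entry u x))"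
    if "\<sigma> \<in> stabiliser {..<m + n} (idx m K)" for \<sigma>
    using that by (simp add: kernel_sum_def stabiliser_def finer_orbit_map_iff Ball_def)
  then show ?thesis unfolding weighted_sum_def word_sum_linear by (intro sum.cong) auto
qed

text \<open>The orbits of a permutation in the stabiliser refine the blocks of \<open>I\<close>.
  Either they are the blocks, and the term is \<open>k\<close> times the power sum of
  \<open>I\<close>, or there are strictly more of them.\<close>

lemma weighted_sum_triangular:
  assumes I: "I \<in> superpartitions" "I \<in> sC n m" and k: "k \<noteq> 0"
    and \<epsilon>: "\<And>\<sigma>. orbits_are_fibres {..<m + n} (idx m I) \<sigma> \<Longrightarrow> \<epsilon> \<sigma> = k"
  shows "\<exists>d. d \<noteq> 0 \<and> weighted_sum n m \<epsilon> I - scaleQ d (power_sum I) \<in>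
    superseries.span (power_sum ` {J \<in> superpartitions. J \<in> sC n m \<and> length I < length J})"
proof -
  let ?N = "m + n"
  let ?G = "stabiliser {..<?N} (idx m I)"
  let ?E = "{\<sigma> \<in> ?G. orbits_are_fibres {..<?N} (idx m I) \<sigma>}"
  let ?t = "\<lambda>\<sigma>. scaleQ (\<epsilon> \<sigma>) (kernel_sum n m (orbit_map ?N \<sigma>))"
  let ?V = "superseries.span (power_sum ` {J \<in> superpartitions. J \<in> sC n m \<and> length I < length J})"
  have fin: "finite ?G" by (rule finite_stabiliser) simp
  obtain \<sigma> where "orbits_are_fibres {..<?N} (idx m I) \<sigma>"
    using orbits_are_fibres_exists[of "{..<?N}" "idx m I"] by auto
  then have "\<sigma> \<in> ?E" by (simp add: orbits_are_fibres_def)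
  \<comment> \<open>At least one permutation has the blocks as its orbits, so the diagonal
    coefficient, this cardinality times \<open>k\<close>, is nonzero.\<close>
  then have E: "card ?E \<noteq> 0" using fin by auto
  have sub: "finer ?N (orbit_map ?N \<sigma>) (idx m I)" if "\<sigma> \<in> ?G" for \<sigma>
    using that by (subst finer_orbit_map_iff) (auto simp: stabiliser_def)
  have diag: "?t \<sigma> = scaleQ k (power_sum I)" if "\<sigma> \<in> ?E" for \<sigma>
  proof -
    have "orbit_map ?N \<sigma> x = orbit_map ?N \<sigma> y"
      if xy: "x < ?N" "y < ?N" "idx m I x = idx m I y" for x y
    proof
      fix v
      show "orbit_map ?N \<sigma> x v = orbit_map ?N \<sigma> y v"
        using orbits_are_fibresD[of "{..<?N}" "idx m I" \<sigma> v x y] \<open>\<sigma> \<in> ?E\<close> xy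
        by (auto simp: orbit_map_def)
    qed
    then have "finer ?N (idx m I) (orbit_map ?N \<sigma>)" unfolding finer_def by blast
    then have "kernel_sum n m (orbit_map ?N \<sigma>) = power_sum I"
      using kernel_sum_cong[OF sub] that power_sum_eq_kernel_sum[OF I(2)] by simp
    then show ?thesis using \<epsilon> that by simp
  qed
  have off: "?t \<sigma> \<in> ?V" if \<sigma>: "\<sigma> \<in> ?G - ?E" for \<sigma>
  proof (cases "kernel_sum n m (orbit_map ?N \<sigma>) = 0")
    case True
    then show ?thesis using superseries.span_zero by simp
  next
    case False
    obtain s J where J: "J \<in> superpartitions" "J \<in> sC n m"
      "length J = card (orbit_map ?N \<sigma> ` {..<?N})"
      "kernel_sum n m (orbit_map ?N \<sigma>) = scaleQ s (power_sum J)"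
      using kernel_sum_power_sum[OF False] by blast
    have "\<not> finer ?N (idx m I) (orbit_map ?N \<sigma>)"
    proof
      assume f: "finer ?N (idx m I) (orbit_map ?N \<sigma>)"
      have "v x = v y" if "\<forall>x\<in>{..<?N}. v (\<sigma> x) = v x" "x \<in> {..<?N}" "y \<in> {..<?N}"
        "idx m I x = idx m I y" for x y and v :: "nat \<Rightarrow> nat"
        using finerD[OF f, of x y] orbit_map_eqD[of ?N \<sigma> x y v] that by auto
      then have "orbits_are_fibres {..<?N} (idx m I) \<sigma>"
        using \<sigma> unfolding orbits_are_fibres_def by blast
      then show False using \<sigma> by blast
    qed
    then have "length I < length J"
      using finer_card(2)[OF sub[of \<sigma>]] \<sigma> J(3) length_eq_card[OF I(2)] by force
    then show ?thesis
      unfolding J(4) using J(1,2) by (intro superseries.span_scale superseries.span_base) auto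
  qed
  have "weighted_sum n m \<epsilon> I = (\<Sum>\<sigma>\<in>?G - ?E. ?t \<sigma>) + (\<Sum>\<sigma>\<in>?E. ?t \<sigma>)"
    unfolding weighted_sum_eq by (rule sum.subset_diff) (use fin in auto)
  also have "(\<Sum>\<sigma>\<in>?E. ?t \<sigma>) = (\<Sum>\<sigma>\<in>?E. scaleQ k (power_sum I))"
    by (rule sum.cong[OF refl diag])
  also have "\<dots> = scaleQ (of_nat (card ?E) * k) (power_sum I)"
    by (simp only: superseries.scale_sum_left[symmetric] sum_constant)
  finally have "weighted_sum n m \<epsilon> I - scaleQ (of_nat (card ?E) * k) (power_sum I) \<in> ?V"
    using superseries.span_sum[of "?G - ?E" ?t] off by simp
  then show ?thesis using E k by (intro exI[of _ "of_nat (card ?E) * k"]) simp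
qed

lemma basis_family_weighted_sum:
  assumes v: "\<And>I n m. I \<in> sC n m \<Longrightarrow> v I = weighted_sum n m \<epsilon> I"
    and \<epsilon>: "\<And>I n m. I \<in> sC n m \<Longrightarrow>
      \<exists>k. k \<noteq> 0 \<and> (\<forall>\<sigma>. orbits_are_fibres {..<m + n} (idx m I) \<sigma> \<longrightarrow> \<epsilon> \<sigma> = k)"
  shows "basis_family v superpartitions sNCSym"
proof (rule basis_family_change[where p = power_sum and r = "\<lambda>I. fdeg I + deg I - length I"])
  show "basis_family power_sum superpartitions sNCSym" by (rule basis_family_power_sum)
  let ?r = "\<lambda>I. fdeg I + deg I - length I"
  fix I assume I: "I \<in> superpartitions"
  define n m where "n = deg I" and "m = fdeg I"
  note In = superpartition_bidegree[OF I, folded n_def m_def]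
  obtain k where k: "k \<noteq> 0" "\<And>\<sigma>. orbits_are_fibres {..<m + n} (idx m I) \<sigma> \<Longrightarrow> \<epsilon> \<sigma> = k"
    using \<epsilon>[OF In] by blast
  from weighted_sum_triangular[of I n m k \<epsilon>, OF I In this] obtain d where
    d: "d \<noteq> 0" "v I - scaleQ d (power_sum I) \<in>
      superseries.span (power_sum ` {J \<in> superpartitions. J \<in> sC n m \<and> length I < length J})"
    unfolding v[OF In] by blast
  \<comment> \<open>More blocks must mean smaller rank, hence the complement of the length; both
    tuples have the same bidegree, and \<open>length_le\<close> prevents truncated
    subtraction.\<close>
  have "?r J < ?r I" if "J \<in> sC n m" "length I < length J" for J
    using length_le[OF that(1)] that(2) by (simp add: sC_bidegree[OF that(1)] sC_bidegree[OF In])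
  then have "power_sum ` {J \<in> superpartitions. J \<in> sC n m \<and> length I < length J} \<subseteq>
      power_sum ` {j \<in> superpartitions. ?r j < ?r I}" by blast
  then show "\<exists>d. d \<noteq> 0 \<and> v I - scaleQ d (power_sum I) \<in>
      superseries.span (power_sum ` {j \<in> superpartitions. ?r j < ?r I})"
    using d superseries.span_mono by blast
qed

section \<open>Elementary and complete homogeneous functions\<close>

lemma elementary_eq_weighted_sum:
  assumes K: "K \<in> sC n m"
  shows "elementary K = weighted_sum n m (\<lambda>\<sigma>. of_int (sign \<sigma>)) K"
proof -
  let ?W = "{(a, b) \<in> words n m.
        (\<forall>i<m. \<forall>j\<in>pos (K ! i). a ! i \<noteq> b ! (j - 1)) \<and>
        (\<forall>B\<in>set K. \<forall>i\<in>pos B. \<forall>j\<in>pos B. i \<noteq> j \<longrightarrow> b ! (i - 1) \<noteq> b ! (j - 1))}"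
  have "elementary K = word_sum n m (\<lambda>u. if u \<in> ?W then 1 else 0)"
    unfolding elementary_def sC_bidegree[OF K] by (rule formal_sum_eq_word_sum) auto
  also have "\<dots> = weighted_sum n m (\<lambda>\<sigma>. of_int (sign \<sigma>)) K"
    unfolding weighted_sum_def
  proof (rule word_sum_cong)
    fix a b :: "nat list" assume ab: "length a = m" "length b = n"
    have pos: "1 \<le> j" if "j \<in> pos B" for j B using that by (cases j) (auto simp: pos_def)
    let ?P = "\<lambda>x y. x = y \<or> entry (a, b) x \<noteq> entry (a, b) y"
    have ij: "m + i - 1 = m + j - 1 \<longleftrightarrow> i = j" if "1 \<le> i" "1 \<le> j" for i j
      using that by auto
    \<comment> \<open>A fermionic and a bosonic position never coincide, so for such pairs
      \<open>?P\<close> reduces to inequality of the letters.\<close>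
    have im: "i \<noteq> m + j - 1" if "i < m" "1 \<le> j" for i j using that by auto
    have "(a, b) \<in> ?W \<longleftrightarrow> (\<forall>i<m. \<forall>j\<in>pos (K ! i). ?P i (m + j - 1)) \<and>
      (\<forall>B\<in>set K. \<forall>i\<in>pos B. \<forall>j\<in>pos B. ?P (m + i - 1) (m + j - 1))"
      using ab by (simp add: words_def entry_fst entry_snd[OF ab(1)] pos ij im disj_imp
          del: One_nat_def cong: conj_cong)
    also have "\<dots> \<longleftrightarrow> (\<forall>x<m + n. \<forall>y<m + n. idx m K x = idx m K y \<longrightarrow> ?P x y)"
      by (rule ball_blocks_iff[OF K]) auto
    finally have W: "(a, b) \<in> ?W \<longleftrightarrow> \<dots>" .
    show "(if (a, b) \<in> ?W then 1 else 0 :: rat) = (\<Sum>\<sigma>\<in>stabiliser {..<m + n} (idx m K).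
        of_int (sign \<sigma>) * of_bool (\<forall>x\<in>{..<m + n}. entry (a, b) (\<sigma> x) = entry (a, b) x))"
      unfolding W signed_stabiliser[OF finite_lessThan, where g = "idx m K" and u = "entry (a, b)"]
      by (simp add: Ball_def)
  qed
  finally show ?thesis .
qed

text \<open>Counting 0 in a fermionic block is what makes the block as large as its class of
  positions; the formula is then \<open>card_stabiliser\<close>.\<close>

lemma tuple_fact_eq_card_stabiliser:
  assumes J: "J \<in> sC n m"
  shows "tuple_fact J = card (stabiliser {..<m + n} (idx m J))"
proof -
  have "card (J ! i) = card {x \<in> {..<m + n}. idx m J x = i}" if i: "i < length J" for i
  proof -
    let ?X = "{x \<in> {..<m + n}. idx m J x = i}" and ?f = "\<lambda>x. if x < m then 0 else Suc (x - m)"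
    have img: "J ! i = ?f ` ?X"
    proof
      show "?f ` ?X \<subseteq> J ! i"
      proof
        fix j assume "j \<in> ?f ` ?X"
        then obtain x where x: "j = ?f x" "x < m + n" "idx m J x = i" by blast
        show "j \<in> J ! i"
          using x idx_eq_iff[OF J, of x i] zero_in_block_iff[OF J i] by (cases "x < m") auto
      qed
      show "J ! i \<subseteq> ?f ` ?X"
      proof
        fix j assume j: "j \<in> J ! i"
        show "j \<in> ?f ` ?X"
        proof (cases "j = 0")
          case True
          then have "i < m" using j zero_in_block_iff[OF J i] by simp
          then show ?thesis using True by (intro image_eqI[of _ _ i]) auto
        next
          case False
          then have "j \<in> {1..n}" "idx m J (m + j - 1) = i"
            using j block_eq[OF J i] by (auto split: if_splits)
          then show ?thesis by (intro image_eqI[of _ _ "m + j - 1"]) auto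
        qed
      qed
    qed
    have "inj_on ?f ?X" by (rule inj_onI) (auto split: if_splits)
    then show ?thesis unfolding img by (rule card_image)
  qed
  then show ?thesis
    unfolding tuple_fact_def card_stabiliser[OF finite_lessThan] idx_image[OF J]
    by (simp add: prod.list_conv_set_nth atLeast0LessThan)
qed

text \<open>The type of a word has the kernel of its letters, so preserving the blocks of the meet
  means preserving the blocks of \<open>K\<close> and the letters.\<close>

lemma tuple_fact_meet:
  assumes K: "K \<in> sC n m" and ab: "length a = m" "length b = n" "distinct a"
    and card: "card (set a - set b) \<le> 1"
  shows "tuple_fact (meet n m K (type_of_word n m (a, b))) =
    card {\<sigma> \<in> stabiliser {..<m + n} (idx m K). \<forall>x\<in>{..<m + n}. entry (a, b) (\<sigma> x) = entry (a, b) x}"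
proof -
  define L where "L = type_of_word n m (a, b)"
  note L = type_of_word[OF ab card, folded L_def]
  note J = meet[OF K L(1)]
  let ?J = "meet n m K L"
  have iff: "idx m ?J x = idx m ?J y \<longleftrightarrow> idx m K x = idx m K y \<and> entry (a, b) x = entry (a, b) y"
    if "x < m + n" "y < m + n" for x y
    using finerD[OF J(2) that] finerD[OF J(3) that] finerD[OF L(2) that] finerD[OF L(3) that] by blast
  have "stabiliser {..<m + n} (idx m ?J) =
    {\<sigma> \<in> stabiliser {..<m + n} (idx m K). \<forall>x\<in>{..<m + n}. entry (a, b) (\<sigma> x) = entry (a, b) x}"
  proof (intro set_eqI)
    fix \<sigma>
    show "\<sigma> \<in> stabiliser {..<m + n} (idx m ?J) \<longleftrightarrow> \<sigma> \<in> {\<sigma> \<in> stabiliser {..<m + n} (idx m K).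
        \<forall>x\<in>{..<m + n}. entry (a, b) (\<sigma> x) = entry (a, b) x}"
    proof (cases "\<sigma> permutes {..<m + n}")
      case True
      then have "\<sigma> x < m + n" if "x < m + n" for x using permutes_in_image[OF True, of x] that by simp
      then show ?thesis using True iff by (auto simp: stabiliser_def)
    qed (simp add: stabiliser_def)
  qed
  then show ?thesis using tuple_fact_eq_card_stabiliser[OF J(1)] by (simp add: L_def)
qed

lemma weighted_sum_in_sNCSym: "weighted_sum n m \<epsilon> K \<in> sNCSym"
  unfolding weighted_sum_eq
  by (intro superseries.subspace_sum superseries.subspace_scale sNCSym_subspace kernel_sum_in_sNCSym)

text \<open>
  The words omitted in the definition of \<open>complete_homogeneous\<close> either vanish or cancel, as a
  symmetric series has no monomials with two fermionic indices outside the word.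
\<close>

lemma complete_homogeneous_eq_weighted_sum:
  assumes K: "K \<in> sC n m"
  shows "complete_homogeneous K = weighted_sum n m (\<lambda>_. 1) K"
proof -
  let ?W = "{(a, b) \<in> words n m. distinct a \<and> card (set a - set b) \<le> 1}"
  define C :: "word \<Rightarrow> rat" where "C u = (\<Sum>\<sigma>\<in>stabiliser {..<m + n} (idx m K).
     1 * of_bool (\<forall>x\<in>{..<m + n}. entry u (\<sigma> x) = entry u x))" for u
  have w: "weighted_sum n m (\<lambda>_. 1) K = word_sum n m C"
    unfolding weighted_sum_def C_def ..
  have C: "of_nat (tuple_fact (meet n m K (type_of_word n m u))) = C u" if u: "u \<in> ?W" for u
  proof -
    obtain a b where [simp]: "u = (a, b)" by (cases u)
    have "C u = of_nat (card {\<sigma> \<in> stabiliser {..<m + n} (idx m K).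
        \<forall>x\<in>{..<m + n}. entry (a, b) (\<sigma> x) = entry (a, b) x})"
      unfolding C_def using finite_stabiliser[of "{..<m + n}" "idx m K"]
      by (simp add: of_bool_def sum.If_cases Int_def)
    then show ?thesis using tuple_fact_meet[OF K, of a b] u by (simp add: words_def)
  qed
  have "complete_homogeneous K = word_sum n m (\<lambda>u. if u \<in> ?W
      then of_nat (tuple_fact (meet n m K (type_of_word n m u))) else 0)"
    unfolding complete_homogeneous_def sC_bidegree[OF K] by (rule formal_sum_eq_word_sum) auto
  also have "\<dots> = word_sum n m (\<lambda>u. if u \<in> ?W then C u else 0)"
    using C by (intro arg_cong[where f = "word_sum n m"]) auto
  also have "\<dots> = word_sum n m C"
  proof (rule superseries_eqI)
    fix S :: "nat set" and w assume S: "finite S"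
    let ?L = "{a. set a \<subseteq> S \<and> length a = m}"
    \<comment> \<open>A nonzero contribution forces \<open>set a = S\<close>, so membership depends
      only on \<open>S\<close> and \<open>w\<close>: each coefficient is kept or dropped as a
      whole.\<close>
    have in_W: "(a, w) \<in> ?W \<longleftrightarrow> card (S - set w) \<le> 1"
      if "coeff (word_val (a, w)) S w \<noteq> 0" "a \<in> ?L" "length w = n" for a
      using word_val_nonzero[OF that(1)] that(2,3) by (simp add: words_def)
    show "coeff (word_sum n m (\<lambda>u. if u \<in> ?W then C u else 0)) S w = coeff (word_sum n m C) S w"
    proof (cases "card (S - set w) \<le> 1")
      case True
      show ?thesis
        unfolding coeff_word_sum[OF S] by (rule if_cong[OF refl sum.cong[OF refl] refl]) (use in_W True in force)
    next
      case False
      have "coeff (word_sum n m (\<lambda>u. if u \<in> ?W then C u else 0)) S w = 0"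
        unfolding coeff_word_sum[OF S] using in_W False by (auto intro!: sum.neutral)
      moreover have "\<exists>x y. x \<in> S - set w \<and> y \<in> S - set w \<and> x \<noteq> y"
      proof (rule ccontr)
        assume "\<not> ?thesis"
        then have "card (S - set w) \<le> Suc 0" using S by (subst card_le_Suc0_iff_eq) auto
        then show False using False by simp
      qed
      then have "coeff (word_sum n m C) S w = 0"
        using sNCSym_coeff_zero[OF weighted_sum_in_sNCSym[of n m "\<lambda>_. 1" K, unfolded w]] by blast
      ultimately show ?thesis by simp
    qed
  qed
  finally show ?thesis using w by simp
qed

theorem theorem4p12:
  shows "basis_family power_sum superpartitions sNCSym \<and>
         basis_family elementary superpartitions sNCSym \<and>
         basis_family complete_homogeneous superpartitions sNCSym"
proof (intro conjI)
  show "basis_family power_sum superpartitions sNCSym" by (rule basis_family_power_sum)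
  show "basis_family elementary superpartitions sNCSym"
  proof (rule basis_family_weighted_sum[OF elementary_eq_weighted_sum])
    fix I n m
    show "\<exists>k. k \<noteq> 0 \<and> (\<forall>\<sigma>. orbits_are_fibres {..<m + n} (idx m I) \<sigma> \<longrightarrow> rat_of_int (sign \<sigma>) = k)"
      \<comment> \<open>The common sign of all permutations whose orbits are the blocks of
        \<open>I\<close>.\<close>
      by (intro exI[of _ "(-1) ^ (card {..<m + n} - card (idx m I ` {..<m + n}))"])
        (simp add: sign_orbits_are_fibres[OF finite_lessThan])
  qed
  show "basis_family complete_homogeneous superpartitions sNCSym"
    by (rule basis_family_weighted_sum[OF complete_homogeneous_eq_weighted_sum]) (auto intro: exI[of _ 1])
qed

end
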